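(* Let $\Omega$ be the unit disk of $\mathbb{R}^2$. Let $D$ be a regular domain that is an $\varepsilon$-perturbation of a disk $B$ centered at the origin, with $D\in C[\varepsilon]$ (that is, $B\subset\Omega_0$ has radius larger than $\rho_0$). Let $\alpha$ be a real number in $(0,1)$. Then there exists a constant $C>0$ such that $$\|\Lambda_D(f)-\Lambda_B(f)\|_{\mathrm{H}^{-1/2}(S^1)}\le C\,\varepsilon^{\alpha}\,\|f\|_{\mathrm{H}^{1+\alpha}(S^1)}$$ holds for the boundary measurement $f$ belonging to the Sobolev space $\mathrm{H}^{1+\alpha}(S^1)$.
   Context: $\sigma_1,\sigma_2$ are the constant conductivities, and $\partial\Omega=S^1$. For a connected open set $D$ compactly contained in $\Omega$ and $f\in \mathrm{H}^{1/2}(\partial\Omega)$, let $u$ be the solution in $\mathrm{H}^1(\Omega)$ of $$\mathrm{div}\big((\sigma_1+(\sigma_2-\sigma_1)\chi_D)\nabla u\big)=0\ \text{ in }\Omega,\qquad u=f\ \text{ on }\partial\Omega.$$ The Dirichlet-to-Neumann map is $\Lambda_D:\mathrm{H}^{1/2}(\partial\Omega)\to \mathrm{H}^{-1/2}(\partial\Omega)$, $\Lambda_D(f)=\sigma_1\,\partial_n u|_{\partial\Omega}$, with $n$ the outward unit normal; $\Lambda_B$ is the same map with the disk $B$ as inclusion. Given $\varepsilon\ge0$, a $C^2$ domain $D$ is called an $\varepsilon$-perturbation of a disk $B$ if there exists $\delta\in C^2(\partial B)$ with $\|\delta\|_{C^2(\partial B)}<1$ such that $\partial D=\{x+\varepsilon\,\delta(x)\,\nu(x):x\in\partial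 B\}$, where $\nu(x)$ is the outward unit normal to $\partial B$ at $x$. $\Omega_0\subset\Omega$ is the set of points of $\Omega$ at distance at least $\delta_0$ from $\partial\Omega$, for a fixed $\delta_0>0$. $C[\varepsilon]$ is the class of $\varepsilon$-perturbations of all disks contained in $\Omega_0$ with radius larger than a fixed number $\rho_0$, which can be arbitrarily small provided that it remains big with respect to $\varepsilon$. *)

theory Defs
  imports "HOL-Analysis.Analysis"
begin

text \<open>The plane is the type \<^typ>\<open>complex\<close> with its Euclidean inner product.\<close>

abbreviation Omega :: "complex set" where
  "Omega \<equiv> ball 0 1"

definition square_integrable :: "'a measure \<Rightarrow> ('a \<Rightarrow> 'b::real_normed_vector) \<Rightarrow> bool" where
  "square_integrable M f \<longleftrightarrow> f \<in> borel_measurable M \<and> integrable M (\<lambda>x. (norm (f x))\<^sup>2)"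


section \<open>Sobolev spaces on the unit circle\<close>

text \<open>A function on the circle is a function on \<^typ>\<open>complex\<close> of which only the values
  at the points \<open>cis t\<close> matter; arc length is Lebesgue measure in \<open>t\<close>.\<close>

abbreviation circle_measure :: "real measure" where
  "circle_measure \<equiv> lebesgue_on {0..2*pi}"

definition fourier_coeff :: "(complex \<Rightarrow> real) \<Rightarrow> int \<Rightarrow> complex" where
  "fourier_coeff f n =
     (LINT t|circle_measure. complex_of_real (f (cis t)) * cis (- (of_int n * t))) / complex_of_real (2*pi)"

text \<open>The space \<open>H\<^sup>s(S\<^sup>1)\<close> for \<open>s \<ge> 0\<close>.\<close>

definition sobolev :: "real \<Rightarrow> (complex \<Rightarrow> real) set" where
  "sobolev s = {f. square_integrable circle_measure (\<lambda>t. f (cis t)) \<and>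
     (\<lambda>n::int. (1 + (of_int n)\<^sup>2) powr s * (cmod (fourier_coeff f n))\<^sup>2) summable_on UNIV}"

definition sobolev_norm :: "real \<Rightarrow> (complex \<Rightarrow> real) \<Rightarrow> real" where
  "sobolev_norm s f =
     sqrt (\<Sum>\<^sub>\<infinity>n::int. (1 + (of_int n)\<^sup>2) powr s * (cmod (fourier_coeff f n))\<^sup>2)"

text \<open>The norm of \<open>H\<^sup>-\<^sup>s(S\<^sup>1)\<close>, the dual of \<open>H\<^sup>s(S\<^sup>1)\<close>. It takes values in
  \<^typ>\<open>ennreal\<close> so that the supremum is \<open>\<infinity>\<close> for an unbounded functional.\<close>

definition dual_sobolev_norm :: "real \<Rightarrow> ((complex \<Rightarrow> real) \<Rightarrow> real) \<Rightarrow> ennreal" where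
  "dual_sobolev_norm s l = (SUP g \<in> {g \<in> sobolev s. sobolev_norm s g \<le> 1}. ennreal \<bar>l g\<bar>)"


section \<open>The Sobolev space \<open>H\<^sup>1\<close> of the disk and its traces\<close>

text \<open>Infinite differentiability: \<open>d i j\<close> is the partial derivative of order \<open>i\<close> in the real
  and \<open>j\<close> in the imaginary direction.\<close>

definition partial_derivatives :: "(complex \<Rightarrow> real) \<Rightarrow> (nat \<Rightarrow> nat \<Rightarrow> complex \<Rightarrow> real) \<Rightarrow> bool" where
  "partial_derivatives \<phi> d \<longleftrightarrow> d 0 0 = \<phi> \<and>
     (\<forall>i j z. GDERIV (d i j) z :> Complex (d (Suc i) j z) (d i (Suc j) z))"

definition test_function :: "complex set \<Rightarrow> (complex \<Rightarrow> real) \<Rightarrow> bool" where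
  "test_function U \<phi> \<longleftrightarrow> (\<exists>d. partial_derivatives \<phi> d) \<and>
     (\<exists>K. compact K \<and> K \<subseteq> U \<and> (\<forall>z. z \<notin> K \<longrightarrow> \<phi> z = 0))"

definition weak_gradient :: "complex set \<Rightarrow> (complex \<Rightarrow> real) \<Rightarrow> (complex \<Rightarrow> complex) \<Rightarrow> bool" where
  "weak_gradient U u G \<longleftrightarrow>
     (\<forall>\<phi> \<psi>. test_function U \<phi> \<longrightarrow> (\<forall>z. GDERIV \<phi> z :> \<psi> z) \<longrightarrow>
        (LINT z|lebesgue_on U. u z *\<^sub>R \<psi> z) = - (LINT z|lebesgue_on U. \<phi> z *\<^sub>R G z))"

definition H1 :: "(complex \<Rightarrow> real) \<Rightarrow> (complex \<Rightarrow> complex) \<Rightarrow> bool" where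
  "H1 u G \<longleftrightarrow> square_integrable (lebesgue_on Omega) u \<and> square_integrable (lebesgue_on Omega) G \<and>
     weak_gradient Omega u G"

text \<open>\<open>H1_trace u G g\<close>: the function \<open>u\<close> is in \<open>H\<^sup>1(\<Omega>)\<close>, its gradient is \<open>G\<close> and its
  trace on the unit circle is \<open>g\<close>. The trace operator is the continuous extension of restriction
  to the circle from continuously differentiable functions on the closed disk to \<open>H\<^sup>1(\<Omega>)\<close>.\<close>

definition H1_trace :: "(complex \<Rightarrow> real) \<Rightarrow> (complex \<Rightarrow> complex) \<Rightarrow> (complex \<Rightarrow> real) \<Rightarrow> bool" where
  "H1_trace u G g \<longleftrightarrow> H1 u G \<and> square_integrable circle_measure (\<lambda>t. g (cis t)) \<and>
     (\<exists>(\<phi> :: nat \<Rightarrow> complex \<Rightarrow> real) (\<psi> :: nat \<Rightarrow> complex \<Rightarrow> complex).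
        (\<forall>k. (\<forall>z. GDERIV (\<phi> k) z :> \<psi> k z) \<and> continuous_on UNIV (\<psi> k)) \<and>
        (\<lambda>k. LINT z|lebesgue_on Omega. (\<phi> k z - u z)\<^sup>2) \<longlonglongrightarrow> 0 \<and>
        (\<lambda>k. LINT z|lebesgue_on Omega. (norm (\<psi> k z - G z))\<^sup>2) \<longlonglongrightarrow> 0 \<and>
        (\<lambda>k. LINT t|circle_measure. (\<phi> k (cis t) - g (cis t))\<^sup>2) \<longlonglongrightarrow> 0)"


section \<open>The Dirichlet problem and the Dirichlet-to-Neumann map\<close>

definition conductivity :: "real \<Rightarrow> real \<Rightarrow> complex set \<Rightarrow> complex \<Rightarrow> real" where
  "conductivity \<sigma>1 \<sigma>2 D z = \<sigma>1 + (\<sigma>2 - \<sigma>1) * indicator D z"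

definition energy :: "(complex \<Rightarrow> real) \<Rightarrow> (complex \<Rightarrow> complex) \<Rightarrow> (complex \<Rightarrow> complex) \<Rightarrow> real" where
  "energy \<gamma> G H = (LINT z|lebesgue_on Omega. \<gamma> z * inner (G z) (H z))"

text \<open>\<open>u\<close> (with gradient \<open>G\<close>) is the weak solution of \<open>div(\<gamma> \<nabla>u) = 0\<close> in \<open>\<Omega>\<close>, \<open>u = f\<close> on the
  circle; the test space \<open>H\<^sub>0\<^sup>1(\<Omega>)\<close> is the kernel of the trace.\<close>

definition dirichlet_solution ::
    "(complex \<Rightarrow> real) \<Rightarrow> (complex \<Rightarrow> real) \<Rightarrow> (complex \<Rightarrow> real) \<Rightarrow> (complex \<Rightarrow> complex) \<Rightarrow> bool" where
  "dirichlet_solution \<gamma> f u G \<longleftrightarrow> H1_trace u G f \<and>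
     (\<forall>v H. H1_trace v H (\<lambda>z. 0) \<longrightarrow> energy \<gamma> G H = 0)"

text \<open>The pairing of \<open>\<Lambda>\<^sub>D f\<close> with \<open>g \<in> H\<^sup>1\<^sup>/\<^sup>2(S\<^sup>1)\<close>. For \<open>u\<close> in \<open>H\<^sup>1\<close> only, the normal derivative
  is the element of \<open>H\<^sup>-\<^sup>1\<^sup>/\<^sup>2\<close> given by Green's formula: for every \<open>v\<close> in \<open>H\<^sup>1\<close> with trace \<open>g\<close>,
  \<open>\<langle>\<sigma>1 \<partial>\<^sub>n u, g\<rangle> = \<integral> \<gamma> \<nabla>u \<bullet> \<nabla>v\<close>, because \<open>\<gamma> = \<sigma>1\<close> near the circle. The value does not
  depend on the choice of \<open>v\<close>.\<close>

definition DN_map ::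
    "real \<Rightarrow> real \<Rightarrow> complex set \<Rightarrow> (complex \<Rightarrow> real) \<Rightarrow> (complex \<Rightarrow> real) \<Rightarrow> real" where
  "DN_map \<sigma>1 \<sigma>2 D f g = (THE r. \<exists>u G v H.
     dirichlet_solution (conductivity \<sigma>1 \<sigma>2 D) f u G \<and> H1_trace v H g \<and>
     r = energy (conductivity \<sigma>1 \<sigma>2 D) G H)"


section \<open>Perturbations of disks\<close>

definition C2_fun :: "(real \<Rightarrow> real) \<Rightarrow> bool" where
  "C2_fun h \<longleftrightarrow> h differentiable_on UNIV \<and> deriv h differentiable_on UNIV \<and>
     continuous_on UNIV (deriv (deriv h))"

text \<open>After a rigid motion, \<open>D\<close> is locally the region below the graph of a \<open>C\<^sup>2\<close> function.\<close>

definition C2_domain :: "complex set \<Rightarrow> bool" where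
  "C2_domain D \<longleftrightarrow> open D \<and> connected D \<and> D \<noteq> {} \<and>
     (\<forall>p \<in> frontier D. \<exists>w h a b. cmod w = 1 \<and> C2_fun h \<and> a > 0 \<and> b > 0 \<and>
        (\<forall>x y. \<bar>x\<bar> < a \<and> \<bar>y\<bar> < b \<longrightarrow> (p + w * Complex x y \<in> D \<longleftrightarrow> y < h x)))"

text \<open>Functions on the circle of centre \<open>c\<close> and radius \<open>\<rho>\<close> are differentiated with respect to
  arc length \<open>s\<close>.\<close>

definition arc_lift :: "complex \<Rightarrow> real \<Rightarrow> (complex \<Rightarrow> real) \<Rightarrow> real \<Rightarrow> real" where
  "arc_lift c \<rho> \<delta> s = \<delta> (c + of_real \<rho> * cis (s / \<rho>))"

definition C2_circle_norm :: "complex \<Rightarrow> real \<Rightarrow> (complex \<Rightarrow> real) \<Rightarrow> real" where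
  "C2_circle_norm c \<rho> \<delta> = (SUP s. \<bar>arc_lift c \<rho> \<delta> s\<bar>) + (SUP s. \<bar>deriv (arc_lift c \<rho> \<delta>) s\<bar>) +
     (SUP s. \<bar>deriv (deriv (arc_lift c \<rho> \<delta>)) s\<bar>)"

definition eps_perturbation :: "real \<Rightarrow> complex \<Rightarrow> real \<Rightarrow> complex set \<Rightarrow> bool" where
  "eps_perturbation \<epsilon> c \<rho> D \<longleftrightarrow> C2_domain D \<and>
     (\<exists>\<delta>. C2_fun (arc_lift c \<rho> \<delta>) \<and> C2_circle_norm c \<rho> \<delta> < 1 \<and>
        frontier D = (\<lambda>x. x + (\<epsilon> * \<delta> x) *\<^sub>R ((x - c) /\<^sub>R \<rho>)) ` sphere c \<rho>)"

definition Omega0 :: "real \<Rightarrow> complex set" where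
  "Omega0 \<delta>0 = {x \<in> Omega. infdist x (frontier Omega) \<ge> \<delta>0}"

text \<open>\<open>D\<close> belongs to the class \<open>C[\<epsilon>]\<close> as a perturbation of the disk \<open>ball c \<rho>\<close>. The
  requirement that \<open>\<rho>0\<close> be big with respect to \<open>\<epsilon>\<close> is imposed only in its weakest form
  \<open>\<epsilon> < \<rho>0\<close>.\<close>

definition perturbation_class ::
    "real \<Rightarrow> real \<Rightarrow> real \<Rightarrow> complex \<Rightarrow> real \<Rightarrow> complex set \<Rightarrow> bool" where
  "perturbation_class \<delta>0 \<rho>0 \<epsilon> c \<rho> D \<longleftrightarrow> 0 \<le> \<epsilon> \<and> \<epsilon> < \<rho>0 \<and> \<rho>0 < \<rho> \<and>
     ball c \<rho> \<subseteq> Omega0 \<delta>0 \<and> eps_perturbation \<epsilon> c \<rho> D"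

end

theory Submission
  imports Defs
begin

text \<open>
  Let \<open>u\<close> solve the problem with inclusion \<open>B\<close> and data \<open>f\<close>, and let \<open>v\<^sub>D\<close>, \<open>v\<^sub>B\<close> solve the problems
  with data \<open>g\<close>. Since differences of solutions with equal data have zero trace,
  \<open>\<langle>(\<Lambda>\<^sub>D - \<Lambda>\<^sub>B) f, g\<rangle> = \<integral> (\<gamma>\<^sub>D - \<gamma>\<^sub>B) \<nabla>u \<bullet> \<nabla>v\<^sub>D\<close>, and the integrand lives on the annulus
  \<open>A = {\<rho> - \<epsilon> \<le> |z| \<le> \<rho> + \<epsilon>}\<close>. No regularity theory for the perturbed interface is needed:
  \<open>w = v\<^sub>D - v\<^sub>B\<close> satisfies \<open>\<integral> \<gamma>\<^sub>D |\<nabla>w|\<^sup>2 = - \<integral> (\<gamma>\<^sub>D - \<gamma>\<^sub>B) \<nabla>v\<^sub>B \<bullet> \<nabla>w\<close>, so the norm of \<open>\<nabla>v\<^sub>D\<close> on \<open>A\<close>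
  is bounded by that of \<open>\<nabla>v\<^sub>B\<close>. The solutions for the concentric disk are explicit Fourier
  series, and the norm of their gradient on \<open>A\<close> is at most \<open>C \<epsilon>\<^sup>1\<^sup>/\<^sup>2\<close> times the \<open>H\<^sup>1\<^sup>/\<^sup>2\<close> norm of
  the data. The pairing is therefore even of order \<open>\<epsilon> \<le> \<epsilon>\<^sup>\<alpha>\<close>. If \<open>f\<close> or \<open>g\<close> is the trace of no
  \<open>H\<^sup>1\<close> function, both maps take the same junk value of \<open>THE\<close> and the difference is zero.
\<close>

section \<open>Square-integrable functions\<close>

text \<open>The half power of \<open>\<epsilon>\<close> is available for
  \<open>H\<^sup>1\<^sup>/\<^sup>2\<close> data because the annulus keeps away from the unit circle.
  The energy of the mode of degree n on the disk of radius r is at most a constant times n |c_n|^2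
  r^(2n), and for a < b < 1 the increment b^(2n) - a^(2n) is at most (b - a) / (1 - b) uniformly in
  n; no power of n is lost in the sum. Traces exist only as limits of C^1 functions on the whole
  plane. The explicit solutions have a kink at the interface, so they enter as limits of smoothed
  modes; their weak equation is checked against C^1 functions, by the divergence theorem in polar
  coordinates on each side of the interface, and extended by density. A perturbation is described by
  its frontier alone, whereas the comparison needs D itself to differ from B only on the annulus.
  This follows because each ray from the origin meets the frontier at most once and D is
  bounded.\<close>

definition l2norm :: "'a measure \<Rightarrow> ('a \<Rightarrow> 'b::real_normed_vector) \<Rightarrow> real" where
  "l2norm M f = sqrt (LINT x|M. (norm (f x))\<^sup>2)"

lemma l2norm_nonneg [simp]: "0 \<le> l2norm M f"
  by (simp add: l2norm_def)

lemma l2norm_power2: "(l2norm M f)\<^sup>2 = (LINT x|M. (norm (f x))\<^sup>2)"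
  by (simp add: l2norm_def)

lemma square_integrable_integrable_mult:
  fixes f :: "'a \<Rightarrow> 'b::{real_normed_vector,second_countable_topology}"
    and g :: "'a \<Rightarrow> 'c::{real_normed_vector,second_countable_topology}"
  assumes "square_integrable M f" "square_integrable M g"
  shows "integrable M (\<lambda>x. norm (f x) * norm (g x))"
proof -
  have [measurable]: "f \<in> borel_measurable M" "g \<in> borel_measurable M"
    and i: "integrable M (\<lambda>x. (norm (f x))\<^sup>2 + (norm (g x))\<^sup>2)"
    using assms by (auto simp: square_integrable_def)
  show ?thesis
  proof (rule Bochner_Integration.integrable_bound [OF i])
    show "AE x in M. norm (norm (f x) * norm (g x)) \<le> norm ((norm (f x))\<^sup>2 + (norm (g x))\<^sup>2)"
    proof (intro AE_I2)
      fix x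
      have "2 * norm (f x) * norm (g x) \<le> (norm (f x))\<^sup>2 + (norm (g x))\<^sup>2"
        by (rule sum_squares_bound)
      moreover have "0 \<le> norm (f x) * norm (g x)" by simp
      ultimately show "norm (norm (f x) * norm (g x)) \<le> norm ((norm (f x))\<^sup>2 + (norm (g x))\<^sup>2)"
        unfolding real_norm_def by linarith
    qed
  qed measurable
qed

text \<open>The two functions may take values in different normed spaces, so there is no inner
  product to start from. The argument uses the nonnegative quadratic form in s and t given by the
  integral of \<open>(s * norm (f x) - t * norm (g x))\<^sup>2\<close>.\<close>

lemma l2norm_Cauchy_Schwarz:
  fixes f :: "'a \<Rightarrow> 'b::{real_normed_vector,second_countable_topology}"
    and g :: "'a \<Rightarrow> 'c::{real_normed_vector,second_countable_topology}"
  assumes "square_integrable M f" "square_integrable M g"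
  shows "(LINT x|M. norm (f x) * norm (g x)) \<le> l2norm M f * l2norm M g"
proof -
  define a b c where "a = (LINT x|M. (norm (f x))\<^sup>2)" and "b = (LINT x|M. (norm (g x))\<^sup>2)"
    and "c = (LINT x|M. norm (f x) * norm (g x))"
  have if2: "integrable M (\<lambda>x. (norm (f x))\<^sup>2)" and ig2: "integrable M (\<lambda>x. (norm (g x))\<^sup>2)"
    and im: "integrable M (\<lambda>x. norm (f x) * norm (g x))"
    using assms square_integrable_integrable_mult[OF assms] by (auto simp: square_integrable_def)
  have q: "0 \<le> s\<^sup>2 * a - 2 * s * t * c + t\<^sup>2 * b" for s t
  proof -
    have "0 \<le> (LINT x|M. (s * norm (f x) - t * norm (g x))\<^sup>2)" by simp
    also have "\<dots> = (LINT x|M. s\<^sup>2 * (norm (f x))\<^sup>2 - 2 * s * t * (norm (f x) * norm (g x)) + t\<^sup>2 * (norm (g x))\<^sup>2)"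
      by (rule Bochner_Integration.integral_cong) (auto simp: power2_eq_square algebra_simps)
    also have "\<dots> = s\<^sup>2 * a - 2 * s * t * c + t\<^sup>2 * b"
      using if2 ig2 im by (simp add: a_def b_def c_def)
    finally show ?thesis .
  qed
  have nn: "0 \<le> a" "0 \<le> b" "0 \<le> c" by (auto simp: a_def b_def c_def)
  have "c\<^sup>2 \<le> a * b"
  proof (cases "b = 0")
    case True
    have "c = 0"
    proof (rule ccontr)
      assume "c \<noteq> 0"
      with nn have "c > 0" by simp
      \<comment> \<open>For b = 0 the form is affine in t; this value of t makes it equal to
        -1.\<close>
      have "0 \<le> a - 2 * ((a + 1) / (2*c)) * c" using q[of 1 "(a+1)/(2*c)"] True by (simp add: mult.assoc)
      with \<open>c > 0\<close> show False by simp
    qed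
    with True show ?thesis by simp
  next
    case False
    with nn have "b > 0" by simp
    \<comment> \<open>The choice s = b, t = c gives b (a b - c^2), from which b can be
      cancelled.\<close>
    have "0 \<le> b\<^sup>2 * a - 2 * b * c * c + c\<^sup>2 * b" by (rule q)
    then have "0 \<le> b * (a * b - c\<^sup>2)" by (simp add: power2_eq_square algebra_simps)
    with \<open>b > 0\<close> show ?thesis by (simp add: zero_le_mult_iff)
  qed
  then have "c \<le> sqrt (a * b)" by (rule real_le_rsqrt)
  then show ?thesis by (simp add: real_sqrt_mult a_def b_def c_def l2norm_def)
qed

lemma square_integrable_dominated:
  assumes "square_integrable M g" "f \<in> borel_measurable M" "\<And>x. x \<in> space M \<Longrightarrow> norm (f x) \<le> norm (g x)"
  shows "square_integrable M f"
  unfolding square_integrable_def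
proof (intro conjI)
  show "integrable M (\<lambda>x. (norm (f x))\<^sup>2)"
    by (rule Bochner_Integration.integrable_bound[where f = "\<lambda>x. (norm (g x))\<^sup>2"])
       (use assms in \<open>auto simp: square_integrable_def intro!: power_mono\<close>)
qed fact

lemma square_integrable_scaleR:
  fixes f :: "'a \<Rightarrow> 'b::{real_normed_vector,second_countable_topology}"
  assumes "square_integrable M f"
  shows "square_integrable M (\<lambda>x. c *\<^sub>R f x)"
  using assms by (auto simp: square_integrable_def power_mult_distrib)

lemma square_integrable_add:
  fixes f g :: "'a \<Rightarrow> 'b::{real_normed_vector,second_countable_topology}"
  assumes "square_integrable M f" "square_integrable M g"
  shows "square_integrable M (\<lambda>x. f x + g x)"
  unfolding square_integrable_def
proof (intro conjI)
  have [measurable]: "f \<in> borel_measurable M" "g \<in> borel_measurable M"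
    using assms by (auto simp: square_integrable_def)
  show "(\<lambda>x. f x + g x) \<in> borel_measurable M" by measurable
  have "integrable M (\<lambda>x. (norm (f x))\<^sup>2 + 2 * (norm (f x) * norm (g x)) + (norm (g x))\<^sup>2)"
    using assms square_integrable_integrable_mult[OF assms] by (auto simp: square_integrable_def)
  then show "integrable M (\<lambda>x. (norm (f x + g x))\<^sup>2)"
  proof (rule Bochner_Integration.integrable_bound)
    show "AE x in M. norm ((norm (f x + g x))\<^sup>2) \<le> norm ((norm (f x))\<^sup>2 + 2 * (norm (f x) * norm (g x)) + (norm (g x))\<^sup>2)"
    proof (intro AE_I2)
      fix x
      have "(norm (f x + g x))\<^sup>2 \<le> (norm (f x) + norm (g x))\<^sup>2"
        by (intro power_mono norm_triangle_ineq) simp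
      then show "norm ((norm (f x + g x))\<^sup>2) \<le> norm ((norm (f x))\<^sup>2 + 2 * (norm (f x) * norm (g x)) + (norm (g x))\<^sup>2)"
        by (simp add: power2_sum)
    qed
  qed measurable
qed

lemma square_integrable_diff:
  fixes f g :: "'a \<Rightarrow> 'b::{real_normed_vector,second_countable_topology}"
  assumes "square_integrable M f" "square_integrable M g"
  shows "square_integrable M (\<lambda>x. f x - g x)"
  using square_integrable_add[OF assms(1) square_integrable_scaleR[OF assms(2), of "-1"]] by simp

lemma square_integrable_zero [simp]: "square_integrable M (\<lambda>x. 0)"
  by (simp add: square_integrable_def)

lemma square_integrable_sum:
  fixes f :: "'i \<Rightarrow> 'a \<Rightarrow> 'b::{real_normed_vector,second_countable_topology}"
  assumes "\<And>i. i \<in> I \<Longrightarrow> square_integrable M (f i)"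
  shows "square_integrable M (\<lambda>x. \<Sum>i\<in>I. f i x)"
  using assms by (induction I rule: infinite_finite_induct) (auto intro!: square_integrable_add)

lemma (in finite_measure) square_integrable_bounded:
  assumes "f \<in> borel_measurable M" "\<And>x. x \<in> space M \<Longrightarrow> norm (f x) \<le> B"
  shows "square_integrable M f"
  unfolding square_integrable_def
proof (intro conjI)
  show "integrable M (\<lambda>x. (norm (f x))\<^sup>2)"
    by (rule integrable_const_bound[where B = "B\<^sup>2"])
      (use assms in \<open>auto intro!: AE_I2 power_mono\<close>)
qed fact

lemma l2norm_cong: "(\<And>x. x \<in> space M \<Longrightarrow> norm (f x) = norm (g x)) \<Longrightarrow> l2norm M f = l2norm M g"
  unfolding l2norm_def by (simp cong: Bochner_Integration.integral_cong)

lemma l2norm_scaleR: "l2norm M (\<lambda>x. c *\<^sub>R f x) = \<bar>c\<bar> * l2norm M f"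
  by (simp add: l2norm_def power_mult_distrib real_sqrt_mult)

lemma l2norm_minus_commute: "l2norm M (\<lambda>x. f x - g x) = l2norm M (\<lambda>x. g x - f x)"
  by (simp add: l2norm_def norm_minus_commute)

lemma l2norm_zero [simp]: "l2norm M (\<lambda>x. 0) = 0"
  by (simp add: l2norm_def)

lemma l2norm_triangle:
  fixes f g :: "'a \<Rightarrow> 'b::{real_normed_vector,second_countable_topology}"
  assumes "square_integrable M f" "square_integrable M g"
  shows "l2norm M (\<lambda>x. f x + g x) \<le> l2norm M f + l2norm M g"
proof -
  note i = square_integrable_integrable_mult[OF assms]
  have i1: "integrable M (\<lambda>x. (norm (f x))\<^sup>2 + 2 * (norm (f x) * norm (g x)) + (norm (g x))\<^sup>2)"
    using assms i by (auto simp: square_integrable_def)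
  have "(LINT x|M. (norm (f x + g x))\<^sup>2) \<le>
      (LINT x|M. (norm (f x))\<^sup>2 + 2 * (norm (f x) * norm (g x)) + (norm (g x))\<^sup>2)"
  proof (rule integral_mono)
    show "integrable M (\<lambda>x. (norm (f x + g x))\<^sup>2)"
      using square_integrable_add[OF assms] by (simp add: square_integrable_def)
    fix x
    have "(norm (f x + g x))\<^sup>2 \<le> (norm (f x) + norm (g x))\<^sup>2"
      by (intro power_mono norm_triangle_ineq) simp
    then show "(norm (f x + g x))\<^sup>2 \<le> (norm (f x))\<^sup>2 + 2 * (norm (f x) * norm (g x)) + (norm (g x))\<^sup>2"
      by (simp add: power2_sum)
  qed fact
  also have "\<dots> = (l2norm M f)\<^sup>2 + 2 * (LINT x|M. norm (f x) * norm (g x)) + (l2norm M g)\<^sup>2"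
    using assms i by (simp add: square_integrable_def l2norm_power2)
  also have "\<dots> \<le> (l2norm M f + l2norm M g)\<^sup>2"
    using l2norm_Cauchy_Schwarz[OF assms] by (simp add: power2_sum)
  finally have "(l2norm M (\<lambda>x. f x + g x))\<^sup>2 \<le> (l2norm M f + l2norm M g)\<^sup>2"
    by (simp add: l2norm_power2)
  then show ?thesis by (rule power2_le_imp_le) simp
qed

lemma l2norm_triangle_diff:
  fixes f g h :: "'a \<Rightarrow> 'b::{real_normed_vector,second_countable_topology}"
  assumes "square_integrable M f" "square_integrable M g" "square_integrable M h"
  shows "l2norm M (\<lambda>x. f x - h x) \<le> l2norm M (\<lambda>x. f x - g x) + l2norm M (\<lambda>x. g x - h x)"
  using l2norm_triangle[OF square_integrable_diff[OF assms(1,2)] square_integrable_diff[OF assms(2,3)]]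
  by simp

lemma l2norm_le_add_diff:
  fixes f g :: "'a \<Rightarrow> 'b::{real_normed_vector,second_countable_topology}"
  assumes "square_integrable M f" "square_integrable M g"
  shows "l2norm M f \<le> l2norm M g + l2norm M (\<lambda>x. f x - g x)"
  using l2norm_triangle[OF assms(2) square_integrable_diff[OF assms]] by simp

lemma l2norm_mono:
  assumes "square_integrable M g" "f \<in> borel_measurable M" "\<And>x. x \<in> space M \<Longrightarrow> norm (f x) \<le> norm (g x)"
  shows "l2norm M f \<le> l2norm M g"
  unfolding l2norm_def using assms square_integrable_dominated[OF assms]
  by (intro real_sqrt_le_mono integral_mono power_mono) (auto simp: square_integrable_def)

lemma square_integrable_integrable_inner:
  fixes f g :: "'a \<Rightarrow> 'b::{real_inner,second_countable_topology}"
  assumes "square_integrable M f" "square_integrable M g"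
  shows "integrable M (\<lambda>x. inner (f x) (g x))"
proof (rule Bochner_Integration.integrable_bound[OF square_integrable_integrable_mult[OF assms]])
  show "(\<lambda>x. inner (f x) (g x)) \<in> borel_measurable M"
    using assms by (auto simp: square_integrable_def)
qed (use Cauchy_Schwarz_ineq2 in auto)

lemma abs_integral_inner_le:
  fixes f g :: "'a \<Rightarrow> 'b::{real_inner,second_countable_topology}"
  assumes "square_integrable M f" "square_integrable M g"
  shows "\<bar>LINT x|M. inner (f x) (g x)\<bar> \<le> l2norm M f * l2norm M g"
proof -
  have "\<bar>LINT x|M. inner (f x) (g x)\<bar> \<le> (LINT x|M. \<bar>inner (f x) (g x)\<bar>)"
    by (rule integral_abs_bound)
  also have "\<dots> \<le> (LINT x|M. norm (f x) * norm (g x))"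
    using square_integrable_integrable_inner[OF assms] square_integrable_integrable_mult[OF assms]
    by (intro integral_mono) (auto simp: Cauchy_Schwarz_ineq2)
  also have "\<dots> \<le> l2norm M f * l2norm M g" by (rule l2norm_Cauchy_Schwarz[OF assms])
  finally show ?thesis .
qed

lemma (in finite_measure) square_integrable_integrable:
  fixes f :: "'a \<Rightarrow> 'b::{banach,second_countable_topology}"
  assumes "square_integrable M f"
  shows "integrable M f" "(LINT x|M. norm (f x)) \<le> l2norm M f * sqrt (measure M (space M))"
proof -
  have 1: "square_integrable M (\<lambda>x. 1::real)" by (simp add: square_integrable_def)
  have "integrable M (\<lambda>x. norm (f x))" using square_integrable_integrable_mult[OF assms 1] by simp
  then show "integrable M f" using assms by (simp add: integrable_norm_iff square_integrable_def)
  show "(LINT x|M. norm (f x)) \<le> l2norm M f * sqrt (measure M (space M))"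
    using l2norm_Cauchy_Schwarz[OF assms 1] by (simp add: l2norm_def)
qed

text \<open>Riesz-Fischer for a geometrically fast sequence. On a finite measure space the
  mean-square bounds control the L^1 norms of successive differences, so the telescoping series
  converges absolutely almost everywhere; Fatou's lemma then carries the bound (1/2)^n over to the
  distance from the limit.\<close>

lemma (in finite_measure) l2_complete_fast:
  fixes f :: "nat \<Rightarrow> 'a \<Rightarrow> 'b::{banach,second_countable_topology}"
  assumes sq: "\<And>n. square_integrable M (f n)"
    and fast: "\<And>n m. n \<le> m \<Longrightarrow> l2norm M (\<lambda>x. f m x - f n x) \<le> (1/2)^n"
  obtains g where "square_integrable M g" "(\<lambda>n. l2norm M (\<lambda>x. f n x - g x)) \<longlonglongrightarrow> 0"
proof -
  have [measurable]: "f n \<in> borel_measurable M" for n using sq by (auto simp: square_integrable_def)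
  define K where "K = sqrt (measure M (space M))"
  have sqd: "square_integrable M (\<lambda>x. f m x - f n x)" for m n by (intro square_integrable_diff sq)
  have "AE x in M. summable (\<lambda>n. norm (f (Suc n) x - f n x))"
  proof -
    have int: "integrable M (\<lambda>x. norm (f (Suc n) x - f n x))" for n
      using square_integrable_integrable[OF sqd] by auto
    have le: "(LINT x|M. norm (f (Suc n) x - f n x)) \<le> (1/2)^n * K" for n
    proof (rule order_trans[OF square_integrable_integrable(2)[OF sqd]])
      show "l2norm M (\<lambda>x. f (Suc n) x - f n x) * sqrt (measure M (space M)) \<le> (1/2)^n * K"
        unfolding K_def by (intro mult_right_mono fast) auto
    qed
    have "(\<integral>\<^sup>+x. (\<Sum>n. ennreal (norm (f (Suc n) x - f n x))) \<partial>M)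
        = (\<Sum>n. \<integral>\<^sup>+x. ennreal (norm (f (Suc n) x - f n x)) \<partial>M)"
      by (rule nn_integral_suminf) measurable
    also have "\<dots> = (\<Sum>n. ennreal (LINT x|M. norm (f (Suc n) x - f n x)))"
      using int by (simp add: nn_integral_eq_integral)
    also have "\<dots> \<le> (\<Sum>n. ennreal ((1/2)^n * K))"
      by (intro suminf_le ennreal_leI le) auto
    also have "\<dots> = ennreal (\<Sum>n. (1/2)^n * K)"
      by (rule suminf_ennreal2) (auto simp: K_def intro!: summable_mult2)
    finally have "(\<integral>\<^sup>+x. (\<Sum>n. ennreal (norm (f (Suc n) x - f n x))) \<partial>M) \<noteq> \<infinity>"
      by (auto simp: top_unique)
    then have "AE x in M. (\<Sum>n. ennreal (norm (f (Suc n) x - f n x))) \<noteq> \<infinity>"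
      by (intro nn_integral_noteq_infinite) measurable
    then show ?thesis
      by eventually_elim (auto intro!: summable_suminf_not_top)
  qed
  then have conv: "AE x in M. convergent (\<lambda>n. f n x)"
  proof eventually_elim
    case (elim x)
    then have "summable (\<lambda>n. f (Suc n) x - f n x)" by (rule summable_norm_cancel)
    then have "(\<lambda>n. \<Sum>i<n. f (Suc i) x - f i x) \<longlonglongrightarrow> (\<Sum>n. f (Suc n) x - f n x)"
      by (rule summable_LIMSEQ)
    then have "(\<lambda>n. f n x - f 0 x) \<longlonglongrightarrow> (\<Sum>n. f (Suc n) x - f n x)"
      by (simp only: sum_lessThan_telescope[of "\<lambda>n. f n x"])
    from tendsto_add[OF this tendsto_const[of "f 0 x"]] show ?case
      by (auto simp: convergent_def)
  qed
  \<comment> \<open>Where the sequence diverges \<open>lim\<close> is an unspecified value; those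
    points form a null set, and \<open>g\<close> is measurable all the same.\<close>
  define g where "g x = lim (\<lambda>n. f n x)" for x
  have [measurable]: "g \<in> borel_measurable M" unfolding g_def by measurable
  have lim: "AE x in M. (\<lambda>n. f n x) \<longlonglongrightarrow> g x"
    using conv by eventually_elim (simp add: g_def convergent_LIMSEQ_iff)
  have key: "integrable M (\<lambda>x. (norm (f n x - g x))\<^sup>2) \<and> l2norm M (\<lambda>x. f n x - g x) \<le> (1/2)^n" for n
  proof -
    have "(\<integral>\<^sup>+x. ennreal ((norm (f n x - g x))\<^sup>2) \<partial>M)
        = (\<integral>\<^sup>+x. liminf (\<lambda>m. ennreal ((norm (f n x - f m x))\<^sup>2)) \<partial>M)"
    proof (rule nn_integral_cong_AE)
      show "AE x in M. ennreal ((norm (f n x - g x))\<^sup>2) = liminf (\<lambda>m. ennreal ((norm (f n x - f m x))\<^sup>2))"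
        using lim
      proof eventually_elim
        case (elim x)
        then have "(\<lambda>m. ennreal ((norm (f n x - f m x))\<^sup>2)) \<longlonglongrightarrow> ennreal ((norm (f n x - g x))\<^sup>2)"
          by (intro tendsto_intros)
        then show ?case by (rule lim_imp_Liminf[OF sequentially_bot, symmetric])
      qed
    qed
    also have "\<dots> \<le> liminf (\<lambda>m. \<integral>\<^sup>+x. ennreal ((norm (f n x - f m x))\<^sup>2) \<partial>M)"
      by (rule nn_integral_liminf) measurable
    also have "\<dots> \<le> ennreal (((1/2)^n)\<^sup>2)"
    proof (rule Liminf_le[OF sequentially_bot])
      show "\<forall>\<^sub>F m in sequentially. (\<integral>\<^sup>+x. ennreal ((norm (f n x - f m x))\<^sup>2) \<partial>M) \<le> ennreal (((1/2)^n)\<^sup>2)"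
        using eventually_ge_at_top[of n]
      proof eventually_elim
        case (elim m)
        have "(\<integral>\<^sup>+x. ennreal ((norm (f n x - f m x))\<^sup>2) \<partial>M) = ennreal (LINT x|M. (norm (f n x - f m x))\<^sup>2)"
          using sqd[of n m] by (intro nn_integral_eq_integral) (auto simp: square_integrable_def)
        also have "\<dots> = ennreal ((l2norm M (\<lambda>x. f m x - f n x))\<^sup>2)"
          by (subst l2norm_minus_commute) (simp add: l2norm_power2)
        also have "\<dots> \<le> ennreal (((1/2)^n)\<^sup>2)"
          by (intro ennreal_leI power_mono fast elim) simp
        finally show ?case .
      qed
    qed
    finally have le: "(\<integral>\<^sup>+x. ennreal ((norm (f n x - g x))\<^sup>2) \<partial>M) \<le> ennreal (((1/2)^n)\<^sup>2)" .
    have int: "integrable M (\<lambda>x. (norm (f n x - g x))\<^sup>2)"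
    proof (rule integrableI_bounded)
      show "(\<integral>\<^sup>+x. ennreal (norm ((norm (f n x - g x))\<^sup>2)) \<partial>M) < \<infinity>"
        using le by (auto simp: less_top[symmetric] top_unique)
    qed measurable
    have "ennreal ((l2norm M (\<lambda>x. f n x - g x))\<^sup>2) \<le> ennreal (((1/2)^n)\<^sup>2)"
      using le int by (simp add: nn_integral_eq_integral l2norm_power2)
    then have "(l2norm M (\<lambda>x. f n x - g x))\<^sup>2 \<le> ((1/2)^n)\<^sup>2" by simp
    then have "l2norm M (\<lambda>x. f n x - g x) \<le> (1/2)^n" by (rule power2_le_imp_le) simp
    with int show ?thesis by simp
  qed
  show thesis
  proof
    have "square_integrable M (\<lambda>x. f 0 x - g x)" using key[of 0] by (simp add: square_integrable_def)
    from square_integrable_diff[OF sq[of 0] this] show "square_integrable M g" by simp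
    show "(\<lambda>n. l2norm M (\<lambda>x. f n x - g x)) \<longlonglongrightarrow> 0"
    proof (rule Lim_null_comparison[OF always_eventually])
      show "\<forall>n. norm (l2norm M (\<lambda>x. f n x - g x)) \<le> (1/2)^n" using key by simp
    qed (simp add: LIMSEQ_power_zero)
  qed
qed

text \<open>A Cauchy sequence has a geometrically fast subsequence, and the limit of the subsequence
  is the limit of the whole sequence.\<close>

lemma (in finite_measure) l2_complete:
  fixes f :: "nat \<Rightarrow> 'a \<Rightarrow> 'b::{banach,second_countable_topology}"
  assumes sq: "\<And>n. square_integrable M (f n)"
    and Cauchy: "\<And>e. e > 0 \<Longrightarrow> \<exists>N. \<forall>n\<ge>N. \<forall>m\<ge>N. l2norm M (\<lambda>x. f m x - f n x) < e"
  obtains g where "square_integrable M g" "(\<lambda>n. l2norm M (\<lambda>x. f n x - g x)) \<longlonglongrightarrow> 0"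
proof -
  have "\<exists>N. \<forall>n\<ge>N. \<forall>m\<ge>N. l2norm M (\<lambda>x. f m x - f n x) < (1/2)^k" for k
    by (rule Cauchy) simp
  then obtain N where N: "\<And>k n m. n \<ge> N k \<Longrightarrow> m \<ge> N k \<Longrightarrow> l2norm M (\<lambda>x. f m x - f n x) < (1/2)^k"
    by metis
  \<comment> \<open>The maximum puts \<open>r k\<close> beyond every threshold \<open>N j\<close>
    with j at most k, so that \<open>f (r m)\<close> and \<open>f (r n)\<close> are (1/2)^n close
    for m at least n; the summand k makes \<open>r\<close> tend to infinity.\<close>
  define r where "r k = Max (N ` {..k}) + k" for k
  have rN: "N j \<le> r k" if "j \<le> k" for j k
    unfolding r_def using that by (intro trans_le_add1 Max_ge) auto
  have rk: "k \<le> r k" for k by (simp add: r_def)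
  obtain g where g: "square_integrable M g" "(\<lambda>n. l2norm M (\<lambda>x. f (r n) x - g x)) \<longlonglongrightarrow> 0"
  proof (rule l2_complete_fast[of "\<lambda>n. f (r n)"])
    show "l2norm M (\<lambda>x. f (r m) x - f (r n) x) \<le> (1/2)^n" if "n \<le> m" for n m
      using N[OF rN rN, of n n m] that by simp
  qed (use sq in auto)
  have "(\<lambda>n. l2norm M (\<lambda>x. f n x - g x)) \<longlonglongrightarrow> 0"
  proof (rule LIMSEQ_I)
    fix e :: real assume "e > 0"
    then obtain P where P: "\<And>n m. n \<ge> P \<Longrightarrow> m \<ge> P \<Longrightarrow> l2norm M (\<lambda>x. f m x - f n x) < e/2"
      using Cauchy[of "e/2"] by auto
    obtain Q where Q: "\<And>n. n \<ge> Q \<Longrightarrow> l2norm M (\<lambda>x. f (r n) x - g x) < e/2"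
      using LIMSEQ_D[OF g(2), of "e/2"] \<open>e > 0\<close> by auto
    show "\<exists>no. \<forall>n\<ge>no. norm (l2norm M (\<lambda>x. f n x - g x) - 0) < e"
    proof (intro exI allI impI)
      fix n assume "n \<ge> P"
      have "l2norm M (\<lambda>x. f n x - g x)
          \<le> l2norm M (\<lambda>x. f n x - f (r (P + Q)) x) + l2norm M (\<lambda>x. f (r (P + Q)) x - g x)"
        by (intro l2norm_triangle_diff sq g)
      also have "\<dots> < e/2 + e/2"
        using rk[of "P + Q"] \<open>n \<ge> P\<close> by (intro add_strict_mono P Q) auto
      finally show "norm (l2norm M (\<lambda>x. f n x - g x) - 0) < e" by simp
    qed
  qed
  with g(1) show thesis by (rule that)
qed

section \<open>Polar coordinates in the plane\<close>

text \<open>The change of variables theorem speaks of matrices on \<open>real^'n\<close>. Polar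
  coordinates are therefore set up on \<open>real^2\<close>, and the result is transported
  afterwards to complex numbers and to pairs.\<close>

definition polar2 :: "real^2 \<Rightarrow> real^2" where
  "polar2 v = vector [v$1 * cos (v$2), v$1 * sin (v$2)]"

definition polar2_deriv :: "real^2 \<Rightarrow> real^2 \<Rightarrow> real^2" where
  "polar2_deriv v h = vector [h$1 * cos (v$2) - v$1 * sin (v$2) * h$2, h$1 * sin (v$2) + v$1 * cos (v$2) * h$2]"

lemma has_derivative_polar2: "(polar2 has_derivative polar2_deriv v) (at v within S)"
proof -
  have nth: "((\<lambda>x::real^2. x$i) has_derivative (\<lambda>h. h$i)) (at v within S)" for i
    by (rule bounded_linear.has_derivative[OF bounded_linear_vec_nth has_derivative_ident])
  have "(\<lambda>x. polar2 x $ i) = (\<lambda>v. if i = 1 then v$1 * cos (v$2) else v$1 * sin (v$2))" for i :: 2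
    using exhaust_2[of i] by (auto simp: polar2_def fun_eq_iff)
  moreover have "(\<lambda>h. polar2_deriv v h $ i) = (\<lambda>h. if i = 1 then h$1 * cos (v$2) - v$1 * sin (v$2) * h$2 else h$1 * sin (v$2) + v$1 * cos (v$2) * h$2)" for i :: 2
    using exhaust_2[of i] by (auto simp: polar2_deriv_def fun_eq_iff)
  moreover have "((\<lambda>v::real^2. v$1 * cos (v$2)) has_derivative (\<lambda>h. h$1 * cos (v$2) - v$1 * sin (v$2) * h$2)) (at v within S)"
    by (rule has_derivative_eq_rhs, (rule has_derivative_mult nth has_derivative_cos)+) (auto simp: fun_eq_iff algebra_simps)
  moreover have "((\<lambda>v::real^2. v$1 * sin (v$2)) has_derivative (\<lambda>h. h$1 * sin (v$2) + v$1 * cos (v$2) * h$2)) (at v within S)"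
    by (rule has_derivative_eq_rhs, (rule has_derivative_mult nth has_derivative_sin)+) (auto simp: fun_eq_iff algebra_simps)
  ultimately have "((\<lambda>x. polar2 x $ i) has_derivative (\<lambda>h. polar2_deriv v h $ i)) (at v within S)" for i
    using exhaust_2[of i] by auto
  then show ?thesis
    by (subst has_derivative_componentwise_within) (auto simp: Basis_vec_def inner_axis)
qed

lemma det_polar2_deriv: "det (matrix (polar2_deriv v)) = v$1"
proof -
  have "det (matrix (polar2_deriv v)) = v$1 * (cos (v$2) * cos (v$2)) + v$1 * (sin (v$2) * sin (v$2))"
    by (simp add: det_2 matrix_def polar2_deriv_def axis_def algebra_simps)
  also have "\<dots> = v$1 * ((cos (v$2))\<^sup>2 + (sin (v$2))\<^sup>2)"
    by (simp only: power2_eq_square distrib_left)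
  finally show ?thesis by simp
qed

section \<open>Transport of Lebesgue measure between models of the plane\<close>

definition vec2_complex :: "real^2 \<Rightarrow> complex" where "vec2_complex v = Complex (v$1) (v$2)"
definition vec2_pair :: "real^2 \<Rightarrow> real \<times> real" where "vec2_pair v = (v$1, v$2)"

lemma Basis_real2: "(Basis :: (real^2) set) = {axis 1 1, axis 2 1}" "axis 1 (1::real) \<noteq> (axis 2 1 :: real^2)"
  by (auto simp: Basis_vec_def UNIV_2 axis_eq_axis)

lemma borel_measurable_vec_nth [measurable]: "(\<lambda>v::real^2. v$i) \<in> borel_measurable borel"
  by (intro borel_measurable_continuous_onI continuous_intros)

lemma vec2_complex_measurable [measurable]: "vec2_complex \<in> borel \<rightarrow>\<^sub>M borel"
  unfolding vec2_complex_def
  by (intro borel_measurable_continuous_onI) (auto intro!: continuous_intros)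

lemma vec2_pair_measurable [measurable]: "vec2_pair \<in> borel \<rightarrow>\<^sub>M borel"
  unfolding vec2_pair_def 
  by (intro borel_measurable_continuous_onI) (auto intro!: continuous_intros)

text \<open>Lebesgue measure is determined by its values on boxes, and the identification carries
  boxes to boxes with the same side lengths.\<close>

lemma distr_vec2_complex: "distr lborel borel vec2_complex = lborel"
proof (rule lborel_eqI[symmetric])
  fix l u :: complex assume lu: "\<And>b. b \<in> Basis \<Longrightarrow> l \<bullet> b \<le> u \<bullet> b"
  then have le: "Re l \<le> Re u" "Im l \<le> Im u" using lu[of 1] lu[of \<i>] by (auto simp: Basis_complex_def)
  have eq: "vec2_complex -` box l u = box (vector [Re l, Im l]) (vector [Re u, Im u])"
    by (auto simp: vec2_complex_def mem_box Basis_complex_def Basis_real2 inner_axis)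
  have "emeasure (distr lborel borel vec2_complex) (box l u) = emeasure lborel (box (vector [Re l, Im l]) (vector [Re u, Im u]::real^2))"
    by (subst emeasure_distr) (auto simp: eq)
  also have "\<dots> = ennreal ((Re u - Re l) * (Im u - Im l))"
    using le Basis_real2 by (subst emeasure_lborel_box) (auto simp: Basis_real2 inner_axis ennreal_mult)
  also have "\<dots> = (\<Prod>b\<in>Basis. (u - l) \<bullet> b)" by (simp add: Basis_complex_def)
  finally show "emeasure (distr lborel borel vec2_complex) (box l u) = (\<Prod>b\<in>Basis. (u - l) \<bullet> b)" .
qed simp

lemma distr_vec2_pair: "distr lborel borel vec2_pair = lborel"
proof (rule lborel_eqI[symmetric])
  fix l u :: "real \<times> real" assume lu: "\<And>b. b \<in> Basis \<Longrightarrow> l \<bullet> b \<le> u \<bullet> b"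
  have B: "(Basis :: (real \<times> real) set) = {(1,0),(0,1)}" by (auto simp: Basis_prod_def)
  from lu have le: "fst l \<le> fst u" "snd l \<le> snd u" using lu[of "(1,0)"] lu[of "(0,1)"] by (auto simp: B inner_prod_def)
  have eq: "vec2_pair -` box l u = box (vector [fst l, snd l]) (vector [fst u, snd u])"
    by (auto simp: vec2_pair_def mem_box B Basis_real2 inner_axis inner_prod_def)
  have "emeasure (distr lborel borel vec2_pair) (box l u) = emeasure lborel (box (vector [fst l, snd l]) (vector [fst u, snd u]::real^2))"
    by (subst emeasure_distr) (auto simp: eq)
  also have "\<dots> = ennreal ((fst u - fst l) * (snd u - snd l))"
    using le Basis_real2 by (subst emeasure_lborel_box) (auto simp: Basis_real2 inner_axis ennreal_mult)
  also have "\<dots> = (\<Prod>b\<in>Basis. (u - l) \<bullet> b)" by (simp add: B inner_prod_def)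
  finally show "emeasure (distr lborel borel vec2_pair) (box l u) = (\<Prod>b\<in>Basis. (u - l) \<bullet> b)" .
qed simp

lemma vec2_complex_polar2: "vec2_complex (polar2 v) = of_real (v$1) * cis (v$2)"
  by (simp add: vec2_complex_def polar2_def complex_eq_iff)

lemma inj_vec2_complex: "inj vec2_complex"
  by (auto simp: inj_def vec2_complex_def vec_eq_iff forall_2)

abbreviation polar_strip :: "(real^2) set" where
  "polar_strip \<equiv> {v. 0 < v$1 \<and> 0 < v$2 \<and> v$2 < 2*pi}"

lemma inj_on_polar: "inj_on (\<lambda>(r,t). of_real r * cis t) ({0<..} \<times> {0<..<2*pi})"
proof (rule inj_onI, clarsimp)
  fix r s t u :: real
  assume a: "0 < r" "0 < t" "t < 2 * pi" "0 < s" "0 < u" "u < 2 * pi"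
    and eq: "of_real r * cis t = of_real s * cis u"
  have "norm (of_real r * cis t) = r" "norm (of_real s * cis u) = s" using a by (auto simp: norm_mult)
  with eq have rs: "r = s" by metis
  with eq a have "cis t = cis u" by auto
  then have "cis (t - u) = 1" by (metis cis_divide cis_neq_zero divide_self)
  then have "cos (t - u) = 1" by (metis cis.sel(1) one_complex.sel(1))
  then obtain n :: int where "t - u = of_int n * 2 * pi" using cos_one_2pi_int by auto
  moreover have "\<bar>t - u\<bar> < 2 * pi" using a by linarith
  ultimately have "\<bar>of_int n * (2 * pi)\<bar> < 1 * (2 * pi)" by simp
  then have "\<bar>of_int n :: real\<bar> * (2*pi) < 1 * (2*pi)" by (simp add: abs_mult)
  then have "\<bar>of_int n :: real\<bar> < 1" by (simp only: mult_less_cancel_right) auto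
  then have "n = 0" by linarith
  with \<open>t - u = _\<close> rs show "r = s \<and> t = u" by simp
qed

lemma inj_on_polar2: "inj_on polar2 polar_strip"
proof (rule inj_onI)
  fix v w assume vw: "v \<in> polar_strip" "w \<in> polar_strip" and eq: "polar2 v = polar2 w"
  have "(v$1, v$2) = (w$1, w$2)"
  proof (rule inj_onD[OF inj_on_polar])
    show "(case (v$1, v$2) of (r,t) \<Rightarrow> of_real r * cis t) = (case (w$1, w$2) of (r,t) \<Rightarrow> of_real r * cis t)"
      using arg_cong[OF eq, of vec2_complex] by (simp only: vec2_complex_polar2 prod.case)
  qed (use vw in simp_all)
  then show "v = w" by (simp add: vec_eq_iff forall_2)
qed

text \<open>The open angle interval misses only the nonnegative real axis. Discarding the whole axis
  instead costs nothing in measure and gives a coordinate hyperplane, whose negligibility is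
  standard.\<close>

lemma polar2_image: "- {v. v$2 = 0} \<subseteq> polar2 ` polar_strip"
proof
  fix v :: "real^2" assume v: "v \<in> - {v. v$2 = 0}"
  define z where "z = vec2_complex v"
  define r where "r = cmod z"
  define t where "t = Arg2pi z"
  have z: "Im z \<noteq> 0" using v by (simp add: z_def vec2_complex_def)
  have rt: "z = of_real r * cis t" "0 \<le> t" "t < 2*pi"
    using Arg2pi[of z] by (simp_all add: r_def t_def cis_conv_exp is_Arg_def)
  have "z \<noteq> 0" using z by force
  then have "r > 0" by (simp add: r_def)
  have "t \<noteq> 0" using rt(1) z by (metis cis_zero mult.right_neutral Im_complex_of_real)
  have "vec2_complex (polar2 (vector [r,t])) = vec2_complex v"
    by (subst vec2_complex_polar2) (simp only: vector_2 rt(1)[symmetric] z_def[symmetric])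
  then have "polar2 (vector [r,t]) = v" by (rule injD[OF inj_vec2_complex])
  moreover have "vector [r,t] \<in> polar_strip" using \<open>r > 0\<close> \<open>t \<noteq> 0\<close> rt(2,3) by simp
  ultimately show "v \<in> polar2 ` polar_strip" by blast
qed

lemma polar2_measurable [measurable]: "polar2 \<in> borel \<rightarrow>\<^sub>M borel"
proof (rule borel_measurable_continuous_onI)
  show "continuous_on UNIV polar2"
    by (rule has_derivative_continuous_on[of UNIV polar2 polar2_deriv]) (rule has_derivative_polar2)
qed

lemma polar_strip_measurable [measurable]: "polar_strip \<in> sets borel"
proof -
  have "open polar_strip"
    by (intro open_Collect_conj open_Collect_less continuous_intros)
  then show ?thesis by (rule borel_open)
qed

text \<open>Change of variables on the preimage of a box; boxes suffice because they determine the
  measure. The radius \<open>v$1\<close> is the norm of the image point, so the preimage is bounded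
  and the Jacobian \<open>v$1\<close> is integrable on it.\<close>

lemma emeasure_box_polar:
  fixes l u :: "real^2"
  shows "emeasure lborel (box l u) =
    (\<integral>\<^sup>+v. ennreal (v$1) * indicator (polar_strip \<inter> polar2 -` box l u) v \<partial>lborel)"
proof -
  define S where "S = polar_strip \<inter> polar2 -` box l u"
  have Sb: "S \<in> sets borel"
    unfolding S_def using polar_strip_measurable measurable_sets[OF polar2_measurable, of "box l u"] by auto
  then have Sl: "S \<in> sets lebesgue" by (simp add: sets_completionI_sets)
  obtain R where R: "\<And>x. x \<in> box l u \<Longrightarrow> norm x \<le> R" "R > 0"
    using bounded_box[of l u] by (meson bounded_pos)
  have v1: "0 < v$1" "v$1 \<le> R" if v: "v \<in> S" for v
  proof -
    have "norm (vec2_complex (polar2 v)) = v$1"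
      using that by (simp add: vec2_complex_polar2 norm_mult S_def)
    moreover have "norm (vec2_complex w) = norm w" for w
      by (simp add: vec2_complex_def norm_eq_sqrt_inner[of w] inner_vec_def sum_2 cmod_def power2_eq_square)
    ultimately show "v$1 \<le> R" using R(1)[of "polar2 v"] v by (simp add: S_def)
  qed (use v in \<open>simp add: S_def\<close>)
  have absv1: "\<bar>v$1\<bar> \<le> R" if "v \<in> S" for v using v1[OF that] by simp
  have "S \<subseteq> cbox (vector [0,0]) (vector [R, 2*pi])"
    using v1 by (auto simp: S_def mem_box Basis_real2 inner_axis less_imp_le)
  then have "bounded S" using bounded_cbox bounded_subset by blast
  then have lm: "S \<in> lmeasurable" using Sl by (simp add: bounded_set_imp_lmeasurable)
  then have "emeasure lborel S < \<infinity>" using Sb by (simp add: fmeasurable_def)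
  then have int: "integrable lborel (\<lambda>v. indicator S v *\<^sub>R v$1)"
    using Sb absv1 by (intro integrableI_bounded_set_indicator[where B = R]) (auto intro!: AE_I2)
  then have si: "set_integrable lborel S (\<lambda>v. v$1)" by (simp add: set_integrable_def)
  have eqi: "integral S (\<lambda>v. \<bar>det (matrix (polar2_deriv v))\<bar>) = integral S (\<lambda>v. v$1)"
    using v1(1) by (intro Henstock_Kurzweil_Integration.integral_cong) (auto simp: det_polar2_deriv less_imp_le)
  have "measure lebesgue (polar2 ` S) = integral S (\<lambda>v. \<bar>det (matrix (polar2_deriv v))\<bar>)"
  proof (rule measure_differentiable_image_eq[OF Sl has_derivative_polar2])
    show "inj_on polar2 S" using inj_on_polar2 by (rule inj_on_subset) (auto simp: S_def)
    have "(\<lambda>v. v$1) integrable_on S" using si by (rule set_borel_integral_eq_integral)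
    then show "(\<lambda>v. \<bar>det (matrix (polar2_deriv v))\<bar>) integrable_on S"
      by (rule integrable_eq) (use v1(1) in \<open>auto simp: det_polar2_deriv less_imp_le\<close>)
  qed
  also have "\<dots> = (LINT v|lborel. indicator S v *\<^sub>R v$1)"
    unfolding eqi using set_borel_integral_eq_integral(2)[OF si] by (simp add: set_lebesgue_integral_def)
  finally have m: "measure lebesgue (polar2 ` S) = (LINT v|lborel. indicator S v *\<^sub>R v$1)" .
  have "measure lebesgue (polar2 ` S) = measure lebesgue (box l u)"
  proof (rule measure_negligible_symdiff)
    have "negligible {x::real^2. x \<bullet> axis 2 1 = 0}"
      by (rule negligible_standard_hyperplane) (simp add: Basis_real2)
    then show "negligible (box l u - polar2 ` S \<union> (polar2 ` S - box l u))"
    proof (rule negligible_subset)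
      show "box l u - polar2 ` S \<union> (polar2 ` S - box l u) \<subseteq> {x. x \<bullet> axis 2 1 = 0}"
        using polar2_image by (auto simp: S_def inner_axis)
    qed
  qed simp
  then have "emeasure lborel (box l u) = ennreal (LINT v|lborel. indicator S v *\<^sub>R v$1)"
    using m emeasure_eq_ennreal_measure[of lborel "box l u"] emeasure_lborel_box_finite[of l u] by simp
  also have "\<dots> = (\<integral>\<^sup>+v. ennreal (indicator S v *\<^sub>R v$1) \<partial>lborel)"
    using v1(1) by (intro nn_integral_eq_integral[symmetric] int AE_I2) (auto simp: indicator_def less_imp_le)
  also have "\<dots> = (\<integral>\<^sup>+v. ennreal (v$1) * indicator S v \<partial>lborel)"
    by (intro nn_integral_cong) (auto simp: indicator_def)
  finally show ?thesis by (simp add: S_def)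
qed

lemma lborel_polar2:
  "lborel = distr (density lborel (\<lambda>v. ennreal (v$1) * indicator polar_strip v)) borel polar2"
proof (rule lborel_eqI)
  fix l u :: "real^2" assume lu: "\<And>b. b \<in> Basis \<Longrightarrow> l \<bullet> b \<le> u \<bullet> b"
  have m: "polar2 -` box l u \<in> sets borel"
    using measurable_sets[OF polar2_measurable, of "box l u"] by simp
  have "emeasure (distr (density lborel (\<lambda>v. ennreal (v$1) * indicator polar_strip v)) borel polar2) (box l u)
     = (\<integral>\<^sup>+v. ennreal (v$1) * indicator polar_strip v * indicator (polar2 -` box l u) v \<partial>lborel)"
    using m by (subst emeasure_distr) (auto simp: emeasure_density)
  also have "\<dots> = emeasure lborel (box l u)"
    unfolding emeasure_box_polar by (intro nn_integral_cong) (auto simp: indicator_def)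
  also have "\<dots> = (\<Prod>b\<in>Basis. (u - l) \<bullet> b)" using lu by (rule emeasure_lborel_box)
  finally show "emeasure (distr (density lborel (\<lambda>v. ennreal (v$1) * indicator polar_strip v)) borel polar2) (box l u)
    = (\<Prod>b\<in>Basis. (u - l) \<bullet> b)" .
qed simp

definition polar_density :: "real \<times> real \<Rightarrow> real" where
  "polar_density = (\<lambda>(r,t). r * indicator ({0<..} \<times> {0<..<2*pi}) (r,t))"

lemma polar_density_measurable [measurable]: "polar_density \<in> borel_measurable (lborel \<Otimes>\<^sub>M lborel)"
  unfolding polar_density_def by measurable

lemma borel_measurable_polar [measurable]:
  "(\<lambda>(r,t). of_real r * cis t) \<in> borel_measurable (lborel \<Otimes>\<^sub>M lborel)"
proof -
  have "(\<lambda>(r,t). of_real r * cis t) \<in> borel_measurable borel"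
    by (intro borel_measurable_continuous_onI) (auto simp: case_prod_beta intro!: continuous_intros)
  then show ?thesis by (simp add: lborel_prod)
qed

text \<open>The parametrisation factors in two ways: as \<open>vec2_complex \<circ> polar2\<close>,
  and as the complex polar map after \<open>vec2_pair\<close>. The first is known to yield Lebesgue
  measure, the second exhibits the source as a product.\<close>

lemma lborel_polar:
  "lborel = distr (density (lborel \<Otimes>\<^sub>M lborel) (\<lambda>x. ennreal (polar_density x))) borel (\<lambda>(r,t). of_real r * cis t)"
proof -
  let ?w = "\<lambda>v. ennreal (v$1) * indicator polar_strip v" and ?P = "\<lambda>(r,t). of_real r * cis t :: complex"
  have [measurable]: "polar_density \<in> borel_measurable borel" "?P \<in> borel_measurable borel"
    using polar_density_measurable borel_measurable_polar by (simp_all add: lborel_prod)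
  have w: "?w = (\<lambda>x. ennreal (polar_density x)) \<circ> vec2_pair"
    by (auto simp: fun_eq_iff polar_density_def vec2_pair_def indicator_def)
  have "lborel = distr lborel borel vec2_complex" by (simp add: distr_vec2_complex)
  also have "\<dots> = distr (distr (density lborel ?w) borel polar2) borel vec2_complex"
    by (subst lborel_polar2) simp
  also have "\<dots> = distr (density lborel ?w) borel (vec2_complex \<circ> polar2)"
    by (rule distr_distr) auto
  also have "vec2_complex \<circ> polar2 = ?P \<circ> vec2_pair"
    by (auto simp: fun_eq_iff vec2_complex_polar2 vec2_pair_def)
  also have "distr (density lborel ?w) borel (?P \<circ> vec2_pair)
      = distr (distr (density lborel ?w) borel vec2_pair) borel ?P"
    by (rule distr_distr[symmetric]) auto
  also have "distr (density lborel ?w) borel vec2_pair = density (distr lborel borel vec2_pair) (\<lambda>x. ennreal (polar_density x))"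
    unfolding w comp_def by (rule density_distr[symmetric]) auto
  finally show ?thesis by (simp add: distr_vec2_pair lborel_prod)
qed

lemma integral_polar:
  fixes F :: "complex \<Rightarrow> 'b::{banach,second_countable_topology}"
  assumes [measurable]: "F \<in> borel_measurable borel"
  shows "(LINT z|lborel. F z) =
    (LINT x|(lborel \<Otimes>\<^sub>M lborel). polar_density x *\<^sub>R F (of_real (fst x) * cis (snd x)))"
proof -
  have P: "(\<lambda>(r,t). of_real r * cis t) = (\<lambda>x. of_real (fst x) * cis (snd x))" by (simp add: fun_eq_iff)
  have [measurable]: "(\<lambda>x. of_real (fst x) * cis (snd x)) \<in> borel_measurable (lborel \<Otimes>\<^sub>M lborel)"
    using borel_measurable_polar by (simp add: P)
  have nn: "0 \<le> polar_density x" for x by (auto simp: polar_density_def indicator_def split: prod.split)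
  show ?thesis
    by (subst lborel_polar, unfold P, subst integral_distr, measurable, subst integral_density) (use nn in auto)
qed

section \<open>Integrals over annuli and the divergence theorem\<close>

text \<open>Both boundary circles belong to the set, which makes it compact. For a = 0 it is the
  closed disk, and an inner boundary term weighted by a then disappears.\<close>

definition annulus :: "real \<Rightarrow> real \<Rightarrow> complex set" where
  "annulus a b = {z. a \<le> cmod z \<and> cmod z \<le> b}"

lemma compact_annulus: "compact (annulus a b)"
proof -
  have "annulus a b = cball 0 b \<inter> {z. a \<le> cmod z}" by (auto simp: annulus_def)
  moreover have "closed {z. a \<le> cmod z}" by (intro closed_Collect_le continuous_intros)
  ultimately show ?thesis by (simp add: compact_Int_closed)
qed

lemma annulus_borel [measurable]: "annulus a b \<in> sets borel"
  by (simp add: borel_compact compact_annulus)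

lemma annulus_lebesgue [measurable]: "annulus a b \<in> sets lebesgue"
  by (simp add: sets_completionI_sets)

lemma polar_mem_annulus: "0 \<le> a \<Longrightarrow> r \<in> {a..b} \<Longrightarrow> of_real r * cis t \<in> annulus a b"
  by (simp add: annulus_def norm_mult)

lemma continuous_on_polar_comp:
  assumes "0 \<le> a" "continuous_on (annulus a b) F"
  shows "continuous_on (cbox (a,0) (b,2*pi)) (\<lambda>x. F (of_real (fst x) * cis (snd x)))"
proof (rule continuous_on_compose2[OF assms(2)])
  show "(\<lambda>x. complex_of_real (fst x) * cis (snd x)) ` cbox (a, 0) (b, 2 * pi) \<subseteq> annulus a b"
    using assms(1) polar_mem_annulus by (auto simp: cbox_Pair_eq)
qed (intro continuous_intros)

lemma integral_annulus:
  fixes F :: "complex \<Rightarrow> 'b::euclidean_space"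
  assumes "0 \<le> a" "a \<le> b" and F: "continuous_on (annulus a b) F"
  shows "(LINT z|lebesgue_on (annulus a b). F z) =
    integral {a..b} (\<lambda>r. integral {0..2*pi} (\<lambda>t. r *\<^sub>R F (of_real r * cis t)))"
proof -
  let ?G = "\<lambda>x. fst x *\<^sub>R F (of_real (fst x) * cis (snd x))" and ?Q = "cbox (a,0) (b,2*pi)"
  have contG: "continuous_on ?Q ?G"
    by (intro continuous_intros continuous_on_polar_comp assms)
  have m: "(\<lambda>z. indicator (annulus a b) z *\<^sub>R F z) \<in> borel_measurable borel"
    using F by (intro borel_measurable_continuous_on_indicator) auto
  have "(LINT z|lebesgue_on (annulus a b). F z) = (LINT z|lebesgue. indicator (annulus a b) z *\<^sub>R F z)"
    by (subst integral_restrict_space) auto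
  also have "\<dots> = (LINT z|lborel. indicator (annulus a b) z *\<^sub>R F z)"
    using m by (intro integral_completion) simp
  also have "\<dots> = (LINT x|lborel. polar_density x *\<^sub>R (indicator (annulus a b) (of_real (fst x) * cis (snd x)) *\<^sub>R F (of_real (fst x) * cis (snd x))))"
    unfolding integral_polar[OF m] lborel_prod ..
  also have "\<dots> = (LINT x|lborel. indicator ?Q x *\<^sub>R ?G x)"
  proof (rule integral_cong_AE)
    show "(\<lambda>x. polar_density x *\<^sub>R (indicator (annulus a b) (of_real (fst x) * cis (snd x)) *\<^sub>R F (of_real (fst x) * cis (snd x)))) \<in> borel_measurable lborel"
    proof -
      have [measurable]: "polar_density \<in> borel_measurable borel"
        "(\<lambda>x. of_real (fst x) * cis (snd x) :: complex) \<in> borel_measurable borel"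
        using polar_density_measurable borel_measurable_polar by (simp_all add: lborel_prod case_prod_unfold)
      from measurable_compose[OF this(2) m] show ?thesis by (intro borel_measurable_scaleR[where f = polar_density]) simp_all
    qed
    show "(\<lambda>x. indicator ?Q x *\<^sub>R ?G x) \<in> borel_measurable lborel"
      unfolding measurable_lborel2 by (rule borel_measurable_continuous_on_indicator[OF _ contG]) simp
    \<comment> \<open>The two integrands can differ only on the lines t = 0 and t = 2 pi, because
      \<open>polar_density\<close> uses the open angle interval. At r = 0 both of them
      vanish.\<close>
    have "negligible {x::real\<times>real. x \<bullet> (0,1) = c}" for c
      by (rule negligible_standard_hyperplane) (simp add: Basis_prod_def)
    then have "{x::real\<times>real. x \<bullet> (0,1) = c} \<in> null_sets lebesgue" for c
      by (simp add: negligible_iff_null_sets)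
    moreover have "{x::real\<times>real. x \<bullet> (0,1) = c} \<in> sets lborel" for c
      using closed_Collect_eq[of "\<lambda>x::real\<times>real. x \<bullet> (0,1)" "\<lambda>_. c"] by (simp add: continuous_intros)
    ultimately have "{x::real\<times>real. x \<bullet> (0,1) = c} \<in> null_sets lborel" for c
      by (metis null_sets_completion_iff)
    then have "{x::real\<times>real. x \<bullet> (0,1) = 0} \<union> {x. x \<bullet> (0,1) = 2*pi} \<in> null_sets lborel" by blast
    then show "AE x in lborel. polar_density x *\<^sub>R (indicator (annulus a b) (of_real (fst x) * cis (snd x)) *\<^sub>R F (of_real (fst x) * cis (snd x)))
        = indicator ?Q x *\<^sub>R ?G x"
    proof (rule AE_I', intro subsetI)
      fix x :: "real \<times> real"
      obtain r t where x: "x = (r,t)" by (cases x)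
      assume "x \<in> {x \<in> space lborel. polar_density x *\<^sub>R (indicator (annulus a b) (of_real (fst x) * cis (snd x)) *\<^sub>R F (of_real (fst x) * cis (snd x))) \<noteq> indicator ?Q x *\<^sub>R ?G x}"
      then show "x \<in> {x. x \<bullet> (0,1) = 0} \<union> {x. x \<bullet> (0,1) = 2*pi}"
        using assms(1) unfolding x
        by (cases "r = 0") (auto simp: polar_density_def annulus_def norm_mult indicator_def cbox_Pair_eq inner_prod_def of_bool_def split: if_splits)
    qed
  qed
  also have "\<dots> = integral ?Q ?G"
  proof -
    have "set_integrable lborel ?Q ?G"
      unfolding set_integrable_def by (rule borel_integrable_compact[OF compact_cbox contG])
    from set_borel_integral_eq_integral(2)[OF this] show ?thesis by (simp add: set_lebesgue_integral_def)
  qed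
  also have "\<dots> = integral (cbox a b) (\<lambda>r. integral (cbox 0 (2*pi)) (\<lambda>t. ?G (r,t)))"
    by (rule integral_prod_continuous[OF contG])
  finally show ?thesis by simp
qed

text \<open>In polar coordinates r div X is the radial derivative of r X . e_r plus the angular
  derivative of X . e_t; these are \<open>P\<close> and \<open>T\<close>. The integral of
  \<open>T\<close> over a period is zero, and after exchanging the order of integration
  \<open>P\<close> leaves the boundary terms. By real linearity every directional derivative is
  expressed through the two partial derivatives whose continuity is assumed.\<close>

lemma divergence_annulus:
  fixes X :: "complex \<Rightarrow> complex"
  assumes ab: "0 \<le> a" "a \<le> b"
    and X: "\<And>z. z \<in> annulus a b \<Longrightarrow> (X has_derivative X' z) (at z)"
    and c1: "continuous_on (annulus a b) (\<lambda>z. X' z 1)"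
    and ci: "continuous_on (annulus a b) (\<lambda>z. X' z \<i>)"
  shows "(LINT z|lebesgue_on (annulus a b). Re (X' z 1) + Im (X' z \<i>)) =
     integral {0..2*pi} (\<lambda>t. b * (X (of_real b * cis t) \<bullet> cis t)) -
     integral {0..2*pi} (\<lambda>t. a * (X (of_real a * cis t) \<bullet> cis t))"
proof -
  let ?z = "\<lambda>r t. of_real r * cis t :: complex"
  let ?Q = "cbox (a,0) (b,2*pi)"
  define P where "P r t = X (?z r t) \<bullet> cis t + r * (X' (?z r t) (cis t) \<bullet> cis t)" for r t
  define T where "T r t = X' (?z r t) (of_real r * (\<i> * cis t)) \<bullet> (\<i> * cis t) - X (?z r t) \<bullet> cis t" for r t
  have mem: "r \<in> {a..b} \<Longrightarrow> ?z r t \<in> annulus a b" for r t using polar_mem_annulus ab by blast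
  have lin: "X' z h = Re h *\<^sub>R X' z 1 + Im h *\<^sub>R X' z \<i>" if "z \<in> annulus a b" for z h
  proof -
    interpret bounded_linear "X' z" using X[OF that] by (rule has_derivative_bounded_linear)
    have "h = Re h *\<^sub>R 1 + Im h *\<^sub>R \<i>" by (simp add: complex_eq_iff)
    then have "X' z h = X' z (Re h *\<^sub>R 1 + Im h *\<^sub>R \<i>)" by (rule arg_cong)
    then show ?thesis by (simp only: add scaleR)
  qed
  have linc: "X' (?z r t) (cis t) = cos t *\<^sub>R X' (?z r t) 1 + sin t *\<^sub>R X' (?z r t) \<i>" if "r \<in> {a..b}" for r t
    by (subst lin[OF mem[OF that]]) simp
  have lini: "X' (?z r t) (of_real r * (\<i> * cis t)) = (- r * sin t) *\<^sub>R X' (?z r t) 1 + (r * cos t) *\<^sub>R X' (?z r t) \<i>" if "r \<in> {a..b}" for r t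
    by (subst lin[OF mem[OF that]]) simp
  have sum: "r *\<^sub>R (Re (X' (?z r t) 1) + Im (X' (?z r t) \<i>)) = P r t + T r t" if "r \<in> {a..b}" for r t
  proof -
    have cs: "(cos t)\<^sup>2 = 1 - (sin t)\<^sup>2" by (simp add: cos_squared_eq)
    show ?thesis
      unfolding P_def T_def linc[OF that] lini[OF that]
      by (simp add: inner_complex_def algebra_simps) (use cs in algebra)
  qed
  have contX: "continuous_on (annulus a b) X"
    using X has_derivative_continuous continuous_at_imp_continuous_on by blast
  note cp = continuous_on_polar_comp[OF ab(1)]
  have contP: "continuous_on ?Q (\<lambda>(r,t). P r t)"
  proof -
    have "continuous_on ?Q (\<lambda>x. X (?z (fst x) (snd x)) \<bullet> cis (snd x)
       + fst x * ((cos (snd x) *\<^sub>R X' (?z (fst x) (snd x)) 1 + sin (snd x) *\<^sub>R X' (?z (fst x) (snd x)) \<i>) \<bullet> cis (snd x)))"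
      by (intro continuous_intros cp contX c1 ci)
    then show ?thesis
      by (rule continuous_on_eq) (auto simp: P_def cbox_Pair_eq linc)
  qed
  have contT: "continuous_on ?Q (\<lambda>(r,t). T r t)"
  proof -
    have "continuous_on ?Q (\<lambda>x. ((- fst x * sin (snd x)) *\<^sub>R X' (?z (fst x) (snd x)) 1 + (fst x * cos (snd x)) *\<^sub>R X' (?z (fst x) (snd x)) \<i>) \<bullet> (\<i> * cis (snd x))
        - X (?z (fst x) (snd x)) \<bullet> cis (snd x))"
      by (intro continuous_intros cp contX c1 ci)
    then show ?thesis
      by (rule continuous_on_eq) (auto simp: T_def cbox_Pair_eq lini)
  qed
  have int_t: "(T r has_integral 0) {0..2*pi}" if r: "r \<in> {a..b}" for r
  proof -
    have "(T r has_integral (X (?z r (2*pi)) \<bullet> (\<i> * cis (2*pi)) - X (?z r 0) \<bullet> (\<i> * cis 0))) {0..2*pi}"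
    proof (rule fundamental_theorem_of_calculus)
      fix t assume "t \<in> {0..2*pi}"
      have 1: "((\<lambda>t. ?z r t) has_derivative (\<lambda>h. of_real r * (h *\<^sub>R (\<i> * cis t)))) (at t within {0..2*pi})"
        by (auto intro!: derivative_eq_intros simp: fun_eq_iff complex_eq_iff)
      have 2: "((\<lambda>t. X (?z r t)) has_derivative (\<lambda>h. X' (?z r t) (of_real r * (h *\<^sub>R (\<i> * cis t))))) (at t within {0..2*pi})"
        by (rule has_derivative_compose[OF 1 X[OF mem[OF r]]])
      have 3: "((\<lambda>t. \<i> * cis t) has_derivative (\<lambda>h. - (h *\<^sub>R cis t))) (at t within {0..2*pi})"
        by (auto intro!: derivative_eq_intros simp: fun_eq_iff complex_eq_iff)
      interpret bounded_linear "X' (?z r t)" using X[OF mem[OF r]] by (rule has_derivative_bounded_linear)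
      show "((\<lambda>t. X (?z r t) \<bullet> (\<i> * cis t)) has_vector_derivative T r t) (at t within {0..2*pi})"
        unfolding has_vector_derivative_def
        by (rule has_derivative_eq_rhs[OF has_derivative_inner[OF 2 3]])
          (simp add: fun_eq_iff scaleR T_def right_diff_distrib)
    qed simp
    then show ?thesis by (simp add: cis_2pi)
  qed
  have int_r: "integral {a..b} (\<lambda>r. P r t) = b * (X (?z b t) \<bullet> cis t) - a * (X (?z a t) \<bullet> cis t)" for t
  proof (rule integral_unique, rule fundamental_theorem_of_calculus[OF ab(2)])
    fix r assume r: "r \<in> {a..b}"
    have 1: "((\<lambda>r. ?z r t) has_derivative (\<lambda>h. h *\<^sub>R cis t)) (at r within {a..b})"
      by (auto intro!: derivative_eq_intros simp: fun_eq_iff scaleR_conv_of_real)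
    have 2: "((\<lambda>r. X (?z r t)) has_derivative (\<lambda>h. X' (?z r t) (h *\<^sub>R cis t))) (at r within {a..b})"
      by (rule has_derivative_compose[OF 1 X[OF mem[OF r]]])
    interpret bounded_linear "X' (?z r t)" using X[OF mem[OF r]] by (rule has_derivative_bounded_linear)
    show "((\<lambda>r. r * (X (?z r t) \<bullet> cis t)) has_vector_derivative P r t) (at r within {a..b})"
      unfolding has_vector_derivative_def
      by (rule has_derivative_eq_rhs[OF has_derivative_mult[OF has_derivative_ident has_derivative_inner_left[OF 2]]])
        (simp add: fun_eq_iff scaleR P_def distrib_left mult.left_commute add.commute)
  qed
  have Pt: "continuous_on {0..2*pi} (P r)" if "r \<in> {a..b}" for r
    using continuous_on_compose2[OF contP, of "{0..2*pi}" "\<lambda>t. (r,t)"] that by (auto simp: continuous_intros cbox_Pair_eq image_subset_iff)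
  have "continuous_on (annulus a b) (\<lambda>z. Re (X' z 1) + Im (X' z \<i>))"
    by (intro continuous_intros c1 ci)
  from integral_annulus[OF ab this]
  have "(LINT z|lebesgue_on (annulus a b). Re (X' z 1) + Im (X' z \<i>)) =
      integral {a..b} (\<lambda>r. integral {0..2*pi} (\<lambda>t. r *\<^sub>R (Re (X' (?z r t) 1) + Im (X' (?z r t) \<i>))))" .
  also have "\<dots> = integral {a..b} (\<lambda>r. integral {0..2*pi} (P r))"
  proof (rule Henstock_Kurzweil_Integration.integral_cong)
    fix r assume r: "r \<in> {a..b}"
    have "((\<lambda>t. P r t + T r t) has_integral (integral {0..2*pi} (P r) + 0)) {0..2*pi}"
      by (intro has_integral_add int_t r integrable_integral integrable_continuous_real Pt)
    then show "integral {0..2*pi} (\<lambda>t. r *\<^sub>R (Re (X' (?z r t) 1) + Im (X' (?z r t) \<i>))) = integral {0..2*pi} (P r)"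
      unfolding sum[OF r] by (simp add: integral_unique)
  qed
  also have "\<dots> = integral {0..2*pi} (\<lambda>t. integral {a..b} (\<lambda>r. P r t))"
    using integral_swap_continuous[OF contP] by simp
  also have "\<dots> = integral {0..2*pi} (\<lambda>t. b * (X (?z b t) \<bullet> cis t) - a * (X (?z a t) \<bullet> cis t))"
    by (simp add: int_r)
  also have "\<dots> = integral {0..2*pi} (\<lambda>t. b * (X (?z b t) \<bullet> cis t)) - integral {0..2*pi} (\<lambda>t. a * (X (?z a t) \<bullet> cis t))"
  proof (rule Henstock_Kurzweil_Integration.integral_diff)
    have "continuous_on {0..2*pi} (\<lambda>t. X (?z r t))" if "r \<in> {a..b}" for r
      using mem[OF that] by (intro continuous_on_compose2[OF contX] continuous_intros) auto
    then show "(\<lambda>t. b * (X (?z b t) \<bullet> cis t)) integrable_on {0..2*pi}" "(\<lambda>t. a * (X (?z a t) \<bullet> cis t)) integrable_on {0..2*pi}"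
      using ab by (auto intro!: integrable_continuous_real continuous_intros)
  qed
  finally show ?thesis .
qed

section \<open>Traces as closures of continuously differentiable functions\<close>

abbreviation disk_measure :: "complex measure" where
  "disk_measure \<equiv> lebesgue_on Omega"

text \<open>The pairs that serve as approximants in \<open>H1_trace\<close>. They live on the whole
  plane, so restriction to the disk and to the circle is immediate.\<close>

definition C1_fun :: "(complex \<Rightarrow> real) \<Rightarrow> (complex \<Rightarrow> complex) \<Rightarrow> bool" where
  "C1_fun \<phi> \<psi> \<longleftrightarrow> (\<forall>z. GDERIV \<phi> z :> \<psi> z) \<and> continuous_on UNIV \<psi>"

lemma C1_fun_has_derivative: "C1_fun \<phi> \<psi> \<Longrightarrow> (\<phi> has_derivative (\<lambda>h. h \<bullet> \<psi> z)) (at z)"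
  by (simp add: C1_fun_def gderiv_def)

lemma C1_fun_continuous:
  assumes "C1_fun \<phi> \<psi>"
  shows "continuous_on S \<phi>" "continuous_on S \<psi>"
proof -
  have "continuous_on UNIV \<phi>"
    by (rule has_derivative_continuous_on[where f' = "\<lambda>z h. h \<bullet> \<psi> z"]) (rule C1_fun_has_derivative[OF assms])
  then show "continuous_on S \<phi>" by (rule continuous_on_subset) simp
  have "continuous_on UNIV \<psi>" using assms by (simp add: C1_fun_def)
  then show "continuous_on S \<psi>" by (rule continuous_on_subset) simp
qed

global_interpretation disk_measure: finite_measure disk_measure
  by (rule finite_measure_lebesgue_on) simp

global_interpretation circle_measure: finite_measure circle_measure
  by (rule finite_measure_lebesgue_on) simp

lemma continuous_square_integrable_disk:
  fixes f :: "complex \<Rightarrow> 'b::euclidean_space"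
  assumes "continuous_on UNIV f"
  shows "square_integrable disk_measure f"
proof -
  have "compact (f ` cball 0 1)"
    by (intro compact_continuous_image continuous_on_subset[OF assms]) auto
  then obtain B where B: "\<And>z. z \<in> cball 0 1 \<Longrightarrow> norm (f z) \<le> B"
    by (meson bounded_iff compact_imp_bounded imageI)
  show ?thesis
  proof (rule disk_measure.square_integrable_bounded[where B = B])
    show "f \<in> borel_measurable disk_measure"
      by (intro continuous_imp_measurable_on_sets_lebesgue continuous_on_subset[OF assms]) auto
  qed (use B in auto)
qed

lemma continuous_square_integrable_circle:
  fixes f :: "real \<Rightarrow> 'b::euclidean_space"
  assumes "continuous_on {0..2*pi} f"
  shows "square_integrable circle_measure f"
proof -
  have "compact (f ` {0..2*pi})" by (intro compact_continuous_image assms) auto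
  then obtain B where B: "\<And>t. t \<in> {0..2*pi} \<Longrightarrow> norm (f t) \<le> B"
    by (meson bounded_iff compact_imp_bounded imageI)
  show ?thesis
  proof (rule circle_measure.square_integrable_bounded[where B = B])
    show "f \<in> borel_measurable circle_measure"
      by (intro continuous_imp_measurable_on_sets_lebesgue assms) auto
  qed (use B in auto)
qed

lemma C1_fun_square_integrable:
  assumes "C1_fun \<phi> \<psi>"
  shows "square_integrable disk_measure \<phi>" "square_integrable disk_measure \<psi>"
    "square_integrable circle_measure (\<lambda>t. \<phi> (cis t))"
proof -
  show "square_integrable disk_measure \<phi>" "square_integrable disk_measure \<psi>"
    by (intro continuous_square_integrable_disk C1_fun_continuous[OF assms])+
  have "continuous_on {0..2*pi} (\<lambda>t. \<phi> (cis t))"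
    by (rule continuous_on_compose2[OF C1_fun_continuous(1)[OF assms, of UNIV]]) (auto intro: continuous_intros)
  then show "square_integrable circle_measure (\<lambda>t. \<phi> (cis t))"
    by (rule continuous_square_integrable_circle)
qed

lemma C1_fun_add: "C1_fun \<phi> \<psi> \<Longrightarrow> C1_fun \<phi>' \<psi>' \<Longrightarrow> C1_fun (\<lambda>z. \<phi> z + \<phi>' z) (\<lambda>z. \<psi> z + \<psi>' z)"
  by (auto simp: C1_fun_def intro: GDERIV_add continuous_intros)

lemma C1_fun_scale: "C1_fun \<phi> \<psi> \<Longrightarrow> C1_fun (\<lambda>z. c * \<phi> z) (\<lambda>z. c *\<^sub>R \<psi> z)"
  by (auto simp: C1_fun_def intro!: continuous_intros GDERIV_subst[OF GDERIV_mult[OF GDERIV_const]])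

lemma C1_fun_mult:
  assumes "C1_fun \<phi> \<psi>" "C1_fun \<phi>' \<psi>'"
  shows "C1_fun (\<lambda>z. \<phi> z * \<phi>' z) (\<lambda>z. \<phi> z *\<^sub>R \<psi>' z + \<phi>' z *\<^sub>R \<psi> z)"
  unfolding C1_fun_def
proof (intro conjI allI)
  show "GDERIV (\<lambda>z. \<phi> z * \<phi>' z) z :> \<phi> z *\<^sub>R \<psi>' z + \<phi>' z *\<^sub>R \<psi> z" for z
    using assms by (intro GDERIV_mult) (auto simp: C1_fun_def)
  show "continuous_on UNIV (\<lambda>z. \<phi> z *\<^sub>R \<psi>' z + \<phi>' z *\<^sub>R \<psi> z)"
    by (intro continuous_intros C1_fun_continuous[OF assms(1)] C1_fun_continuous[OF assms(2)])
qed

lemma integral_disk_eq_annulus: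
  fixes F :: "complex \<Rightarrow> 'b::euclidean_space"
  assumes "continuous_on (annulus 0 1) F"
  shows "(LINT z|disk_measure. F z) = (LINT z|lebesgue_on (annulus 0 1). F z)"
proof -
  have m: "(\<lambda>z. indicator (annulus 0 1) z *\<^sub>R F z) \<in> borel_measurable lebesgue"
    using borel_measurable_continuous_on_indicator[OF _ assms] measurable_completion by (auto simp: measurable_completion)
  have eq: "(\<lambda>z. indicator Omega z *\<^sub>R F z) = (\<lambda>z. indicator Omega z *\<^sub>R (indicator (annulus 0 1) z *\<^sub>R F z))"
    by (auto simp: indicator_def annulus_def)
  have m2: "(\<lambda>z. indicator Omega z *\<^sub>R F z) \<in> borel_measurable lebesgue"
    unfolding eq by (rule borel_measurable_scaleR[OF borel_measurable_indicator m]) simp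
  have "sphere (0::complex) 1 \<in> null_sets lebesgue"
    using negligible_sphere negligible_iff_null_sets by blast
  then have "AE z in lebesgue. indicator Omega z *\<^sub>R F z = indicator (annulus 0 1) z *\<^sub>R F z"
    by (rule AE_I') (auto simp: annulus_def indicator_def)
  then have "(LINT z|lebesgue. indicator Omega z *\<^sub>R F z) = (LINT z|lebesgue. indicator (annulus 0 1) z *\<^sub>R F z)"
    by (intro integral_cong_AE m m2)
  then show ?thesis by (simp add: integral_restrict_space)
qed

lemma integral_circle_eq:
  fixes f :: "real \<Rightarrow> 'b::euclidean_space"
  assumes "continuous_on {0..2*pi} f"
  shows "(LINT t|circle_measure. f t) = integral {0..2*pi} f"
  by (intro lebesgue_integral_eq_integral continuous_imp_integrable_real assms) auto

lemma divergence_disk: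
  fixes X :: "complex \<Rightarrow> complex"
  assumes X: "\<And>z. (X has_derivative X' z) (at z)"
    and c1: "continuous_on UNIV (\<lambda>z. X' z 1)" and ci: "continuous_on UNIV (\<lambda>z. X' z \<i>)"
  shows "(LINT z|disk_measure. Re (X' z 1) + Im (X' z \<i>)) = (LINT t|circle_measure. X (cis t) \<bullet> cis t)"
proof -
  note c = continuous_on_subset[OF c1 subset_UNIV] continuous_on_subset[OF ci subset_UNIV]
  have cX: "continuous_on UNIV X"
    by (rule has_derivative_continuous_on[where f' = X']) (rule X)
  have "(LINT z|disk_measure. Re (X' z 1) + Im (X' z \<i>)) = (LINT z|lebesgue_on (annulus 0 1). Re (X' z 1) + Im (X' z \<i>))"
    by (intro integral_disk_eq_annulus continuous_intros c)
  also have "\<dots> = integral {0..2*pi} (\<lambda>t. X (cis t) \<bullet> cis t)"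
    using divergence_annulus[of 0 1 X X', OF _ _ X c] by simp
  also have "\<dots> = (LINT t|circle_measure. X (cis t) \<bullet> cis t)"
    by (intro integral_circle_eq[symmetric] continuous_intros continuous_on_compose2[OF cX]) auto
  finally show ?thesis .
qed

text \<open>A gradient is unique, so \<open>\<psi>\<close> consists of the two first-order entries
  of \<open>d\<close>; these are themselves differentiable, hence continuous.\<close>

lemma partial_derivatives_C1_fun:
  assumes "partial_derivatives \<phi> d" "\<And>z. GDERIV \<phi> z :> \<psi> z"
  shows "C1_fun \<phi> \<psi>"
proof -
  have d: "GDERIV (d i j) z :> Complex (d (Suc i) j z) (d i (Suc j) z)" "d 0 0 = \<phi>" for i j z
    using assms(1) by (auto simp: partial_derivatives_def)
  have "\<psi> z = Complex (d 1 0 z) (d 0 1 z)" for z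
  proof -
    have "(\<lambda>h. h \<bullet> \<psi> z) = (\<lambda>h. h \<bullet> Complex (d 1 0 z) (d 0 1 z))"
    proof (rule has_derivative_unique)
      show "(\<phi> has_derivative (\<lambda>h. h \<bullet> \<psi> z)) (at z)" using assms(2) by (simp add: gderiv_def)
      show "(\<phi> has_derivative (\<lambda>h. h \<bullet> Complex (d 1 0 z) (d 0 1 z))) (at z)"
        using d(1)[of 0 0 z] unfolding d(2) by (simp add: gderiv_def)
    qed
    then have "\<forall>h. h \<bullet> \<psi> z = h \<bullet> Complex (d 1 0 z) (d 0 1 z)" by meson
    then show ?thesis by (simp only: vector_eq_ldot)
  qed
  moreover have "continuous_on UNIV (d i j)" for i j
    by (rule has_derivative_continuous_on[where f' = "\<lambda>z h. h \<bullet> Complex (d (Suc i) j z) (d i (Suc j) z)"])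
      (use d(1)[of i j] in \<open>simp add: gderiv_def\<close>)
  then have "continuous_on UNIV (\<lambda>z. Complex (d 1 0 z) (d 0 1 z))"
    by (intro continuous_intros)
  ultimately show ?thesis using assms(2) by (simp add: C1_fun_def fun_eq_iff)
qed

lemma test_function_C1_fun:
  "test_function U \<phi> \<Longrightarrow> (\<And>z. GDERIV \<phi> z :> \<psi> z) \<Longrightarrow> C1_fun \<phi> \<psi>"
  using partial_derivatives_C1_fun by (auto simp: test_function_def)

text \<open>The divergence of \<open>h z *\<^sub>R w\<close> for a constant vector w is
  \<open>G z \<bullet> w\<close>, and the boundary term vanishes; w is arbitrary.\<close>

lemma integral_gradient_eq_0:
  assumes C: "C1_fun h G" and zero: "\<And>t. h (cis t) = 0"
  shows "(LINT z|disk_measure. G z) = 0"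
proof -
  have int: "integrable disk_measure G"
    using C1_fun_square_integrable(2)[OF C] by (rule disk_measure.square_integrable_integrable)
  have "(LINT z|disk_measure. G z \<bullet> w) = 0" for w
  proof -
    have hd: "(h has_derivative (\<lambda>k. k \<bullet> G z)) (at z)" for z using C by (auto simp: C1_fun_def gderiv_def)
    have "((\<lambda>z. h z *\<^sub>R w) has_derivative (\<lambda>k. (k \<bullet> G z) *\<^sub>R w)) (at z)" for z
      by (rule has_derivative_scaleR_left[OF hd])
    then have "(LINT z|disk_measure. Re ((1 \<bullet> G z) *\<^sub>R w) + Im ((\<i> \<bullet> G z) *\<^sub>R w)) = (LINT t|circle_measure. (h (cis t) *\<^sub>R w) \<bullet> cis t)"
      by (rule divergence_disk) (intro continuous_intros C1_fun_continuous[OF C])+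
    moreover have "Re ((1 \<bullet> G z) *\<^sub>R w) + Im ((\<i> \<bullet> G z) *\<^sub>R w) = G z \<bullet> w" for z
      by (simp add: inner_complex_def)
    ultimately show ?thesis by (simp add: zero)
  qed
  then have "(LINT z|disk_measure. G z) \<bullet> w = 0" for w using int by simp
  then show ?thesis by (metis inner_eq_zero_iff)
qed

lemma square_integrable_integrable_scaleR:
  fixes f :: "'a \<Rightarrow> real" and g :: "'a \<Rightarrow> 'b::euclidean_space"
  assumes "square_integrable M f" "square_integrable M g"
  shows "integrable M (\<lambda>x. f x *\<^sub>R g x)" "norm (LINT x|M. f x *\<^sub>R g x) \<le> l2norm M f * l2norm M g"
proof -
  show "integrable M (\<lambda>x. f x *\<^sub>R g x)"
    by (rule Bochner_Integration.integrable_bound[OF square_integrable_integrable_mult[OF assms]])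
      (use assms in \<open>auto simp: square_integrable_def\<close>)
  have "norm (LINT x|M. f x *\<^sub>R g x) \<le> (LINT x|M. norm (f x *\<^sub>R g x))" by (rule integral_norm_bound)
  also have "\<dots> = (LINT x|M. norm (f x) * norm (g x))" by simp
  also have "\<dots> \<le> l2norm M f * l2norm M g" by (rule l2norm_Cauchy_Schwarz[OF assms])
  finally show "norm (LINT x|M. f x *\<^sub>R g x) \<le> l2norm M f * l2norm M g" .
qed

text \<open>By the product rule the sum of the two integrands is the gradient of the product with
  the test function. That product vanishes on the circle, since the support of the test function is
  a subset of the open disk.\<close>

lemma C1_fun_weak_gradient:
  assumes C: "C1_fun \<phi> \<psi>"
  shows "weak_gradient Omega \<phi> \<psi>"
  unfolding weak_gradient_def
proof (intro allI impI)
  fix \<eta> \<kappa> assume t: "test_function Omega \<eta>" and g: "\<forall>z. GDERIV \<eta> z :> \<kappa> z"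
  then have E: "C1_fun \<eta> \<kappa>" by (intro test_function_C1_fun) auto
  note sq = C1_fun_square_integrable[OF C] C1_fun_square_integrable[OF E]
  have z: "\<phi> (cis t) * \<eta> (cis t) = 0" for t
    using t by (force simp: test_function_def)
  have "(LINT z|disk_measure. \<phi> z *\<^sub>R \<kappa> z + \<eta> z *\<^sub>R \<psi> z) = 0"
    by (rule integral_gradient_eq_0[OF C1_fun_mult[OF C E] z])
  moreover have "(LINT z|disk_measure. \<phi> z *\<^sub>R \<kappa> z + \<eta> z *\<^sub>R \<psi> z) = (LINT z|disk_measure. \<phi> z *\<^sub>R \<kappa> z) + (LINT z|disk_measure. \<eta> z *\<^sub>R \<psi> z)"
    by (intro Bochner_Integration.integral_add square_integrable_integrable_scaleR sq)
  ultimately show "(LINT z|disk_measure. \<phi> z *\<^sub>R \<kappa> z) = - (LINT z|disk_measure. \<eta> z *\<^sub>R \<psi> z)"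
    by (simp add: eq_neg_iff_add_eq_0)
qed

text \<open>A single approximant with three errors below e replaces three convergent sequences; sums
  and limits are then handled by splitting e.\<close>

definition C1_close :: "real \<Rightarrow> (complex \<Rightarrow> real) \<Rightarrow> (complex \<Rightarrow> complex) \<Rightarrow> (complex \<Rightarrow> real) \<Rightarrow> bool" where
  "C1_close e u G g \<longleftrightarrow> (\<exists>\<phi> \<psi>. C1_fun \<phi> \<psi> \<and> l2norm disk_measure (\<lambda>z. \<phi> z - u z) < e \<and>
     l2norm disk_measure (\<lambda>z. \<psi> z - G z) < e \<and> l2norm circle_measure (\<lambda>t. \<phi> (cis t) - g (cis t)) < e)"

text \<open>The weak gradient condition does not appear on the right: it follows from the
  approximation, because integration by parts against a fixed test function is continuous in the
  mean-square sense and holds for the approximants.\<close>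

lemma H1_trace_iff:
  "H1_trace u G g \<longleftrightarrow> square_integrable disk_measure u \<and> square_integrable disk_measure G \<and>
     square_integrable circle_measure (\<lambda>t. g (cis t)) \<and> (\<forall>e>0. C1_close e u G g)"
proof (intro iffI conjI allI impI)
  assume H: "H1_trace u G g"
  then show "square_integrable disk_measure u" "square_integrable disk_measure G" "square_integrable circle_measure (\<lambda>t. g (cis t))"
    by (auto simp: H1_trace_def H1_def)
  fix e :: real assume e: "e > 0"
  obtain \<phi> \<psi> where C: "\<And>k. C1_fun (\<phi> k) (\<psi> k)"
    and 1: "(\<lambda>k. LINT z|disk_measure. (\<phi> k z - u z)\<^sup>2) \<longlonglongrightarrow> 0"
    and 2: "(\<lambda>k. LINT z|disk_measure. (norm (\<psi> k z - G z))\<^sup>2) \<longlonglongrightarrow> 0"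
    and 3: "(\<lambda>k. LINT t|circle_measure. (\<phi> k (cis t) - g (cis t))\<^sup>2) \<longlonglongrightarrow> 0"
    using H by (auto simp: H1_trace_def C1_fun_def)
  have "(\<lambda>k. l2norm disk_measure (\<lambda>z. \<phi> k z - u z)) \<longlonglongrightarrow> 0"
    "(\<lambda>k. l2norm disk_measure (\<lambda>z. \<psi> k z - G z)) \<longlonglongrightarrow> 0"
    "(\<lambda>k. l2norm circle_measure (\<lambda>t. \<phi> k (cis t) - g (cis t))) \<longlonglongrightarrow> 0"
    using tendsto_real_sqrt[OF 1] tendsto_real_sqrt[OF 2] tendsto_real_sqrt[OF 3] by (simp_all add: l2norm_def)
  then have "\<forall>\<^sub>F k in sequentially. l2norm disk_measure (\<lambda>z. \<phi> k z - u z) < e \<and> l2norm disk_measure (\<lambda>z. \<psi> k z - G z) < e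
      \<and> l2norm circle_measure (\<lambda>t. \<phi> k (cis t) - g (cis t)) < e"
    by (intro eventually_conj order_tendstoD(2)[OF _ e])
  from eventually_happens'[OF sequentially_bot this] obtain k where "l2norm disk_measure (\<lambda>z. \<phi> k z - u z) < e \<and> l2norm disk_measure (\<lambda>z. \<psi> k z - G z) < e
      \<and> l2norm circle_measure (\<lambda>t. \<phi> k (cis t) - g (cis t)) < e"
    by blast
  with C[of k] show "C1_close e u G g"
    unfolding C1_close_def by (intro exI[of _ "\<phi> k"] exI[of _ "\<psi> k"]) simp
next
  assume A: "square_integrable disk_measure u \<and> square_integrable disk_measure G \<and>
     square_integrable circle_measure (\<lambda>t. g (cis t)) \<and> (\<forall>e>0. C1_close e u G g)"
  then have sq: "square_integrable disk_measure u" "square_integrable disk_measure G"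
    "square_integrable circle_measure (\<lambda>t. g (cis t))" by auto
  define P where "P k p \<longleftrightarrow> C1_fun (fst p) (snd p) \<and> l2norm disk_measure (\<lambda>z. fst p z - u z) < 1 / Suc k \<and>
     l2norm disk_measure (\<lambda>z. snd p z - G z) < 1 / Suc k \<and>
     l2norm circle_measure (\<lambda>t. fst p (cis t) - g (cis t)) < 1 / Suc k"
    for k :: nat and p :: "(complex \<Rightarrow> real) \<times> (complex \<Rightarrow> complex)"
  have "\<exists>p. P k p" for k
  proof -
    have "C1_close (1 / Suc k) u G g" using A by simp
    then obtain \<phi> \<psi> where "P k (\<phi>, \<psi>)" unfolding C1_close_def P_def by auto
    then show ?thesis by blast
  qed
  then obtain p where p: "\<And>k. P k (p k)" using choice[of P] by blast
  define \<phi> where "\<phi> k = fst (p k)" for k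
  define \<psi> where "\<psi> k = snd (p k)" for k
  have C: "\<And>k. C1_fun (\<phi> k) (\<psi> k)"
    and 1: "\<And>k. l2norm disk_measure (\<lambda>z. \<phi> k z - u z) < 1 / Suc k"
    and 2: "\<And>k. l2norm disk_measure (\<lambda>z. \<psi> k z - G z) < 1 / Suc k"
    and 3: "\<And>k. l2norm circle_measure (\<lambda>t. \<phi> k (cis t) - g (cis t)) < 1 / Suc k"
    using p unfolding P_def \<phi>_def \<psi>_def by auto
  have lim: "(\<lambda>k. (a k)\<^sup>2) \<longlonglongrightarrow> 0" if "\<And>k. a k < 1 / Suc k" "\<And>k. 0 \<le> a k" for a :: "nat \<Rightarrow> real"
  proof -
    have "a \<longlonglongrightarrow> 0"
      by (rule tendsto_sandwich[OF _ _ tendsto_const LIMSEQ_inverse_real_of_nat])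
        (use that in \<open>auto simp: inverse_eq_divide less_imp_le intro!: always_eventually\<close>)
    then show ?thesis using tendsto_power[of a 0 sequentially 2] by simp
  qed
  have "weak_gradient Omega u G"
    unfolding weak_gradient_def
  proof (intro allI impI)
    fix \<eta> \<kappa> assume t: "test_function Omega \<eta>" and g: "\<forall>z. GDERIV \<eta> z :> \<kappa> z"
    then have E: "C1_fun \<eta> \<kappa>" by (intro test_function_C1_fun) auto
    note sE = C1_fun_square_integrable[OF E]
    let ?K = "l2norm disk_measure \<kappa> + l2norm disk_measure \<eta>"
    \<comment> \<open>The defect in integration by parts for \<open>u\<close> and \<open>G\<close>.
      It is zero for the approximants, hence bounded by their errors times the norms of the test
      function and of its gradient.\<close>
    define I where "I = (LINT z|disk_measure. u z *\<^sub>R \<kappa> z) + (LINT z|disk_measure. \<eta> z *\<^sub>R G z)"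
    have "norm I \<le> 1 / Suc k * ?K" for k
    proof -
      note sC = C1_fun_square_integrable[OF C[of k]]
      have "(LINT z|disk_measure. \<phi> k z *\<^sub>R \<kappa> z) + (LINT z|disk_measure. \<eta> z *\<^sub>R \<psi> k z) = 0"
        using C1_fun_weak_gradient[OF C[of k]] t g by (simp add: weak_gradient_def)
      then have "- I = (LINT z|disk_measure. \<phi> k z *\<^sub>R \<kappa> z) - (LINT z|disk_measure. u z *\<^sub>R \<kappa> z)
          + ((LINT z|disk_measure. \<eta> z *\<^sub>R \<psi> k z) - (LINT z|disk_measure. \<eta> z *\<^sub>R G z))"
        by (simp add: I_def algebra_simps)
      also have "\<dots> = (LINT z|disk_measure. (\<phi> k z - u z) *\<^sub>R \<kappa> z) + (LINT z|disk_measure. \<eta> z *\<^sub>R (\<psi> k z - G z))"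
        by (simp add: scaleR_diff_left scaleR_diff_right square_integrable_integrable_scaleR sC sE sq)
      finally have "norm I = norm ((LINT z|disk_measure. (\<phi> k z - u z) *\<^sub>R \<kappa> z) + (LINT z|disk_measure. \<eta> z *\<^sub>R (\<psi> k z - G z)))"
        by (metis norm_minus_cancel)
      also have "\<dots> \<le> l2norm disk_measure (\<lambda>z. \<phi> k z - u z) * l2norm disk_measure \<kappa>
          + l2norm disk_measure \<eta> * l2norm disk_measure (\<lambda>z. \<psi> k z - G z)"
        by (intro norm_triangle_mono square_integrable_integrable_scaleR square_integrable_diff sC sE sq)
      also have "\<dots> \<le> 1 / Suc k * l2norm disk_measure \<kappa> + l2norm disk_measure \<eta> * (1 / Suc k)"
        using 1[of k] 2[of k] by (intro add_mono mult_mono) auto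
      finally show ?thesis by (simp add: algebra_simps)
    qed
    moreover have "(\<lambda>k. 1 / Suc k * ?K) \<longlonglongrightarrow> 0 * ?K"
      by (intro tendsto_mult tendsto_const) (use LIMSEQ_inverse_real_of_nat in \<open>simp add: inverse_eq_divide\<close>)
    ultimately have "norm I \<le> 0 * ?K"
      by (intro LIMSEQ_le_const[of "\<lambda>k. 1 / Suc k * ?K"]) auto
    then have "I = 0" by simp
    then show "(LINT z|disk_measure. u z *\<^sub>R \<kappa> z) = - (LINT z|disk_measure. \<eta> z *\<^sub>R G z)"
      by (simp add: I_def eq_neg_iff_add_eq_0)
  qed
  moreover have "(\<lambda>k. LINT z|disk_measure. (\<phi> k z - u z)\<^sup>2) \<longlonglongrightarrow> 0"
    using lim[OF 1] by (simp add: l2norm_power2)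
  moreover have "(\<lambda>k. LINT z|disk_measure. (norm (\<psi> k z - G z))\<^sup>2) \<longlonglongrightarrow> 0"
    using lim[OF 2] by (simp add: l2norm_power2)
  moreover have "(\<lambda>k. LINT t|circle_measure. (\<phi> k (cis t) - g (cis t))\<^sup>2) \<longlonglongrightarrow> 0"
    using lim[OF 3] by (simp add: l2norm_power2)
  ultimately show "H1_trace u G g"
    unfolding H1_trace_def H1_def
    by (intro conjI sq exI[of _ \<phi>] exI[of _ \<psi>]) (use C in \<open>simp_all add: C1_fun_def\<close>)
qed

section \<open>Algebra, closure and completeness of the trace relation\<close>

lemma H1_trace_square_integrable:
  assumes "H1_trace u G g"
  shows "square_integrable disk_measure u" "square_integrable disk_measure G"
    "square_integrable circle_measure (\<lambda>t. g (cis t))"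
  using assms by (auto simp: H1_trace_iff)

lemma C1_fun_close:
  assumes "H1_trace u G g" "e > 0"
  obtains \<phi> \<psi> where "C1_fun \<phi> \<psi>" "l2norm disk_measure (\<lambda>z. \<phi> z - u z) < e"
     "l2norm disk_measure (\<lambda>z. \<psi> z - G z) < e" "l2norm circle_measure (\<lambda>t. \<phi> (cis t) - g (cis t)) < e"
  using assms by (auto simp: H1_trace_iff C1_close_def)

lemma C1_closeI:
  assumes "C1_fun \<phi> \<psi>" "l2norm disk_measure (\<lambda>z. \<phi> z - u z) < e"
     "l2norm disk_measure (\<lambda>z. \<psi> z - G z) < e" "l2norm circle_measure (\<lambda>t. \<phi> (cis t) - g (cis t)) < e"
  shows "C1_close e u G g"
  unfolding C1_close_def using assms by (intro exI[of _ \<phi>] exI[of _ \<psi>]) simp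

lemma H1_trace_C1_fun:
  assumes "C1_fun \<phi> \<psi>"
  shows "H1_trace \<phi> \<psi> \<phi>"
  unfolding H1_trace_iff using C1_fun_square_integrable[OF assms]
  by (auto intro!: C1_closeI[OF assms])

lemma H1_trace_scale:
  assumes H: "H1_trace u G g"
  shows "H1_trace (\<lambda>z. c * u z) (\<lambda>z. c *\<^sub>R G z) (\<lambda>z. c * g z)"
  unfolding H1_trace_iff
proof (intro conjI allI impI)
  note sq = H1_trace_square_integrable[OF H]
  show "square_integrable disk_measure (\<lambda>z. c * u z)" "square_integrable disk_measure (\<lambda>z. c *\<^sub>R G z)"
    "square_integrable circle_measure (\<lambda>t. c * g (cis t))"
    using sq[THEN square_integrable_scaleR, of c] by simp_all
  fix e :: real assume "e > 0"
  then have "e / (\<bar>c\<bar> + 1) > 0" by simp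
  then obtain \<phi> \<psi> where C: "C1_fun \<phi> \<psi>" and 1: "l2norm disk_measure (\<lambda>z. \<phi> z - u z) < e / (\<bar>c\<bar> + 1)"
     "l2norm disk_measure (\<lambda>z. \<psi> z - G z) < e / (\<bar>c\<bar> + 1)" "l2norm circle_measure (\<lambda>t. \<phi> (cis t) - g (cis t)) < e / (\<bar>c\<bar> + 1)"
    using C1_fun_close[OF H] by blast
  have le: "\<bar>c\<bar> * x < e" if "x < e / (\<bar>c\<bar> + 1)" "0 \<le> x" for x
  proof -
    have "(\<bar>c\<bar> + 1) * x < e" using that(1) by (simp add: field_simps)
    moreover have "\<bar>c\<bar> * x \<le> (\<bar>c\<bar> + 1) * x" using that(2) by (intro mult_right_mono) auto
    ultimately show ?thesis by linarith
  qed
  show "C1_close e (\<lambda>z. c * u z) (\<lambda>z. c *\<^sub>R G z) (\<lambda>z. c * g z)"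
  proof (rule C1_closeI[OF C1_fun_scale[OF C]])
    show "l2norm disk_measure (\<lambda>z. c * \<phi> z - c * u z) < e"
      using l2norm_scaleR[of disk_measure c "\<lambda>z. \<phi> z - u z"] le[OF 1(1)] by (simp add: right_diff_distrib)
    show "l2norm disk_measure (\<lambda>z. c *\<^sub>R \<psi> z - c *\<^sub>R G z) < e"
      using l2norm_scaleR[of disk_measure c "\<lambda>z. \<psi> z - G z"] le[OF 1(2)] by (simp add: scaleR_diff_right)
    show "l2norm circle_measure (\<lambda>t. c * \<phi> (cis t) - c * g (cis t)) < e"
      using l2norm_scaleR[of circle_measure c "\<lambda>t. \<phi> (cis t) - g (cis t)"] le[OF 1(3)] by (simp add: right_diff_distrib)
  qed
qed

lemma l2norm_add_diff_less:
  fixes f g f' g' :: "'a \<Rightarrow> 'b::{real_normed_vector,second_countable_topology}"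
  assumes "square_integrable M f" "square_integrable M g" "square_integrable M f'" "square_integrable M g'"
    and "l2norm M (\<lambda>x. f x - g x) < a" "l2norm M (\<lambda>x. f' x - g' x) < b"
  shows "l2norm M (\<lambda>x. (f x + f' x) - (g x + g' x)) < a + b"
proof -
  have "l2norm M (\<lambda>x. (f x - g x) + (f' x - g' x)) \<le> l2norm M (\<lambda>x. f x - g x) + l2norm M (\<lambda>x. f' x - g' x)"
    by (intro l2norm_triangle square_integrable_diff assms)
  also have "\<dots> < a + b" using assms by simp
  finally show ?thesis by (simp add: add_diff_add)
qed

lemma H1_trace_add:
  assumes H: "H1_trace u G g" and H': "H1_trace u' G' g'"
  shows "H1_trace (\<lambda>z. u z + u' z) (\<lambda>z. G z + G' z) (\<lambda>z. g z + g' z)"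
  unfolding H1_trace_iff
proof (intro conjI allI impI square_integrable_add H1_trace_square_integrable[OF H] H1_trace_square_integrable[OF H'])
  fix e :: real assume "e > 0"
  then have e2: "e / 2 > 0" by simp
  note sq = H1_trace_square_integrable[OF H] H1_trace_square_integrable[OF H']
  obtain \<phi> \<psi> where C: "C1_fun \<phi> \<psi>" and 1: "l2norm disk_measure (\<lambda>z. \<phi> z - u z) < e / 2"
     "l2norm disk_measure (\<lambda>z. \<psi> z - G z) < e / 2" "l2norm circle_measure (\<lambda>t. \<phi> (cis t) - g (cis t)) < e / 2"
    using C1_fun_close[OF H e2] by blast
  obtain \<phi>' \<psi>' where C': "C1_fun \<phi>' \<psi>'" and l1': "l2norm disk_measure (\<lambda>z. \<phi>' z - u' z) < e / 2"
     "l2norm disk_measure (\<lambda>z. \<psi>' z - G' z) < e / 2" "l2norm circle_measure (\<lambda>t. \<phi>' (cis t) - g' (cis t)) < e / 2"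
    using C1_fun_close[OF H' e2] by blast
  note sC = C1_fun_square_integrable[OF C] C1_fun_square_integrable[OF C']
  note l = l2norm_add_diff_less[where a = "e/2" and b = "e/2", unfolded field_sum_of_halves]
  show "C1_close e (\<lambda>z. u z + u' z) (\<lambda>z. G z + G' z) (\<lambda>z. g z + g' z)"
    by (intro C1_closeI[OF C1_fun_add[OF C C']] l sC sq 1 l1')
qed

lemma H1_trace_diff:
  assumes H: "H1_trace u G g" and H': "H1_trace u' G' g'"
  shows "H1_trace (\<lambda>z. u z - u' z) (\<lambda>z. G z - G' z) (\<lambda>z. g z - g' z)"
  using H1_trace_add[OF H H1_trace_scale[OF H', of "-1"]] by simp

lemma H1_trace_zero: "H1_trace (\<lambda>z. 0) (\<lambda>z. 0) (\<lambda>z. 0)"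
  by (rule H1_trace_C1_fun) (auto simp: C1_fun_def GDERIV_const)

lemma H1_trace_sum:
  assumes "\<And>i. i \<in> I \<Longrightarrow> H1_trace (u i) (G i) (g i)"
  shows "H1_trace (\<lambda>z. \<Sum>i\<in>I. u i z) (\<lambda>z. \<Sum>i\<in>I. G i z) (\<lambda>z. \<Sum>i\<in>I. g i z)"
  using assms by (induction I rule: infinite_finite_induct) (auto intro: H1_trace_zero H1_trace_add)

text \<open>The relation is the closure of the C^1 triples, hence closed: half of e is spent on
  reaching a member of the sequence, the other half on approximating that member.\<close>

lemma H1_trace_closed:
  assumes sq: "square_integrable disk_measure u" "square_integrable disk_measure G"
    "square_integrable circle_measure (\<lambda>t. g (cis t))"
    and H: "\<And>k. H1_trace (u' k) (G' k) (g' k)"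
    and lim: "(\<lambda>k. l2norm disk_measure (\<lambda>z. u' k z - u z)) \<longlonglongrightarrow> 0"
      "(\<lambda>k. l2norm disk_measure (\<lambda>z. G' k z - G z)) \<longlonglongrightarrow> 0"
      "(\<lambda>k. l2norm circle_measure (\<lambda>t. g' k (cis t) - g (cis t))) \<longlonglongrightarrow> 0"
  shows "H1_trace u G g"
  unfolding H1_trace_iff
proof (intro conjI allI impI sq)
  fix e :: real assume "e > 0"
  then have e2: "e / 2 > 0" by simp
  have "\<forall>\<^sub>F k in sequentially. l2norm disk_measure (\<lambda>z. u' k z - u z) < e/2 \<and> l2norm disk_measure (\<lambda>z. G' k z - G z) < e/2
      \<and> l2norm circle_measure (\<lambda>t. g' k (cis t) - g (cis t)) < e/2"
    by (intro eventually_conj order_tendstoD(2)[OF lim(1) e2] order_tendstoD(2)[OF lim(2) e2] order_tendstoD(2)[OF lim(3) e2])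
  from eventually_happens'[OF sequentially_bot this]
  obtain k where k: "l2norm disk_measure (\<lambda>z. u' k z - u z) < e/2" "l2norm disk_measure (\<lambda>z. G' k z - G z) < e/2"
      "l2norm circle_measure (\<lambda>t. g' k (cis t) - g (cis t)) < e/2"
    by blast
  obtain \<phi> \<psi> where C: "C1_fun \<phi> \<psi>" and 1: "l2norm disk_measure (\<lambda>z. \<phi> z - u' k z) < e / 2"
     "l2norm disk_measure (\<lambda>z. \<psi> z - G' k z) < e / 2" "l2norm circle_measure (\<lambda>t. \<phi> (cis t) - g' k (cis t)) < e / 2"
    using C1_fun_close[OF H e2] by blast
  note sq' = H1_trace_square_integrable[OF H[of k]] C1_fun_square_integrable[OF C] sq
  show "C1_close e u G g"
  proof (rule C1_closeI[OF C])
    show "l2norm disk_measure (\<lambda>z. \<phi> z - u z) < e"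
      using l2norm_triangle_diff[OF sq'(4) sq'(1) sq'(7)] 1(1) k(1) by linarith
    show "l2norm disk_measure (\<lambda>z. \<psi> z - G z) < e"
      using l2norm_triangle_diff[OF sq'(5) sq'(2) sq'(8)] 1(2) k(2) by linarith
    show "l2norm circle_measure (\<lambda>t. \<phi> (cis t) - g (cis t)) < e"
      using l2norm_triangle_diff[OF sq'(6) sq'(3) sq'(9)] 1(3) k(3) by linarith
  qed
qed

text \<open>The divergence of \<open>(\<phi> z * \<phi> z) *\<^sub>R z\<close> is 2 \<phi>^2 + 2
  \<phi> (\<psi> . z), and its flux through the circle is the integral of \<phi>^2 there. With a, b,
  c for the three norms this gives 2 a (a - b) <= c^2, which excludes a > b + c.\<close>

lemma C1_fun_Poincare:
  assumes C: "C1_fun \<phi> \<psi>"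
  shows "l2norm disk_measure \<phi> \<le> l2norm disk_measure \<psi> + l2norm circle_measure (\<lambda>t. \<phi> (cis t))"
proof -
  let ?a = "l2norm disk_measure \<phi>" and ?b = "l2norm disk_measure \<psi>" and ?c = "l2norm circle_measure (\<lambda>t. \<phi> (cis t))"
  note sq = C1_fun_square_integrable[OF C]
  note ct = C1_fun_continuous[OF C]
  let ?X' = "\<lambda>z h. (\<phi> z * \<phi> z) *\<^sub>R h + (2 * \<phi> z * (h \<bullet> \<psi> z)) *\<^sub>R z"
  have X: "((\<lambda>z. (\<phi> z * \<phi> z) *\<^sub>R z) has_derivative ?X' z) (at z)" for z
    by (rule has_derivative_eq_rhs[OF has_derivative_scaleR[OF has_derivative_mult has_derivative_ident]])
      (auto intro: C1_fun_has_derivative[OF C] simp: fun_eq_iff)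
  have "(LINT z|disk_measure. Re (?X' z 1) + Im (?X' z \<i>)) = (LINT t|circle_measure. ((\<phi> (cis t) * \<phi> (cis t)) *\<^sub>R cis t) \<bullet> cis t)"
    by (rule divergence_disk[OF X]) (intro continuous_intros ct)+
  also have "\<dots> = (LINT t|circle_measure. (norm (\<phi> (cis t)))\<^sup>2)"
    by (simp add: power2_eq_square dot_square_norm)
  also have "\<dots> = ?c\<^sup>2" by (simp add: l2norm_power2)
  also have "(\<lambda>z. Re (?X' z 1) + Im (?X' z \<i>)) = (\<lambda>z. 2 * (norm (\<phi> z))\<^sup>2 + \<phi> z * (2 *\<^sub>R (\<psi> z \<bullet> z)))"
    by (auto simp: fun_eq_iff inner_complex_def power2_eq_square algebra_simps)
  also have "(LINT z|disk_measure. 2 * (norm (\<phi> z))\<^sup>2 + \<phi> z * (2 *\<^sub>R (\<psi> z \<bullet> z)))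
      = 2 * ?a\<^sup>2 + (LINT z|disk_measure. \<phi> z * (2 *\<^sub>R (\<psi> z \<bullet> z)))"
  proof -
    have "integrable disk_measure (\<lambda>z. \<phi> z * (2 *\<^sub>R (\<psi> z \<bullet> z)))"
    proof -
      have "square_integrable disk_measure (\<lambda>z. \<phi> z * (2 *\<^sub>R (\<psi> z \<bullet> z)))"
        by (intro continuous_square_integrable_disk continuous_intros ct)
      then show ?thesis by (rule disk_measure.square_integrable_integrable)
    qed
    then show ?thesis using sq(1) by (simp add: square_integrable_def l2norm_power2)
  qed
  finally have eq: "2 * ?a\<^sup>2 + (LINT z|disk_measure. \<phi> z * (2 *\<^sub>R (\<psi> z \<bullet> z))) = ?c\<^sup>2" .
  have sq2: "square_integrable disk_measure (\<lambda>z. 2 *\<^sub>R (\<psi> z \<bullet> z))"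
    by (intro continuous_square_integrable_disk continuous_intros ct)
  have "\<bar>LINT z|disk_measure. \<phi> z * (2 *\<^sub>R (\<psi> z \<bullet> z))\<bar> \<le> ?a * l2norm disk_measure (\<lambda>z. 2 *\<^sub>R (\<psi> z \<bullet> z))"
    using abs_integral_inner_le[OF sq(1) sq2] by simp
  also have "l2norm disk_measure (\<lambda>z. 2 *\<^sub>R (\<psi> z \<bullet> z)) \<le> l2norm disk_measure (\<lambda>z. 2 *\<^sub>R \<psi> z)"
  proof (rule l2norm_mono[OF square_integrable_scaleR[OF sq(2)]])
    show "(\<lambda>z. 2 *\<^sub>R (\<psi> z \<bullet> z)) \<in> borel_measurable disk_measure" using sq2 by (simp add: square_integrable_def)
    fix z :: complex assume "z \<in> space disk_measure"
    then have "norm z \<le> 1" by simp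
    have "\<bar>\<psi> z \<bullet> z\<bar> \<le> norm (\<psi> z) * norm z" by (rule Cauchy_Schwarz_ineq2)
    also have "\<dots> \<le> norm (\<psi> z) * 1" using \<open>norm z \<le> 1\<close> by (intro mult_left_mono) auto
    finally show "norm (2 *\<^sub>R (\<psi> z \<bullet> z)) \<le> norm (2 *\<^sub>R \<psi> z)" by simp
  qed
  also have "\<dots> = 2 * ?b" by (simp add: l2norm_scaleR)
  finally have le: "\<bar>LINT z|disk_measure. \<phi> z * (2 *\<^sub>R (\<psi> z \<bullet> z))\<bar> \<le> ?a * (2 * ?b)"
    by (simp add: mult_left_mono)
  have main: "2 * (?a * (?a - ?b)) \<le> ?c\<^sup>2"
    using eq le by (simp add: power2_eq_square algebra_simps)
  show ?thesis
  proof (rule ccontr)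
    assume "\<not> ?thesis"
    then have "?a > ?b + ?c" by simp
    moreover have "?b \<ge> 0" "?c \<ge> 0" by auto
    ultimately have "?c < ?a" "?c < ?a - ?b" "?c \<ge> 0" by linarith+
    then have "?c * ?c < ?a * (?a - ?b)" by (intro mult_strict_mono')
    moreover have "0 \<le> ?c * ?c" by simp
    ultimately show False using main unfolding power2_eq_square by linarith
  qed
qed

lemma H1_trace_Poincare:
  assumes H: "H1_trace u G g"
  shows "l2norm disk_measure u \<le> l2norm disk_measure G + l2norm circle_measure (\<lambda>t. g (cis t))"
proof (rule field_le_epsilon)
  fix e :: real assume "e > 0"
  then have e3: "e / 3 > 0" by simp
  obtain \<phi> \<psi> where C: "C1_fun \<phi> \<psi>" and 1: "l2norm disk_measure (\<lambda>z. \<phi> z - u z) < e / 3"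
     "l2norm disk_measure (\<lambda>z. \<psi> z - G z) < e / 3" "l2norm circle_measure (\<lambda>t. \<phi> (cis t) - g (cis t)) < e / 3"
    using C1_fun_close[OF H e3] by blast
  note sC = C1_fun_square_integrable[OF C] and sq = H1_trace_square_integrable[OF H]
  have "l2norm disk_measure u \<le> l2norm disk_measure \<phi> + l2norm disk_measure (\<lambda>z. \<phi> z - u z)"
    using l2norm_le_add_diff[OF sq(1) sC(1)] l2norm_minus_commute[of disk_measure \<phi> u] by simp
  moreover have "l2norm disk_measure \<psi> \<le> l2norm disk_measure G + l2norm disk_measure (\<lambda>z. \<psi> z - G z)"
    by (rule l2norm_le_add_diff[OF sC(2) sq(2)])
  moreover have "l2norm circle_measure (\<lambda>t. \<phi> (cis t)) \<le> l2norm circle_measure (\<lambda>t. g (cis t)) + l2norm circle_measure (\<lambda>t. \<phi> (cis t) - g (cis t))"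
    by (rule l2norm_le_add_diff[OF sC(3) sq(3)])
  ultimately show "l2norm disk_measure u \<le> l2norm disk_measure G + l2norm circle_measure (\<lambda>t. g (cis t)) + e"
    using C1_fun_Poincare[OF C] 1 by linarith
qed

lemma l2_convergent_Cauchy:
  fixes f :: "nat \<Rightarrow> 'a \<Rightarrow> 'b::{real_normed_vector,second_countable_topology}"
  assumes sq: "\<And>k. square_integrable M (f k)" "square_integrable M g"
    and lim: "(\<lambda>k. l2norm M (\<lambda>x. f k x - g x)) \<longlonglongrightarrow> 0" and "e > 0"
  shows "\<exists>N. \<forall>n\<ge>N. \<forall>m\<ge>N. l2norm M (\<lambda>x. f m x - f n x) < e"
proof -
  obtain N where N: "\<And>n. n \<ge> N \<Longrightarrow> l2norm M (\<lambda>x. f n x - g x) < e/2"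
    using LIMSEQ_D[OF lim, of "e/2"] \<open>e > 0\<close> by auto
  have "l2norm M (\<lambda>x. f m x - f n x) < e" if "n \<ge> N" "m \<ge> N" for n m
  proof -
    have "l2norm M (\<lambda>x. f m x - f n x) \<le> l2norm M (\<lambda>x. f m x - g x) + l2norm M (\<lambda>x. g x - f n x)"
      by (intro l2norm_triangle_diff sq)
    then show ?thesis using N[OF that(1)] N[OF that(2)] l2norm_minus_commute[of M g "f n"] by linarith
  qed
  then show ?thesis by blast
qed

text \<open>The Poincare inequality, applied to differences, makes the functions Cauchy as soon as
  the gradients are Cauchy and the traces converge; closedness of the relation then identifies the
  limit.\<close>

lemma H1_trace_complete:
  assumes H: "\<And>k. H1_trace (u k) (G k) (g k)"
    and sqg: "square_integrable circle_measure (\<lambda>t. f (cis t))"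
    and limg: "(\<lambda>k. l2norm circle_measure (\<lambda>t. g k (cis t) - f (cis t))) \<longlonglongrightarrow> 0"
    and Cauchy: "\<And>e. e > 0 \<Longrightarrow> \<exists>N. \<forall>n\<ge>N. \<forall>m\<ge>N. l2norm disk_measure (\<lambda>z. G m z - G n z) < e"
  obtains v F where "H1_trace v F f" "(\<lambda>k. l2norm disk_measure (\<lambda>z. G k z - F z)) \<longlonglongrightarrow> 0"
proof -
  note sq = H1_trace_square_integrable[OF H]
  obtain F where F: "square_integrable disk_measure F" "(\<lambda>k. l2norm disk_measure (\<lambda>z. G k z - F z)) \<longlonglongrightarrow> 0"
    by (rule disk_measure.l2_complete[OF sq(2) Cauchy])
  have Cauchy_u: "\<exists>N. \<forall>n\<ge>N. \<forall>m\<ge>N. l2norm disk_measure (\<lambda>z. u m z - u n z) < e" if "e > 0" for e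
  proof -
    from that have e2: "e/2 > 0" by simp
    obtain N1 where N1: "\<And>n m. n \<ge> N1 \<Longrightarrow> m \<ge> N1 \<Longrightarrow> l2norm disk_measure (\<lambda>z. G m z - G n z) < e/2"
      using Cauchy[OF e2] by auto
    obtain N2 where N2: "\<And>n m. n \<ge> N2 \<Longrightarrow> m \<ge> N2 \<Longrightarrow> l2norm circle_measure (\<lambda>t. g m (cis t) - g n (cis t)) < e/2"
      using l2_convergent_Cauchy[OF sq(3) sqg limg e2] by auto
    have "l2norm disk_measure (\<lambda>z. u m z - u n z) < e" if "n \<ge> max N1 N2" "m \<ge> max N1 N2" for n m
      using H1_trace_Poincare[OF H1_trace_diff[OF H H], of m n] N1[of n m] N2[of n m] that by simp
    then show ?thesis by blast
  qed
  obtain v where v: "square_integrable disk_measure v" "(\<lambda>k. l2norm disk_measure (\<lambda>z. u k z - v z)) \<longlonglongrightarrow> 0"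
    by (rule disk_measure.l2_complete[OF sq(1) Cauchy_u])
  have "H1_trace v F f"
    by (rule H1_trace_closed[OF v(1) F(1) sqg H v(2) F(2) limg])
  from this F(2) show thesis by (rule that)
qed

section \<open>The Dirichlet problem with bounded coefficient\<close>

text \<open>First-order condition for an approximate minimiser with slack e. The test value is s = -
  x / (E + 1) instead of the optimal - x / E, so that E = 0 needs no separate treatment.\<close>

lemma quadratic_nonneg_bound:
  fixes e x E :: real
  assumes q: "\<And>s. 0 \<le> e + (2 * s * x + s\<^sup>2 * E)" and E: "0 \<le> E"
  shows "x\<^sup>2 \<le> e * (E + 1)"
proof -
  define y where "y = E + 1"
  define w where "w = x\<^sup>2 / y"
  have y: "y > 0" using E by (simp add: y_def)
  have "0 \<le> e + (2 * (- x / y) * x + (- x / y)\<^sup>2 * E)" by (rule q)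
  also have "2 * (- x / y) * x = - 2 * w" by (simp add: w_def power2_eq_square)
  also have "(- x / y)\<^sup>2 * E = w * (E / y)" by (simp add: w_def power2_eq_square)
  finally have 1: "0 \<le> e + (- 2 * w + w * (E / y))" .
  have "0 \<le> w" "E / y \<le> 1" using y by (simp_all add: w_def y_def)
  then have "w * (E / y) \<le> w * 1" by (intro mult_left_mono)
  with 1 have "w \<le> e" by simp
  then have "x\<^sup>2 \<le> e * y" using y unfolding w_def by (simp add: pos_divide_le_eq)
  then show ?thesis by (simp add: y_def)
qed

text \<open>The results hold for every measurable coefficient with ellipticity bounds
  \<open>m\<close> and \<open>K\<close>; they apply to the perturbed inclusion without any knowledge
  of its shape.\<close>

locale bounded_coefficient =
  fixes \<gamma> :: "complex \<Rightarrow> real" and m K :: real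
  assumes coefficient_measurable [measurable]: "\<gamma> \<in> borel_measurable disk_measure"
    and m_pos: "0 < m"
    and lower: "z \<in> Omega \<Longrightarrow> m \<le> \<gamma> z"
    and upper: "z \<in> Omega \<Longrightarrow> \<gamma> z \<le> K"
begin

lemma K_pos: "0 < K"
  using lower[of 0] upper[of 0] m_pos by simp

lemma abs_coefficient_le: "z \<in> Omega \<Longrightarrow> \<bar>\<gamma> z\<bar> \<le> K"
  using lower[of z] upper[of z] m_pos by simp

lemma square_integrable_coefficient:
  fixes G :: "complex \<Rightarrow> complex"
  assumes "square_integrable disk_measure G"
  shows "square_integrable disk_measure (\<lambda>z. \<gamma> z *\<^sub>R G z)" "l2norm disk_measure (\<lambda>z. \<gamma> z *\<^sub>R G z) \<le> K * l2norm disk_measure G"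
proof -
  have [measurable]: "G \<in> borel_measurable disk_measure" using assms by (simp add: square_integrable_def)
  have m: "(\<lambda>z. \<gamma> z *\<^sub>R G z) \<in> borel_measurable disk_measure" by measurable
  have le: "norm (\<gamma> z *\<^sub>R G z) \<le> norm (K *\<^sub>R G z)" if "z \<in> space disk_measure" for z
  proof -
    have "\<bar>\<gamma> z\<bar> * norm (G z) \<le> \<bar>K\<bar> * norm (G z)"
      using abs_coefficient_le[of z] that K_pos by (intro mult_right_mono) auto
    then show ?thesis by simp
  qed
  show "square_integrable disk_measure (\<lambda>z. \<gamma> z *\<^sub>R G z)"
    by (rule square_integrable_dominated[OF square_integrable_scaleR[OF assms, of K] m le])
  have "l2norm disk_measure (\<lambda>z. \<gamma> z *\<^sub>R G z) \<le> l2norm disk_measure (\<lambda>z. K *\<^sub>R G z)"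
    by (rule l2norm_mono[OF square_integrable_scaleR[OF assms] m le])
  then show "l2norm disk_measure (\<lambda>z. \<gamma> z *\<^sub>R G z) \<le> K * l2norm disk_measure G"
    using K_pos by (simp add: l2norm_scaleR)
qed

lemma energy_integrable:
  fixes G H :: "complex \<Rightarrow> complex"
  assumes "square_integrable disk_measure G" "square_integrable disk_measure H"
  shows "integrable disk_measure (\<lambda>z. \<gamma> z * (G z \<bullet> H z))"
  using square_integrable_integrable_inner[OF square_integrable_coefficient(1)[OF assms(1)] assms(2)] by simp

lemma abs_energy_le:
  assumes "square_integrable disk_measure G" "square_integrable disk_measure H"
  shows "\<bar>energy \<gamma> G H\<bar> \<le> K * l2norm disk_measure G * l2norm disk_measure H"
proof -
  have "\<bar>energy \<gamma> G H\<bar> \<le> l2norm disk_measure (\<lambda>z. \<gamma> z *\<^sub>R G z) * l2norm disk_measure H"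
    using abs_integral_inner_le[OF square_integrable_coefficient(1)[OF assms(1)] assms(2)] by (simp add: energy_def)
  also have "\<dots> \<le> (K * l2norm disk_measure G) * l2norm disk_measure H"
    by (intro mult_right_mono square_integrable_coefficient assms) simp
  finally show ?thesis .
qed

lemma energy_commute: "energy \<gamma> G H = energy \<gamma> H G"
  by (simp add: energy_def inner_commute)

lemma energy_add_left:
  assumes "square_integrable disk_measure G" "square_integrable disk_measure G'" "square_integrable disk_measure H"
  shows "energy \<gamma> (\<lambda>z. G z + G' z) H = energy \<gamma> G H + energy \<gamma> G' H"
  unfolding energy_def
  using energy_integrable[OF assms(1,3)] energy_integrable[OF assms(2,3)] by (simp add: inner_add_left distrib_left)

lemma energy_diff_left:
  assumes "square_integrable disk_measure G" "square_integrable disk_measure G'" "square_integrable disk_measure H"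
  shows "energy \<gamma> (\<lambda>z. G z - G' z) H = energy \<gamma> G H - energy \<gamma> G' H"
  unfolding energy_def
  using energy_integrable[OF assms(1,3)] energy_integrable[OF assms(2,3)] by (simp add: inner_diff_left right_diff_distrib)

lemma energy_scale_left: "energy \<gamma> (\<lambda>z. c *\<^sub>R G z) H = c * energy \<gamma> G H"
  unfolding energy_def by (simp add: mult.left_commute)

lemma energy_diff_right:
  assumes "square_integrable disk_measure G" "square_integrable disk_measure H" "square_integrable disk_measure H'"
  shows "energy \<gamma> G (\<lambda>z. H z - H' z) = energy \<gamma> G H - energy \<gamma> G H'"
  using energy_diff_left[OF assms(2,3,1)] energy_commute by metis

lemma energy_lower:
  assumes "square_integrable disk_measure G"
  shows "m * (l2norm disk_measure G)\<^sup>2 \<le> energy \<gamma> G G"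
proof -
  have "m * (l2norm disk_measure G)\<^sup>2 = (LINT z|disk_measure. m * (norm (G z))\<^sup>2)"
    by (simp add: l2norm_power2)
  also have "\<dots> \<le> (LINT z|disk_measure. \<gamma> z * (G z \<bullet> G z))"
  proof (rule integral_mono[OF _ energy_integrable[OF assms assms]])
    show "integrable disk_measure (\<lambda>z. m * (norm (G z))\<^sup>2)" using assms by (simp add: square_integrable_def)
    show "m * (norm (G z))\<^sup>2 \<le> \<gamma> z * (G z \<bullet> G z)" if "z \<in> space disk_measure" for z
      using lower[of z] that by (simp add: dot_square_norm mult_right_mono)
  qed
  finally show ?thesis by (simp add: energy_def)
qed

lemma energy_nonneg:
  assumes "square_integrable disk_measure G"
  shows "0 \<le> energy \<gamma> G G"
proof -
  have "0 \<le> m * (l2norm disk_measure G)\<^sup>2" using m_pos by simp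
  then show ?thesis using energy_lower[OF assms] by linarith
qed

lemma energy_quadratic:
  assumes G: "square_integrable disk_measure G" and H: "square_integrable disk_measure H"
  shows "energy \<gamma> (\<lambda>z. G z + s *\<^sub>R H z) (\<lambda>z. G z + s *\<^sub>R H z) = energy \<gamma> G G + 2 * s * energy \<gamma> G H + s\<^sup>2 * energy \<gamma> H H"
proof -
  note sH = square_integrable_scaleR[OF H, of s]
  note a = square_integrable_add[OF G sH]
  have "energy \<gamma> (\<lambda>z. G z + s *\<^sub>R H z) (\<lambda>z. G z + s *\<^sub>R H z)
      = energy \<gamma> G (\<lambda>z. G z + s *\<^sub>R H z) + s * energy \<gamma> H (\<lambda>z. G z + s *\<^sub>R H z)"
    by (simp only: energy_add_left[OF G sH a] energy_scale_left)
  also have "\<dots> = energy \<gamma> (\<lambda>z. G z + s *\<^sub>R H z) G + s * energy \<gamma> (\<lambda>z. G z + s *\<^sub>R H z) H"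
    by (simp only: energy_commute[of _ "\<lambda>z. G z + s *\<^sub>R H z"])
  also have "\<dots> = (energy \<gamma> G G + s * energy \<gamma> H G) + s * (energy \<gamma> G H + s * energy \<gamma> H H)"
    by (simp only: energy_add_left[OF G sH G] energy_add_left[OF G sH H] energy_scale_left)
  also have "energy \<gamma> H G = energy \<gamma> G H" by (rule energy_commute)
  finally show ?thesis by (simp add: algebra_simps power2_eq_square)
qed

text \<open>Direct method: a minimising sequence of the energy among functions with trace
  \<open>f\<close> is Cauchy by the parallelogram identity, and its limit satisfies the
  Euler-Lagrange equation.\<close>

lemma dirichlet_solution_exists:
  assumes ex: "H1_trace u0 G0 f"
  obtains u G where "dirichlet_solution \<gamma> f u G"
proof -
  define S where "S = {energy \<gamma> G G | u G. H1_trace u G f}"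
  define d where "d = Inf S"
  have "energy \<gamma> G0 G0 \<in> S" using ex by (auto simp: S_def)
  then have ne: "S \<noteq> {}" by blast
  have nonneg: "0 \<le> energy \<gamma> G G" if "H1_trace u G f" for u G
    by (rule energy_nonneg[OF H1_trace_square_integrable(2)[OF that]])
  have bdd: "bdd_below S" using nonneg by (auto simp: S_def intro!: bdd_belowI[of _ 0])
  have d_le: "d \<le> energy \<gamma> G G" if "H1_trace u G f" for u G
    unfolding d_def using that by (intro cInf_lower bdd) (auto simp: S_def)
  define P where "P k p \<longleftrightarrow> H1_trace (fst p) (snd p) f \<and> energy \<gamma> (snd p) (snd p) < d + 1 / Suc k"
    for k :: nat and p :: "(complex \<Rightarrow> real) \<times> (complex \<Rightarrow> complex)"
  have "\<exists>p. P k p" for k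
  proof -
    have "d < d + 1 / Suc k" by simp
    then obtain x where "x \<in> S" "x < d + 1 / Suc k"
      using cInf_lessD[OF ne, of "d + 1 / Suc k"] unfolding d_def by blast
    then obtain u G where "P k (u, G)" by (auto simp: S_def P_def)
    then show ?thesis by blast
  qed
  then obtain p where p: "\<And>k. P k (p k)" using choice[of P] by blast
  define u where "u k = fst (p k)" for k
  define G where "G k = snd (p k)" for k
  have H: "\<And>k. H1_trace (u k) (G k) f" and small: "\<And>k. energy \<gamma> (G k) (G k) < d + 1 / Suc k"
    using p by (auto simp: P_def u_def G_def)
  note sq = H1_trace_square_integrable[OF H]
  have dist: "m * (l2norm disk_measure (\<lambda>z. G j z - G k z))\<^sup>2 \<le> 2 / Suc j + 2 / Suc k" for j k
  proof -
    note sd = square_integrable_diff[OF sq(2) sq(2), of j k]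
    let ?D = "\<lambda>z. G j z - G k z"
    \<comment> \<open>The midpoint of two competitors is a competitor, so its energy is at least
      \<open>d\<close>. Compared with the energies of \<open>G j\<close> and \<open>G k\<close> this
      bounds the energy of their difference by 2 / Suc j + 2 / Suc k.\<close>
    have "H1_trace (\<lambda>z. (1/2) * u j z + (1/2) * u k z) (\<lambda>z. (1/2) *\<^sub>R G j z + (1/2) *\<^sub>R G k z) (\<lambda>z. (1/2) * f z + (1/2) * f z)"
      by (intro H1_trace_add H1_trace_scale H)
    moreover have "(\<lambda>z. (1/2) *\<^sub>R G j z + (1/2) *\<^sub>R G k z) = (\<lambda>z. G k z + (1/2) *\<^sub>R ?D z)"
      by (auto simp: fun_eq_iff scaleR_diff_right)
    ultimately have "d \<le> energy \<gamma> (\<lambda>z. G k z + (1/2) *\<^sub>R ?D z) (\<lambda>z. G k z + (1/2) *\<^sub>R ?D z)"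
      using d_le by simp
    also have "\<dots> = energy \<gamma> (G k) (G k) + energy \<gamma> (G k) ?D + energy \<gamma> ?D ?D / 4"
      unfolding energy_quadratic[OF sq(2) sd] by (simp add: power2_eq_square)
    finally have 1: "d \<le> energy \<gamma> (G k) (G k) + energy \<gamma> (G k) ?D + energy \<gamma> ?D ?D / 4" .
    have "energy \<gamma> (G j) (G j) = energy \<gamma> (\<lambda>z. G k z + 1 *\<^sub>R ?D z) (\<lambda>z. G k z + 1 *\<^sub>R ?D z)" by simp
    also have "\<dots> = energy \<gamma> (G k) (G k) + 2 * energy \<gamma> (G k) ?D + energy \<gamma> ?D ?D"
      unfolding energy_quadratic[OF sq(2) sd] by simp
    finally have eqj: "energy \<gamma> (G j) (G j) = energy \<gamma> (G k) (G k) + 2 * energy \<gamma> (G k) ?D + energy \<gamma> ?D ?D" .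
    have two: "2 / real (Suc i) = 2 * (1 / real (Suc i))" for i by simp
    have "energy \<gamma> ?D ?D \<le> 2 / Suc j + 2 / Suc k"
      unfolding two using 1 small[of j] small[of k] eqj by linarith
    with energy_lower[OF sd] show ?thesis by linarith
  qed
  have Cauchy: "\<exists>N. \<forall>j\<ge>N. \<forall>k\<ge>N. l2norm disk_measure (\<lambda>z. G k z - G j z) < e" if e: "e > 0" for e
  proof -
    obtain N where N: "4 / (m * e\<^sup>2) < real N" using reals_Archimedean2 by blast
    have pos: "m * e\<^sup>2 > 0" using m_pos e by simp
    have "l2norm disk_measure (\<lambda>z. G k z - G j z) < e" if "j \<ge> N" "k \<ge> N" for j k
    proof -
      have N0: "real N > 0" using N pos divide_pos_pos[of 4 "m * e\<^sup>2"] by linarith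
      have "2 / real (Suc i) \<le> 2 / real N" if "i \<ge> N" for i
        by (rule divide_left_mono) (use that N0 in auto)
      from this[OF that(1)] this[OF that(2)]
      have "2 / real (Suc k) + 2 / real (Suc j) \<le> 4 / real N" by simp
      then have "m * (l2norm disk_measure (\<lambda>z. G k z - G j z))\<^sup>2 \<le> 4 / real N"
        using dist[of k j] by linarith
      also have "\<dots> < m * e\<^sup>2"
        using N unfolding pos_divide_less_eq[OF N0] pos_divide_less_eq[OF pos] by (simp only: mult.commute)
      finally have "(l2norm disk_measure (\<lambda>z. G k z - G j z))\<^sup>2 < e\<^sup>2" unfolding mult_less_cancel_left_pos[OF m_pos] .
      then show ?thesis by (rule power_less_imp_less_base) (use e in simp)
    qed
    then show ?thesis by (intro exI[of _ N] allI impI)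
  qed
  obtain v F where v: "H1_trace v F f" and F: "(\<lambda>k. l2norm disk_measure (\<lambda>z. G k z - F z)) \<longlonglongrightarrow> 0"
    by (rule H1_trace_complete[OF H H1_trace_square_integrable(3)[OF ex] _ Cauchy]) simp_all
  note sF = H1_trace_square_integrable(2)[OF v]
  have "energy \<gamma> F H = 0" if Hw: "H1_trace w H (\<lambda>z. 0)" for w H
  proof -
    note sH = H1_trace_square_integrable(2)[OF Hw]
    let ?E = "energy \<gamma> H H"
    have E0: "?E \<ge> 0" by (rule energy_nonneg[OF sH])
    \<comment> \<open>The variation is applied to the members of the minimising sequence, which
      minimise up to 1 / Suc k. The weak equation for the limit \<open>F\<close> then comes from
      comparing two limits of \<open>energy \<gamma> (G k) H\<close>.\<close>
    have b: "(energy \<gamma> (G k) H)\<^sup>2 \<le> 1 / Suc k * (?E + 1)" for k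
    proof (rule quadratic_nonneg_bound[OF _ E0])
      fix s
      have "H1_trace (\<lambda>z. u k z + s * w z) (\<lambda>z. G k z + s *\<^sub>R H z) (\<lambda>z. f z + s * 0)"
        by (intro H1_trace_add H1_trace_scale[OF Hw] H)
      then have "d \<le> energy \<gamma> (\<lambda>z. G k z + s *\<^sub>R H z) (\<lambda>z. G k z + s *\<^sub>R H z)"
        unfolding mult_zero_right add_0_right by (rule d_le)
      also have "\<dots> = energy \<gamma> (G k) (G k) + 2 * s * energy \<gamma> (G k) H + s\<^sup>2 * ?E"
        by (rule energy_quadratic[OF sq(2) sH])
      finally show "0 \<le> 1 / Suc k + (2 * s * energy \<gamma> (G k) H + s\<^sup>2 * ?E)" using small[of k] by linarith
    qed
    have lim1: "(\<lambda>k. energy \<gamma> (G k) H) \<longlonglongrightarrow> 0"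
    proof -
      have "(\<lambda>k. 1 / Suc k * (?E + 1)) \<longlonglongrightarrow> 0 * (?E + 1)"
        by (intro tendsto_mult tendsto_const) (use LIMSEQ_inverse_real_of_nat in \<open>simp add: inverse_eq_divide\<close>)
      then have lim0: "(\<lambda>k. 1 / Suc k * (?E + 1)) \<longlonglongrightarrow> 0" by simp
      have "(\<lambda>k. (energy \<gamma> (G k) H)\<^sup>2) \<longlonglongrightarrow> 0"
      proof (rule tendsto_sandwich[OF always_eventually always_eventually tendsto_const lim0])
        show "\<forall>k. (energy \<gamma> (G k) H)\<^sup>2 \<le> 1 / Suc k * (?E + 1)" using b by blast
      qed simp
      then have "(\<lambda>k. sqrt ((energy \<gamma> (G k) H)\<^sup>2)) \<longlonglongrightarrow> sqrt 0" by (rule tendsto_real_sqrt)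
      then show ?thesis by (simp add: tendsto_rabs_zero_iff)
    qed
    have lim2: "(\<lambda>k. energy \<gamma> (G k) H) \<longlonglongrightarrow> energy \<gamma> F H"
    proof (rule LIM_zero_cancel, rule Lim_null_comparison[OF always_eventually], rule allI)
      show "norm (energy \<gamma> (G k) H - energy \<gamma> F H) \<le> K * l2norm disk_measure (\<lambda>z. G k z - F z) * l2norm disk_measure H" for k
        unfolding real_norm_def energy_diff_left[OF sq(2) sF sH, symmetric]
        by (rule abs_energy_le[OF square_integrable_diff[OF sq(2) sF] sH])
      have "(\<lambda>k. K * l2norm disk_measure (\<lambda>z. G k z - F z) * l2norm disk_measure H) \<longlonglongrightarrow> K * 0 * l2norm disk_measure H"
        by (rule tendsto_mult[OF tendsto_mult[OF tendsto_const F] tendsto_const])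
      then show "(\<lambda>k. K * l2norm disk_measure (\<lambda>z. G k z - F z) * l2norm disk_measure H) \<longlonglongrightarrow> 0"
        by (simp only: mult_zero_right mult_zero_left)
    qed
    show ?thesis by (rule LIMSEQ_unique[OF lim2 lim1])
  qed
  then have "dirichlet_solution \<gamma> f v F" unfolding dirichlet_solution_def by (intro conjI v allI impI)
  then show thesis by (rule that)
qed

lemma dirichlet_solution_square_integrable:
  assumes "dirichlet_solution \<gamma> f u G"
  shows "square_integrable disk_measure G"
proof -
  have "H1_trace u G f" using assms by (simp add: dirichlet_solution_def)
  then show ?thesis by (rule H1_trace_square_integrable(2))
qed

text \<open>Two extensions of the same data differ by a function of zero trace, which is an
  admissible test function. This is what makes the pairing independent of the extension.\<close>

lemma dirichlet_solution_energy_cong: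
  assumes "dirichlet_solution \<gamma> f u G" "H1_trace v H g" "H1_trace v' H' g"
  shows "energy \<gamma> G H = energy \<gamma> G H'"
proof -
  have "H1_trace (\<lambda>z. v z - v' z) (\<lambda>z. H z - H' z) (\<lambda>z. 0)"
    using H1_trace_diff[OF assms(2,3)] by simp
  moreover have "\<forall>v H. H1_trace v H (\<lambda>z. 0) \<longrightarrow> energy \<gamma> G H = 0"
    using assms(1) by (simp add: dirichlet_solution_def)
  ultimately have "energy \<gamma> G (\<lambda>z. H z - H' z) = 0" by (elim allE impE)
  then show ?thesis
    using energy_diff_right[OF dirichlet_solution_square_integrable[OF assms(1)] H1_trace_square_integrable(2)[OF assms(2)] H1_trace_square_integrable(2)[OF assms(3)]]
    by simp
qed

text \<open>Coercivity applied to the difference of the two gradients. Equality in norm of the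
  gradients is all that the pairing depends on.\<close>

lemma dirichlet_solution_unique:
  assumes "dirichlet_solution \<gamma> f u G" "dirichlet_solution \<gamma> f u' G'"
  shows "l2norm disk_measure (\<lambda>z. G z - G' z) = 0"
proof -
  note s = assms[THEN dirichlet_solution_square_integrable]
  note sd = square_integrable_diff[OF s]
  have t: "H1_trace u G f" "H1_trace u' G' f" using assms by (auto simp: dirichlet_solution_def)
  have "energy \<gamma> (\<lambda>z. G z - G' z) (\<lambda>z. G z - G' z) =
      (energy \<gamma> G G - energy \<gamma> G G') - (energy \<gamma> G' G - energy \<gamma> G' G')"
    by (simp only: energy_diff_left[OF s sd] energy_diff_right[OF s(1) s] energy_diff_right[OF s(2) s])
  also have "\<dots> = 0"
    using dirichlet_solution_energy_cong[OF assms(1) t] dirichlet_solution_energy_cong[OF assms(2) t] by simp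
  finally have "m * (l2norm disk_measure (\<lambda>z. G z - G' z))\<^sup>2 \<le> 0"
    using energy_lower[OF sd] by simp
  then show ?thesis using m_pos by (simp add: mult_le_0_iff)
qed

end

text \<open>Turns the definite description into a computation: any solution and any extension may be
  inserted, because the energy depends on neither choice.\<close>

lemma DN_map_eq:
  assumes b: "bounded_coefficient (conductivity \<sigma>1 \<sigma>2 D) m K"
    and s: "dirichlet_solution (conductivity \<sigma>1 \<sigma>2 D) f u G" and v: "H1_trace v H g"
  shows "DN_map \<sigma>1 \<sigma>2 D f g = energy (conductivity \<sigma>1 \<sigma>2 D) G H"
  unfolding DN_map_def
proof (rule the_equality)
  show "\<exists>u G' v H'. dirichlet_solution (conductivity \<sigma>1 \<sigma>2 D) f u G' \<and> H1_trace v H' g \<and>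
      energy (conductivity \<sigma>1 \<sigma>2 D) G H = energy (conductivity \<sigma>1 \<sigma>2 D) G' H'"
    by (rule exI[of _ u], rule exI[of _ G], rule exI[of _ v], rule exI[of _ H]) (simp add: s v)
next
  interpret bounded_coefficient "conductivity \<sigma>1 \<sigma>2 D" m K by fact
  fix r assume "\<exists>u G v H. dirichlet_solution (conductivity \<sigma>1 \<sigma>2 D) f u G \<and> H1_trace v H g \<and>
      r = energy (conductivity \<sigma>1 \<sigma>2 D) G H"
  then obtain u' G' v' H' where s': "dirichlet_solution (conductivity \<sigma>1 \<sigma>2 D) f u' G'" and v': "H1_trace v' H' g"
    and r: "r = energy (conductivity \<sigma>1 \<sigma>2 D) G' H'" by auto
  note q = dirichlet_solution_square_integrable[OF s] dirichlet_solution_square_integrable[OF s'] H1_trace_square_integrable(2)[OF v]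
  have "r = energy (conductivity \<sigma>1 \<sigma>2 D) G' H"
    using dirichlet_solution_energy_cong[OF s' v' v] r by simp
  moreover have "\<bar>energy (conductivity \<sigma>1 \<sigma>2 D) (\<lambda>z. G z - G' z) H\<bar> \<le> 0"
    using abs_energy_le[OF square_integrable_diff[OF q(1,2)] q(3)] dirichlet_solution_unique[OF s s'] by simp
  ultimately show "r = energy (conductivity \<sigma>1 \<sigma>2 D) G H"
    using energy_diff_left[OF q] by simp
qed

lemma DN_map_undefined:
  assumes "(\<nexists>u G. H1_trace u G f) \<or> (\<nexists>v H. H1_trace v H g)"
  shows "DN_map \<sigma>1 \<sigma>2 D f g = DN_map \<sigma>1 \<sigma>2 D' f g"
proof -
  have e: "(\<exists>u G v H. dirichlet_solution (conductivity \<sigma>1 \<sigma>2 E) f u G \<and> H1_trace v H g \<and>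
      r = energy (conductivity \<sigma>1 \<sigma>2 E) G H) \<longleftrightarrow> False" for E r
    using assms unfolding dirichlet_solution_def by blast
  show ?thesis unfolding DN_map_def e ..
qed

section \<open>Comparison of two Dirichlet-to-Neumann maps\<close>

lemma square_integrable_indicator:
  fixes G :: "complex \<Rightarrow> complex"
  assumes "square_integrable disk_measure G" "A \<in> sets lebesgue"
  shows "square_integrable disk_measure (\<lambda>z. indicator A z *\<^sub>R G z)"
    "l2norm disk_measure (\<lambda>z. indicator A z *\<^sub>R G z) \<le> l2norm disk_measure G"
proof -
  have [measurable]: "G \<in> borel_measurable disk_measure" using assms(1) by (simp add: square_integrable_def)
  have "indicator A \<in> borel_measurable lebesgue" using assms(2) by simp
  then have [measurable]: "(indicator A :: complex \<Rightarrow> real) \<in> borel_measurable disk_measure"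
    by (rule measurable_restrict_space1)
  have m: "(\<lambda>z. indicator A z *\<^sub>R G z) \<in> borel_measurable disk_measure" by measurable
  have le: "norm (indicator A z *\<^sub>R G z) \<le> norm (G z)" for z by (simp add: indicator_def)
  show "square_integrable disk_measure (\<lambda>z. indicator A z *\<^sub>R G z)"
    by (rule square_integrable_dominated[OF assms(1) m le])
  show "l2norm disk_measure (\<lambda>z. indicator A z *\<^sub>R G z) \<le> l2norm disk_measure G"
    by (rule l2norm_mono[OF assms(1) m le])
qed

text \<open>The indicator that dominates the difference of the coefficients equals its own square,
  so one copy can be given to each of the two gradients before Cauchy-Schwarz is applied.\<close>

lemma abs_energy_diff_le:
  assumes \<gamma>: "bounded_coefficient \<gamma> m K" "bounded_coefficient \<gamma>' m K"
    and A: "A \<in> sets lebesgue" and diff: "\<And>z. z \<in> Omega \<Longrightarrow> \<bar>\<gamma> z - \<gamma>' z\<bar> \<le> d * indicator A z" and "0 \<le> d"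
    and G: "square_integrable disk_measure G" and H: "square_integrable disk_measure H"
  shows "\<bar>energy \<gamma> G H - energy \<gamma>' G H\<bar> \<le>
    d * l2norm disk_measure (\<lambda>z. indicator A z *\<^sub>R G z) * l2norm disk_measure (\<lambda>z. indicator A z *\<^sub>R H z)"
proof -
  let ?a = "\<lambda>G z. indicator A z *\<^sub>R G z :: complex"
  note i = bounded_coefficient.energy_integrable[OF _ G H]
  note sq = square_integrable_indicator(1)[OF G A] square_integrable_indicator(1)[OF H A]
  have "energy \<gamma> G H - energy \<gamma>' G H = (LINT z|disk_measure. (\<gamma> z - \<gamma>' z) * (G z \<bullet> H z))"
    unfolding energy_def left_diff_distrib
    by (rule Bochner_Integration.integral_diff[OF i[OF \<gamma>(1)] i[OF \<gamma>(2)], symmetric])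
  also have "\<bar>\<dots>\<bar> \<le> (LINT z|disk_measure. \<bar>(\<gamma> z - \<gamma>' z) * (G z \<bullet> H z)\<bar>)" by (rule integral_abs_bound)
  also have "\<dots> \<le> (LINT z|disk_measure. d * (norm (?a G z) * norm (?a H z)))"
  proof (rule integral_mono)
    have "integrable disk_measure (\<lambda>z. (\<gamma> z - \<gamma>' z) * (G z \<bullet> H z))"
      unfolding left_diff_distrib by (intro Bochner_Integration.integrable_diff i[OF \<gamma>(1)] i[OF \<gamma>(2)])
    then show "integrable disk_measure (\<lambda>z. \<bar>(\<gamma> z - \<gamma>' z) * (G z \<bullet> H z)\<bar>)" by (rule integrable_abs)
    show "integrable disk_measure (\<lambda>z. d * (norm (?a G z) * norm (?a H z)))"
      by (intro integrable_mult_right square_integrable_integrable_mult sq)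
    fix z assume "z \<in> space disk_measure"
    then have z: "z \<in> Omega" by simp
    have "\<bar>(\<gamma> z - \<gamma>' z) * (G z \<bullet> H z)\<bar> \<le> (d * indicator A z) * (norm (G z) * norm (H z))"
      unfolding abs_mult using \<open>0 \<le> d\<close> by (intro mult_mono diff z Cauchy_Schwarz_ineq2) auto
    then show "\<bar>(\<gamma> z - \<gamma>' z) * (G z \<bullet> H z)\<bar> \<le> d * (norm (?a G z) * norm (?a H z))"
      by (cases "z \<in> A") simp_all
  qed
  also have "\<dots> = d * (LINT z|disk_measure. norm (?a G z) * norm (?a H z))" by simp
  also have "\<dots> \<le> d * (l2norm disk_measure (?a G) * l2norm disk_measure (?a H))"
    by (intro mult_left_mono l2norm_Cauchy_Schwarz sq) fact
  finally show ?thesis by (simp add: mult.assoc)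
qed

lemma DN_map_perturbation:
  assumes bD: "bounded_coefficient (conductivity \<sigma>1 \<sigma>2 D) m K" and bB: "bounded_coefficient (conductivity \<sigma>1 \<sigma>2 B) m K"
    and A: "A \<in> sets lebesgue"
    and diff: "\<And>z. z \<in> Omega \<Longrightarrow> \<bar>conductivity \<sigma>1 \<sigma>2 D z - conductivity \<sigma>1 \<sigma>2 B z\<bar> \<le> d * indicator A z" and "0 \<le> d"
    and u: "dirichlet_solution (conductivity \<sigma>1 \<sigma>2 B) f u G" and v: "dirichlet_solution (conductivity \<sigma>1 \<sigma>2 B) g v H"
  shows "\<bar>DN_map \<sigma>1 \<sigma>2 D f g - DN_map \<sigma>1 \<sigma>2 B f g\<bar> \<le>
    d * (1 + d / m) * l2norm disk_measure (\<lambda>z. indicator A z *\<^sub>R G z) * l2norm disk_measure (\<lambda>z. indicator A z *\<^sub>R H z)"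
proof -
  let ?D = "conductivity \<sigma>1 \<sigma>2 D" and ?B = "conductivity \<sigma>1 \<sigma>2 B"
  let ?n = "\<lambda>G. l2norm disk_measure (\<lambda>z. indicator A z *\<^sub>R G z :: complex)"
  interpret D: bounded_coefficient ?D m K by fact
  interpret B: bounded_coefficient ?B m K by fact
  have tu: "H1_trace u G f" and tv: "H1_trace v H g"
    using u v by (simp_all add: dirichlet_solution_def)
  obtain uD GD where uD: "dirichlet_solution ?D f uD GD" by (rule D.dirichlet_solution_exists[OF tu])
  obtain vD HD where vD: "dirichlet_solution ?D g vD HD" by (rule D.dirichlet_solution_exists[OF tv])
  have tuD: "H1_trace uD GD f" and tvD: "H1_trace vD HD g"
    using uD vD by (simp_all add: dirichlet_solution_def)
  note sG = H1_trace_square_integrable(2)[OF tu] and sH = H1_trace_square_integrable(2)[OF tv]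
    and sGD = H1_trace_square_integrable(2)[OF tuD] and sHD = H1_trace_square_integrable(2)[OF tvD]
  \<comment> \<open>Both pairings are brought to the same two gradients. For D, \<open>HD\<close>
    belongs to a solution, so by symmetry of the form \<open>GD\<close> may be replaced by the other
    extension \<open>G\<close> of f; for B, \<open>G\<close> belongs to a solution and
    \<open>HD\<close> is an extension of g.\<close>
  have "DN_map \<sigma>1 \<sigma>2 D f g = energy ?D GD HD" by (rule DN_map_eq[OF bD uD tvD])
  also have "\<dots> = energy ?D HD GD" by (rule D.energy_commute)
  also have "\<dots> = energy ?D HD G" by (rule D.dirichlet_solution_energy_cong[OF vD tuD tu])
  also have "\<dots> = energy ?D G HD" by (rule D.energy_commute)
  finally have 1: "DN_map \<sigma>1 \<sigma>2 D f g = energy ?D G HD" .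
  have 2: "DN_map \<sigma>1 \<sigma>2 B f g = energy ?B G HD" by (rule DN_map_eq[OF bB u tvD])
  have main: "\<bar>DN_map \<sigma>1 \<sigma>2 D f g - DN_map \<sigma>1 \<sigma>2 B f g\<bar> \<le> d * ?n G * ?n HD"
    unfolding 1 2 by (rule abs_energy_diff_le[OF bD bB A diff \<open>0 \<le> d\<close> sG sHD])
  let ?W = "\<lambda>z. HD z - H z"
  note sW = square_integrable_diff[OF sHD sH]
  have "energy ?D HD ?W = energy ?D HD HD - energy ?D HD H" by (rule D.energy_diff_right[OF sHD sHD sH])
  then have eD: "energy ?D HD ?W = 0" using D.dirichlet_solution_energy_cong[OF vD tvD tv] by simp
  have "energy ?B H ?W = energy ?B H HD - energy ?B H H" by (rule B.energy_diff_right[OF sH sHD sH])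
  then have eB: "energy ?B H ?W = 0" using B.dirichlet_solution_energy_cong[OF v tvD tv] by simp
  have "energy ?D ?W ?W = energy ?D HD ?W - energy ?D H ?W" by (rule D.energy_diff_left[OF sHD sH sW])
  also have "\<dots> = - (energy ?D H ?W - energy ?B H ?W)" by (simp add: eD eB)
  also have "\<dots> \<le> \<bar>energy ?D H ?W - energy ?B H ?W\<bar>" by simp
  also have "\<dots> \<le> d * ?n H * ?n ?W" by (rule abs_energy_diff_le[OF bD bB A diff \<open>0 \<le> d\<close> sH sW])
  also have "\<dots> \<le> d * ?n H * l2norm disk_measure ?W"
    using \<open>0 \<le> d\<close> by (intro mult_left_mono square_integrable_indicator(2)[OF sW A]) auto
  finally have "m * (l2norm disk_measure ?W)\<^sup>2 \<le> d * ?n H * l2norm disk_measure ?W"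
    using D.energy_lower[OF sW] by linarith
  \<comment> \<open>One factor of the norm of \<open>?W\<close> is split off. If that norm is zero,
    the bound that follows holds because its right-hand side is nonnegative.\<close>
  then have "l2norm disk_measure ?W * (m * l2norm disk_measure ?W - d * ?n H) \<le> 0"
    by (simp add: power2_eq_square algebra_simps)
  moreover have "0 \<le> d * ?n H" using \<open>0 \<le> d\<close> by simp
  ultimately have "m * l2norm disk_measure ?W \<le> d * ?n H"
    using l2norm_nonneg[of disk_measure ?W] by (auto simp: mult_le_0_iff)
  then have W: "l2norm disk_measure ?W \<le> d / m * ?n H"
    using D.m_pos by (simp add: pos_le_divide_eq mult.commute)
  have "?n HD \<le> ?n H + l2norm disk_measure (\<lambda>z. indicator A z *\<^sub>R HD z - indicator A z *\<^sub>R H z)"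
    by (intro l2norm_le_add_diff square_integrable_indicator sHD sH A)
  also have "\<dots> = ?n H + ?n ?W" by (simp add: scaleR_diff_right)
  also have "\<dots> \<le> ?n H + d / m * ?n H"
    using W square_integrable_indicator(2)[OF sW A] by linarith
  finally have "?n HD \<le> (1 + d / m) * ?n H" by (simp add: distrib_right)
  then have "d * ?n G * ?n HD \<le> d * ?n G * ((1 + d / m) * ?n H)"
    using \<open>0 \<le> d\<close> by (intro mult_left_mono) auto
  with main show ?thesis by (simp add: mult.assoc mult.left_commute)
qed

section \<open>Fourier series on the circle\<close>

definition harmonic_poly :: "(nat \<Rightarrow> complex) \<Rightarrow> nat \<Rightarrow> complex \<Rightarrow> real" where
  "harmonic_poly c N z = (\<Sum>n\<le>N. Re (c n * z ^ n))"

text \<open>Real trigonometric polynomials, with equality required on the circle only. There z * cnj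
  z = 1, so products are again sums of modes and the class is an algebra.\<close>

inductive circle_poly :: "(complex \<Rightarrow> real) \<Rightarrow> bool" where
  mode: "(\<And>z. cmod z = 1 \<Longrightarrow> h z = Re (c * z ^ n)) \<Longrightarrow> circle_poly h"
| add: "circle_poly h1 \<Longrightarrow> circle_poly h2 \<Longrightarrow> (\<And>z. cmod z = 1 \<Longrightarrow> h z = h1 z + h2 z) \<Longrightarrow> circle_poly h"

text \<open>Re x Re y is half of Re (x y) plus half of Re (x * cnj y). On the circle the second term
  is a mode whose degree is the distance between n and m, which is why the two orders of n and m are
  treated apart.\<close>

lemma circle_poly_mult_mode:
  "circle_poly h \<Longrightarrow> (\<And>z. cmod z = 1 \<Longrightarrow> k z = h z * Re (d * z ^ m)) \<Longrightarrow> circle_poly k"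
proof (induction arbitrary: k rule: circle_poly.induct)
  case (mode h c n)
  have prod: "Re x * Re y = Re (x * y) / 2 + Re (x * cnj y) / 2" for x y :: complex
    by (simp add: field_simps)
  have half: "Re x / 2 = Re (a / 2 * w)" if "x = a * w" for x a w :: complex
    by (simp add: that field_simps)
  have zz: "z * cnj z = 1" if "cmod z = 1" for z
    using complex_norm_square[of z] that by simp
  have p1: "circle_poly (\<lambda>z. Re (c * z ^ n * cnj (d * z ^ m)) / 2)"
  proof (cases "m \<le> n")
    case True
    show ?thesis
    proof (rule circle_poly.mode[of _ "c * cnj d / 2" "n - m"])
      fix z :: complex assume "cmod z = 1"
      have "z ^ n * cnj z ^ m = z ^ (n - m) * (z * cnj z) ^ m"
        using True by (simp add: power_mult_distrib mult.assoc[symmetric] power_add[symmetric])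
      then have "c * z ^ n * cnj (d * z ^ m) = c * cnj d * z ^ (n - m)"
        using zz[OF \<open>cmod z = 1\<close>] by (simp add: mult_ac)
      then show "Re (c * z ^ n * cnj (d * z ^ m)) / 2 = Re (c * cnj d / 2 * z ^ (n - m))" by (rule half)
    qed
  next
    case False
    show ?thesis
    proof (rule circle_poly.mode[of _ "cnj c * d / 2" "m - n"])
      fix z :: complex assume "cmod z = 1"
      have "cnj z ^ n * z ^ m = z ^ (m - n) * (z * cnj z) ^ n"
        using False by (simp add: power_mult_distrib mult.assoc[symmetric] power_add[symmetric])
      then have "cnj (c * z ^ n) * (d * z ^ m) = cnj c * d * z ^ (m - n)"
        using zz[OF \<open>cmod z = 1\<close>] by (simp add: mult_ac)
      then have "Re (cnj (c * z ^ n) * (d * z ^ m)) / 2 = Re (cnj c * d / 2 * z ^ (m - n))" by (rule half)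
      moreover have "Re (x * cnj y) = Re (cnj x * y)" for x y by simp
      ultimately show "Re (c * z ^ n * cnj (d * z ^ m)) / 2 = Re (cnj c * d / 2 * z ^ (m - n))" by metis
    qed
  qed
  have p2: "circle_poly (\<lambda>z. Re (c * z ^ n * (d * z ^ m)) / 2)"
    by (rule circle_poly.mode[of _ "c * d / 2" "n + m"], rule half) (simp add: power_add mult_ac)
  show ?case
  proof (rule circle_poly.add[OF p2 p1])
    fix z :: complex assume z: "cmod z = 1"
    show "k z = Re (c * z ^ n * (d * z ^ m)) / 2 + Re (c * z ^ n * cnj (d * z ^ m)) / 2"
      by (simp only: mode.prems[OF z] mode.hyps[OF z] prod)
  qed
next
  case (add h1 h2 h)
  have "circle_poly (\<lambda>z. h1 z * Re (d * z ^ m))" "circle_poly (\<lambda>z. h2 z * Re (d * z ^ m))"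
    by (rule add.IH, rule refl)+
  then show ?case
    by (rule circle_poly.add) (simp add: add.prems add.hyps distrib_right)
qed

lemma circle_poly_mult: "circle_poly h' \<Longrightarrow> circle_poly h \<Longrightarrow> circle_poly (\<lambda>z. h z * h' z)"
proof (induction rule: circle_poly.induct)
  case (mode h' c n)
  show ?case by (rule circle_poly_mult_mode[OF mode.prems]) (simp only: mode.hyps)
next
  case (add h1 h2 h')
  show ?case
    by (rule circle_poly.add[OF add.IH(1)[OF add.prems] add.IH(2)[OF add.prems]]) (simp only: add.hyps distrib_left)
qed

lemma circle_poly_eq_harmonic_poly:
  "circle_poly h \<Longrightarrow> \<exists>c N. \<forall>z. cmod z = 1 \<longrightarrow> h z = harmonic_poly c N z"
proof (induction rule: circle_poly.induct)
  case (mode h c n)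
  have eq: "harmonic_poly ((\<lambda>_. 0)(n := c)) n z = Re (c * z ^ n)" for z
    unfolding harmonic_poly_def by (subst sum.remove[of _ n]) (auto intro!: sum.neutral)
  show ?case
    by (intro exI[of _ "(\<lambda>_. 0)(n := c)"] exI[of _ n] allI impI) (simp only: eq mode.hyps)
next
  case (add h1 h2 h)
  then obtain c N d M where cd: "\<And>z. cmod z = 1 \<Longrightarrow> h1 z = harmonic_poly c N z" "\<And>z. cmod z = 1 \<Longrightarrow> h2 z = harmonic_poly d M z"
    by auto
  have ext: "harmonic_poly c N z = harmonic_poly (\<lambda>n. if n \<le> N then c n else 0) (N + M) z" for c :: "nat \<Rightarrow> complex" and N M z
    unfolding harmonic_poly_def by (rule sum.mono_neutral_cong_left) auto
  let ?e = "\<lambda>n. (if n \<le> N then c n else 0) + (if n \<le> M then d n else 0)"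
  have "harmonic_poly ?e (N + M) z = harmonic_poly c N z + harmonic_poly d M z" for z
    unfolding ext[of c N z M] ext[of d M z N] by (simp add: harmonic_poly_def sum.distrib[symmetric] distrib_right add.commute)
  with add.hyps cd show ?case by (intro exI[of _ ?e] exI[of _ "N + M"]) simp
qed

lemma circle_poly_continuous: "circle_poly h \<Longrightarrow> continuous_on (sphere 0 1) h"
proof (induction rule: circle_poly.induct)
  case (mode h c n)
  have "continuous_on (sphere 0 1) (\<lambda>z. Re (c * z ^ n))" by (intro continuous_intros)
  then show ?case by (rule continuous_on_eq) (use mode in auto)
next
  case (add h1 h2 h)
  have "continuous_on (sphere 0 1) (\<lambda>z. h1 z + h2 z)" by (intro continuous_intros add.IH)
  then show ?case by (rule continuous_on_eq) (use add in auto)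
qed

text \<open>Stone-Weierstrass on the circle; every element of the algebra agrees there with a
  harmonic polynomial.\<close>

lemma harmonic_poly_dense:
  assumes "continuous_on (sphere 0 1) f" "e > 0"
  obtains c N where "\<And>z. cmod z = 1 \<Longrightarrow> \<bar>f z - harmonic_poly c N z\<bar> < e"
proof -
  interpret function_ring_on "Collect circle_poly" "sphere 0 1"
  proof
    show "(\<lambda>_. c) \<in> Collect circle_poly" for c
      by (auto intro!: circle_poly.mode[of _ "of_real c" 0])
    fix x y :: complex assume xy: "x \<in> sphere 0 1" "y \<in> sphere 0 1" "x \<noteq> y"
    \<comment> \<open>Real and imaginary part as modes of degree one; together they separate
      points.\<close>
    have "circle_poly (\<lambda>z. Re (1 * z ^ 1))" "circle_poly (\<lambda>z. Re ((- \<i>) * z ^ 1))"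
      by (rule circle_poly.mode, rule refl)+
    moreover have "Re x \<noteq> Re y \<or> Im x \<noteq> Im y" using xy by (auto simp: complex_eq_iff)
    ultimately show "\<exists>f\<in>Collect circle_poly. f x \<noteq> f y"
      by (elim disjE) (rule bexI[where x = "\<lambda>z. Re (1 * z ^ 1)"] bexI[where x = "\<lambda>z. Re ((- \<i>) * z ^ 1)"]; simp)+
  qed (auto intro: circle_poly_continuous circle_poly_mult circle_poly.add)
  obtain g where "g \<in> Collect circle_poly" and g: "\<forall>x\<in>sphere 0 1. \<bar>f x - g x\<bar> < e"
    using Stone_Weierstrass_basic[OF assms] by blast
  then obtain c N where "\<forall>z. cmod z = 1 \<longrightarrow> g z = harmonic_poly c N z"
    using circle_poly_eq_harmonic_poly by blast
  with g have "\<And>z. cmod z = 1 \<Longrightarrow> \<bar>f z - harmonic_poly c N z\<bar> < e" by auto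
  then show thesis by (rule that)
qed

lemma harmonic_poly_continuous: "continuous_on S (harmonic_poly c N)"
  unfolding harmonic_poly_def by (intro continuous_intros)

lemma cis_continuous_circle:
  fixes F :: "complex \<Rightarrow> 'b::topological_space"
  assumes "continuous_on (sphere 0 1) F"
  shows "continuous_on S (\<lambda>t. F (cis t))"
  by (rule continuous_on_compose2[OF assms]) (auto intro: continuous_intros)

lemma harmonic_poly_square_integrable: "square_integrable circle_measure (\<lambda>t. harmonic_poly c N (cis t))"
  by (intro continuous_square_integrable_circle cis_continuous_circle harmonic_poly_continuous)

section \<open>Fourier coefficients and mean-square convergence\<close>

lemma integral_cis_multiple:
  "(LINT t|circle_measure. cis (of_int k * t)) = (if k = 0 then of_real (2 * pi) else 0)"
proof -
  have "continuous_on {0..2*pi} (\<lambda>t. cis (of_int k * t))" by (intro continuous_intros)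
  then have "(LINT t|circle_measure. cis (of_int k * t)) = integral {0..2*pi} (\<lambda>t. cis (of_int k * t))"
    by (rule integral_circle_eq)
  also have "\<dots> = (if k = 0 then of_real (2 * pi) else 0)"
  proof (cases "k = 0")
    case True
    then show ?thesis by (simp add: scaleR_conv_of_real)
  next
    case False
    have "((\<lambda>t. cis (of_int k * t)) has_integral cis (of_int k * (2*pi)) / (\<i> * of_int k) - cis (of_int k * 0) / (\<i> * of_int k)) {0..2*pi}"
    proof (rule fundamental_theorem_of_calculus)
      fix t :: real
      have "((\<lambda>t. cis (of_int k * t)) has_derivative (\<lambda>h. (of_int k * h) *\<^sub>R (\<i> * cis (of_int k * t)))) (at t within {0..2*pi})"
        by (auto intro!: derivative_eq_intros)
      then have "((\<lambda>t. cis (of_int k * t) / (\<i> * of_int k)) has_derivative (\<lambda>h. (of_int k * h) *\<^sub>R (\<i> * cis (of_int k * t)) / (\<i> * of_int k))) (at t within {0..2*pi})"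
        by (rule bounded_linear.has_derivative[OF bounded_linear_divide])
      also have "(\<lambda>h. (of_int k * h) *\<^sub>R (\<i> * cis (of_int k * t)) / (\<i> * of_int k)) = (\<lambda>h. h *\<^sub>R cis (of_int k * t))"
        using False by (simp add: fun_eq_iff scaleR_conv_of_real field_simps)
      finally show "((\<lambda>t. cis (of_int k * t) / (\<i> * of_int k)) has_vector_derivative cis (of_int k * t)) (at t within {0..2*pi})"
        by (simp add: has_vector_derivative_def)
    qed simp
    moreover have "cis (of_int k * (2*pi)) = 1"
      using cis_multiple_2pi[of "of_int k"] by (simp add: mult.commute)
    ultimately show ?thesis using False by (simp add: integral_unique)
  qed
  finally show ?thesis .
qed

lemma fourier_coeff_scaleR:
  "fourier_coeff g n = (LINT t|circle_measure. g (cis t) *\<^sub>R cis (- (of_int n * t))) /\<^sub>R (2 * pi)"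
  by (simp only: fourier_coeff_def scaleR_conv_of_real divide_inverse of_real_inverse mult.commute[of "inverse _"])

lemma fourier_integrable:
  assumes "square_integrable circle_measure (\<lambda>t. g (cis t))"
  shows "integrable circle_measure (\<lambda>t. g (cis t) *\<^sub>R cis (- (of_int n * t)))"
  by (rule square_integrable_integrable_scaleR(1)[OF assms], rule continuous_square_integrable_circle, intro continuous_intros)

lemma fourier_coeff_diff:
  assumes "square_integrable circle_measure (\<lambda>t. f (cis t))" "square_integrable circle_measure (\<lambda>t. g (cis t))"
  shows "fourier_coeff (\<lambda>z. f z - g z) n = fourier_coeff f n - fourier_coeff g n"
  unfolding fourier_coeff_scaleR scaleR_diff_left
    Bochner_Integration.integral_diff[OF fourier_integrable[OF assms(1)] fourier_integrable[OF assms(2)]]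
  by (rule scaleR_diff_right)

lemma fourier_coeff_sum:
  assumes "\<And>i. i \<in> I \<Longrightarrow> square_integrable circle_measure (\<lambda>t. f i (cis t))"
  shows "fourier_coeff (\<lambda>z. \<Sum>i\<in>I. f i z) n = (\<Sum>i\<in>I. fourier_coeff (f i) n)"
  unfolding fourier_coeff_scaleR scaleR_sum_left
  by (subst Bochner_Integration.integral_sum[OF fourier_integrable[OF assms]]) (simp_all only: scaleR_sum_right)

lemma integral_mult_mode:
  assumes "square_integrable circle_measure (\<lambda>t. g (cis t))"
  shows "(LINT t|circle_measure. g (cis t) * Re (c * cis t ^ n)) = 2 * pi * (c \<bullet> fourier_coeff g (int n))"
proof -
  have "Re (c * cis t ^ n) = c \<bullet> cis (- (of_int (int n) * t))" for t
    by (simp add: Complex.DeMoivre inner_complex_def)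
  then have "(LINT t|circle_measure. g (cis t) * Re (c * cis t ^ n)) = (LINT t|circle_measure. c \<bullet> (g (cis t) *\<^sub>R cis (- (of_int (int n) * t))))"
    by simp
  also have "\<dots> = c \<bullet> (LINT t|circle_measure. g (cis t) *\<^sub>R cis (- (of_int (int n) * t)))"
    by (rule integral_inner_right) (use fourier_integrable[OF assms] in blast)
  finally show ?thesis by (simp add: fourier_coeff_scaleR)
qed

text \<open>Re (a z^k) is half of a z^k + cnj a z^(-k) on the circle. For nonnegative n the second
  term is seen only when k and n are both zero.\<close>

lemma fourier_coeff_mode:
  "fourier_coeff (\<lambda>z. Re (a * z ^ k)) (int n) = ((if k = n then a else 0) + (if k = 0 \<and> n = 0 then cnj a else 0)) / 2"
proof -
  have int: "integrable circle_measure (\<lambda>t. c * cis (of_int j * t))" for c j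
    by (intro continuous_imp_integrable_real continuous_intros)
  have eq: "Re (a * cis t ^ k) *\<^sub>R cis (- (of_int (int n) * t)) =
      (a * cis (of_int (int k - int n) * t) + cnj a * cis (of_int (- int k - int n) * t)) / 2" for t
  proof -
    have "Re (a * cis t ^ k) *\<^sub>R cis (- (of_int (int n) * t)) =
       (a * cis (real k * t) + cnj (a * cis (real k * t))) / 2 * cis (- (real n * t))"
    proof -
      have "complex_of_real (Re w) = (w + cnj w) / 2" for w by (simp add: complex_add_cnj)
      then show ?thesis by (simp only: scaleR_conv_of_real Complex.DeMoivre of_int_of_nat_eq)
    qed
    also have "\<dots> = (a * (cis (real k * t) * cis (- (real n * t))) + cnj a * (cis (- (real k * t)) * cis (- (real n * t)))) / 2"
      by (simp add: algebra_simps cis_cnj)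
    finally show ?thesis unfolding cis_mult by (simp add: algebra_simps)
  qed
  have "(LINT t|circle_measure. Re (a * cis t ^ k) *\<^sub>R cis (- (of_int (int n) * t))) =
      (a * (if int k - int n = 0 then of_real (2 * pi) else 0) + cnj a * (if - int k - int n = 0 then of_real (2 * pi) else 0)) / 2"
    unfolding eq
  proof -
    show "(LINT t|circle_measure. (a * cis (of_int i * t) + b * cis (of_int j * t)) / 2) =
        (a * (if i = 0 then of_real (2 * pi) else 0) + b * (if j = 0 then of_real (2 * pi) else 0)) / 2" for a b i j
      using int[of a i] int[of b j] by (simp add: integral_cis_multiple)
  qed
  also have "\<dots> = (2 * pi) *\<^sub>R (((if k = n then a else 0) + (if k = 0 \<and> n = 0 then cnj a else 0)) / 2)"
    by (auto simp: scaleR_conv_of_real algebra_simps)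
  finally show ?thesis by (simp add: fourier_coeff_scaleR)
qed

text \<open>For a real function the coefficients at n and - n are conjugate, so the two-sided series
  folds into the real part of a one-sided one. All coefficients double except the constant
  one.\<close>

definition fourier_poly_coeff :: "(complex \<Rightarrow> real) \<Rightarrow> nat \<Rightarrow> complex" where
  "fourier_poly_coeff g n = (if n = 0 then 1 else 2) * fourier_coeff g (int n)"

lemma fourier_coeff_0_real: "cnj (fourier_coeff g 0) = fourier_coeff g 0"
proof -
  have "(LINT t|circle_measure. complex_of_real (g (cis t))) = of_real (LINT t|circle_measure. g (cis t))"
    by (rule integral_complex_of_real)
  then show ?thesis by (simp add: fourier_coeff_def)
qed

lemma fourier_coeff_harmonic_poly:
  assumes "n \<le> N"
  shows "fourier_coeff (harmonic_poly (fourier_poly_coeff g) N) (int n) = fourier_coeff g (int n)"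
proof -
  let ?c = "fourier_poly_coeff g"
  have sq: "square_integrable circle_measure (\<lambda>t. Re (?c i * cis t ^ i))" for i
    by (intro continuous_square_integrable_circle continuous_intros)
  have "fourier_coeff (harmonic_poly ?c N) (int n) = (\<Sum>i\<le>N. fourier_coeff (\<lambda>z. Re (?c i * z ^ i)) (int n))"
    unfolding harmonic_poly_def by (rule fourier_coeff_sum) (rule sq)
  also have "\<dots> = (\<Sum>i\<le>N. if i = n then fourier_coeff g (int n) else 0)"
  proof (intro sum.cong refl)
    show "fourier_coeff (\<lambda>z. Re (?c i * z ^ i)) (int n) = (if i = n then fourier_coeff g (int n) else 0)" for i
      unfolding fourier_coeff_mode by (auto simp: fourier_poly_coeff_def fourier_coeff_0_real)
  qed
  also have "\<dots> = fourier_coeff g (int n)" using assms by simp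
  finally show ?thesis .
qed

text \<open>The residual has vanishing coefficients up to degree N and is therefore orthogonal to
  every harmonic polynomial of that degree; the claim is Pythagoras.\<close>

lemma fourier_best_approximation:
  assumes g: "square_integrable circle_measure (\<lambda>t. g (cis t))"
  shows "l2norm circle_measure (\<lambda>t. harmonic_poly (fourier_poly_coeff g) N (cis t) - g (cis t)) \<le>
    l2norm circle_measure (\<lambda>t. harmonic_poly d N (cis t) - g (cis t))"
proof -
  let ?c = "fourier_poly_coeff g"
  define r where "r z = harmonic_poly ?c N z - g z" for z
  define q where "q = harmonic_poly (\<lambda>n. d n - ?c n) N"
  note sc = harmonic_poly_square_integrable
  have sr: "square_integrable circle_measure (\<lambda>t. r (cis t))"
    unfolding r_def by (rule square_integrable_diff[OF sc g])
  have sq: "square_integrable circle_measure (\<lambda>t. q (cis t))" unfolding q_def by (rule sc)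
  have r0: "fourier_coeff r (int n) = 0" if "n \<le> N" for n
    unfolding r_def by (subst fourier_coeff_diff[OF sc g]) (simp add: fourier_coeff_harmonic_poly that)
  have "(LINT t|circle_measure. r (cis t) * q (cis t)) = (\<Sum>n\<le>N. LINT t|circle_measure. r (cis t) * Re ((d n - ?c n) * cis t ^ n))"
    unfolding q_def harmonic_poly_def sum_distrib_left
  proof (rule Bochner_Integration.integral_sum)
    fix n
    have "square_integrable circle_measure (\<lambda>t. Re ((d n - ?c n) * cis t ^ n))"
      by (intro continuous_square_integrable_circle continuous_intros)
    from square_integrable_integrable_inner[OF sr this]
    show "integrable circle_measure (\<lambda>t. r (cis t) * Re ((d n - ?c n) * cis t ^ n))" by simp
  qed
  also have "\<dots> = 0"
    by (intro sum.neutral ballI) (simp only: integral_mult_mode[OF sr] r0 atMost_iff inner_zero_right mult_zero_right)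
  finally have orth: "(LINT t|circle_measure. r (cis t) * q (cis t)) = 0" .
  have eq: "harmonic_poly d N z - g z = r z + q z" for z
  proof -
    have "harmonic_poly d N z = harmonic_poly ?c N z + q z"
      by (simp add: q_def harmonic_poly_def sum.distrib[symmetric] left_diff_distrib)
    then show ?thesis by (simp add: r_def)
  qed
  have irq: "integrable circle_measure (\<lambda>t. r (cis t) * q (cis t))"
    using square_integrable_integrable_inner[OF sr sq] by simp
  have ir: "integrable circle_measure (\<lambda>t. (r (cis t))\<^sup>2)" and iq: "integrable circle_measure (\<lambda>t. (q (cis t))\<^sup>2)"
    using sr sq by (auto simp: square_integrable_def)
  have "(l2norm circle_measure (\<lambda>t. harmonic_poly d N (cis t) - g (cis t)))\<^sup>2
      = (LINT t|circle_measure. (r (cis t))\<^sup>2 + 2 * (r (cis t) * q (cis t)) + (q (cis t))\<^sup>2)"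
    unfolding eq l2norm_power2 by (simp add: power2_sum algebra_simps)
  also have "\<dots> = (LINT t|circle_measure. (r (cis t))\<^sup>2) + (LINT t|circle_measure. (q (cis t))\<^sup>2)"
    using ir iq irq orth by simp
  also have "\<dots> \<ge> (LINT t|circle_measure. (r (cis t))\<^sup>2)" by simp
  finally have "(l2norm circle_measure (\<lambda>t. r (cis t)))\<^sup>2 \<le> (l2norm circle_measure (\<lambda>t. harmonic_poly d N (cis t) - g (cis t)))\<^sup>2"
    by (simp add: l2norm_power2)
  then have "l2norm circle_measure (\<lambda>t. r (cis t)) \<le> l2norm circle_measure (\<lambda>t. harmonic_poly d N (cis t) - g (cis t))"
    by (rule power2_le_imp_le) simp
  then show ?thesis by (simp add: r_def)
qed

lemma harmonic_poly_extend:
  assumes "N \<le> M"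
  shows "harmonic_poly c N z = harmonic_poly (\<lambda>n. if n \<le> N then c n else 0) M z"
  unfolding harmonic_poly_def using assms by (intro sum.mono_neutral_cong_left) auto

text \<open>Approximability by continuous functions is a hypothesis here; in the application it is
  supplied by the C^1 functions that define the trace. Stone-Weierstrass and the best approximation
  property do the rest.\<close>

lemma fourier_series_l2_convergence:
  assumes g: "square_integrable circle_measure (\<lambda>t. g (cis t))"
    and dense: "\<And>e. e > 0 \<Longrightarrow> \<exists>f. continuous_on (sphere 0 1) f \<and> l2norm circle_measure (\<lambda>t. f (cis t) - g (cis t)) < e"
  shows "(\<lambda>N. l2norm circle_measure (\<lambda>t. harmonic_poly (fourier_poly_coeff g) N (cis t) - g (cis t))) \<longlonglongrightarrow> 0"
proof (rule LIMSEQ_I)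
  fix e :: real assume e: "e > 0"
  then have e2: "e/2 > 0" and e6: "e/6 > 0" by simp_all
  from dense[OF e2] obtain f where f: "continuous_on (sphere 0 1) f"
    and fg: "l2norm circle_measure (\<lambda>t. f (cis t) - g (cis t)) < e/2"
    by (elim exE conjE)
  \<comment> \<open>The uniform error e/6 becomes at most e/2 in mean square, because the circle has
    length 2 pi, which is at most 9.\<close>
  obtain d M where d: "\<And>z. cmod z = 1 \<Longrightarrow> \<bar>f z - harmonic_poly d M z\<bar> < e/6"
    by (rule harmonic_poly_dense[OF f e6]) (rule that)
  have sf: "square_integrable circle_measure (\<lambda>t. f (cis t))"
    by (intro continuous_square_integrable_circle cis_continuous_circle f)
  note sh = harmonic_poly_square_integrable[of d M]
  have fd: "l2norm circle_measure (\<lambda>t. harmonic_poly d M (cis t) - f (cis t)) \<le> e/2"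
  proof -
    have "(l2norm circle_measure (\<lambda>t. harmonic_poly d M (cis t) - f (cis t)))\<^sup>2 =
        (LINT t|circle_measure. (norm (harmonic_poly d M (cis t) - f (cis t)))\<^sup>2)"
      by (rule l2norm_power2)
    also have "\<dots> \<le> (LINT t|circle_measure. (e/6)\<^sup>2)"
    proof (rule integral_mono)
      show "integrable circle_measure (\<lambda>t. (norm (harmonic_poly d M (cis t) - f (cis t)))\<^sup>2)"
        using square_integrable_diff[OF sh sf] by (simp add: square_integrable_def)
      show "(norm (harmonic_poly d M (cis t) - f (cis t)))\<^sup>2 \<le> (e/6)\<^sup>2" for t
        using d[of "cis t"] by (intro power_mono) (auto simp: abs_minus_commute)
    qed simp
    also have "\<dots> = (e/6)\<^sup>2 * (2 * pi)" by (simp add: measure_restrict_space)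
    also have "\<dots> \<le> (e/6)\<^sup>2 * 9"
      using pi_less_4 by (intro mult_left_mono) auto
    also have "\<dots> = (e/2)\<^sup>2" by (simp add: power2_eq_square)
    finally show ?thesis by (rule power2_le_imp_le) (use e in simp)
  qed
  have "norm (l2norm circle_measure (\<lambda>t. harmonic_poly (fourier_poly_coeff g) N (cis t) - g (cis t)) - 0) < e" if "N \<ge> M" for N
  proof -
    have "l2norm circle_measure (\<lambda>t. harmonic_poly (fourier_poly_coeff g) N (cis t) - g (cis t))
      \<le> l2norm circle_measure (\<lambda>t. harmonic_poly d M (cis t) - g (cis t))"
      \<comment> \<open>The competitor of degree \<open>M\<close> is padded with zero coefficients
        to degree \<open>N\<close>.\<close>
      unfolding harmonic_poly_extend[OF that, of d] by (rule fourier_best_approximation[OF g])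
    also have "\<dots> \<le> l2norm circle_measure (\<lambda>t. harmonic_poly d M (cis t) - f (cis t)) + l2norm circle_measure (\<lambda>t. f (cis t) - g (cis t))"
      by (rule l2norm_triangle_diff[OF sh sf g])
    finally show ?thesis using fd fg by simp
  qed
  then show "\<exists>no. \<forall>n\<ge>no. norm (l2norm circle_measure (\<lambda>t. harmonic_poly (fourier_poly_coeff g) n (cis t) - g (cis t)) - 0) < e"
    by (intro exI[of _ M] allI impI)
qed

text \<open>The frequencies are an arbitrary injective family, since the gradients of modes carry
  the frequencies n - 1 and - n - 1 and not n.\<close>

lemma Parseval_finite:
  assumes fin: "finite S" and inj: "inj_on k S"
  shows "(LINT t|circle_measure. (cmod (\<Sum>n\<in>S. a n * cis (of_int (k n) * t)))\<^sup>2) = 2 * pi * (\<Sum>n\<in>S. (cmod (a n))\<^sup>2)"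
proof -
  let ?f = "\<lambda>t. \<Sum>n\<in>S. a n * cis (of_int (k n) * t)"
  have int: "integrable circle_measure (\<lambda>t. c * cis (of_int j * t))" for c j
    by (intro continuous_imp_integrable_real continuous_intros)
  have eq: "complex_of_real ((cmod (?f t))\<^sup>2) = (\<Sum>n\<in>S. \<Sum>m\<in>S. (a n * cnj (a m)) * cis (of_int (k n - k m) * t))" for t
  proof -
    have "complex_of_real ((cmod (?f t))\<^sup>2) = ?f t * cnj (?f t)" by (rule complex_norm_square)
    also have "\<dots> = (\<Sum>n\<in>S. \<Sum>m\<in>S. (a n * cis (of_int (k n) * t)) * (cnj (a m) * cis (- (of_int (k m) * t))))"
      by (simp only: cnj_sum complex_cnj_mult cis_cnj sum_product)
    also have "\<dots> = (\<Sum>n\<in>S. \<Sum>m\<in>S. (a n * cnj (a m)) * (cis (of_int (k n) * t) * cis (- (of_int (k m) * t))))"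
      by (simp only: mult_ac)
    finally show ?thesis unfolding cis_mult by (simp add: left_diff_distrib)
  qed
  have "complex_of_real (LINT t|circle_measure. (cmod (?f t))\<^sup>2) = (LINT t|circle_measure. complex_of_real ((cmod (?f t))\<^sup>2))"
    by (rule integral_complex_of_real[symmetric])
  also have "\<dots> = (\<Sum>n\<in>S. \<Sum>m\<in>S. (LINT t|circle_measure. (a n * cnj (a m)) * cis (of_int (k n - k m) * t)))"
    unfolding eq
    by (rule trans[OF Bochner_Integration.integral_sum sum.cong[OF refl Bochner_Integration.integral_sum]])
      ((rule Bochner_Integration.integrable_sum)?, rule int)+
  also have "\<dots> = (\<Sum>n\<in>S. \<Sum>m\<in>S. (a n * cnj (a m)) * (if n = m then of_real (2 * pi) else 0))"
  proof (intro sum.cong refl)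
    fix n m assume "n \<in> S" "m \<in> S"
    then have "k n - k m = 0 \<longleftrightarrow> n = m" using inj by (auto dest: inj_onD)
    then show "(LINT t|circle_measure. (a n * cnj (a m)) * cis (of_int (k n - k m) * t)) = (a n * cnj (a m)) * (if n = m then of_real (2 * pi) else 0)"
      by (subst integral_mult_right_zero) (simp only: integral_cis_multiple)
  qed
  also have "\<dots> = (\<Sum>n\<in>S. complex_of_real (2 * pi * (cmod (a n))\<^sup>2))"
    using fin by (intro sum.cong refl) (simp add: if_distrib[of "\<lambda>x. _ * x"] sum.delta complex_norm_square[symmetric] mult.commute cong: if_cong)
  also have "\<dots> = complex_of_real (2 * pi * (\<Sum>n\<in>S. (cmod (a n))\<^sup>2))"
    by (simp add: sum_distrib_left)
  finally show ?thesis by (simp only: of_real_eq_iff)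
qed

section \<open>The concentric disk: explicit solutions\<close>

lemma (in finite_measure) l2norm_dominated_convergence:
  fixes f :: "nat \<Rightarrow> 'a \<Rightarrow> 'b::{banach,second_countable_topology}"
  assumes meas: "\<And>k. f k \<in> borel_measurable M" and bound: "\<And>k x. x \<in> space M \<Longrightarrow> norm (f k x) \<le> B"
    and lim: "\<And>x. x \<in> space M \<Longrightarrow> (\<lambda>k. f k x) \<longlonglongrightarrow> g x"
  shows "square_integrable M g" "(\<lambda>k. l2norm M (\<lambda>x. f k x - g x)) \<longlonglongrightarrow> 0"
proof -
  have [measurable]: "f k \<in> borel_measurable M" for k by (rule meas)
  have g [measurable]: "g \<in> borel_measurable M"
    by (rule borel_measurable_LIMSEQ_metric[OF meas lim])
  have gB: "norm (g x) \<le> B" if "x \<in> space M" for x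
    by (rule LIMSEQ_le_const2[OF tendsto_norm[OF lim[OF that]]]) (use bound[OF that] in blast)
  show "square_integrable M g" by (rule square_integrable_bounded[OF g gB])
  have "(\<lambda>k. LINT x|M. (norm (f k x - g x))\<^sup>2) \<longlonglongrightarrow> (LINT x|M. 0)"
  proof (rule integral_dominated_convergence[where w = "\<lambda>_. (2 * B)\<^sup>2"])
    show "AE x in M. (\<lambda>k. (norm (f k x - g x))\<^sup>2) \<longlonglongrightarrow> 0"
    proof (rule AE_I2)
      fix x assume x: "x \<in> space M"
      have "(\<lambda>k. (norm (f k x - g x))\<^sup>2) \<longlonglongrightarrow> (norm (g x - g x))\<^sup>2"
        by (intro tendsto_intros lim[OF x])
      then show "(\<lambda>k. (norm (f k x - g x))\<^sup>2) \<longlonglongrightarrow> 0" by simp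
    qed
    show "AE x in M. norm ((norm (f k x - g x))\<^sup>2) \<le> (2 * B)\<^sup>2" for k
    proof (rule AE_I2)
      fix x assume x: "x \<in> space M"
      have "norm (f k x - g x) \<le> 2 * B"
        using norm_triangle_ineq4[of "f k x" "g x"] bound[OF x, of k] gB[OF x] by linarith
      then have "(norm (f k x - g x))\<^sup>2 \<le> (2 * B)\<^sup>2" by (rule power_mono) simp
      then show "norm ((norm (f k x - g x))\<^sup>2) \<le> (2 * B)\<^sup>2" by simp
    qed
  qed measurable
  then have "(\<lambda>k. LINT x|M. (norm (f k x - g x))\<^sup>2) \<longlonglongrightarrow> 0" by simp
  from tendsto_real_sqrt[OF this] show "(\<lambda>k. l2norm M (\<lambda>x. f k x - g x)) \<longlonglongrightarrow> 0"
    by (simp add: l2norm_def)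
qed

text \<open>The way by which functions with a kink acquire a trace: uniformly bounded C^1 functions
  whose values and gradients converge at every point of the closed disk converge in all three
  mean-square norms.\<close>

lemma H1_trace_pointwise_limit:
  assumes C: "\<And>k. C1_fun (\<phi> k) (\<psi> k)"
    and bound: "\<And>k z. cmod z \<le> 1 \<Longrightarrow> \<bar>\<phi> k z\<bar> \<le> B" "\<And>k z. cmod z \<le> 1 \<Longrightarrow> norm (\<psi> k z) \<le> B"
    and lim: "\<And>z. cmod z \<le> 1 \<Longrightarrow> (\<lambda>k. \<phi> k z) \<longlonglongrightarrow> u z" "\<And>z. cmod z \<le> 1 \<Longrightarrow> (\<lambda>k. \<psi> k z) \<longlonglongrightarrow> G z"
  shows "H1_trace u G u"
proof -
  note sq = C1_fun_square_integrable[OF C]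
  have m: "\<phi> k \<in> borel_measurable disk_measure" "\<psi> k \<in> borel_measurable disk_measure"
    "(\<lambda>t. \<phi> k (cis t)) \<in> borel_measurable circle_measure" for k
    using sq[of k] by (simp_all add: square_integrable_def)
  note 1 = disk_measure.l2norm_dominated_convergence[where f = \<phi> and B = B and g = u, OF m(1)]
  note 2 = disk_measure.l2norm_dominated_convergence[where f = \<psi> and B = B and g = G, OF m(2)]
  note 3 = circle_measure.l2norm_dominated_convergence[where f = "\<lambda>k t. \<phi> k (cis t)" and B = B and g = "\<lambda>t. u (cis t)", OF m(3)]
  have s: "cmod z \<le> 1" if "z \<in> space disk_measure" for z using that by simp
  show ?thesis
    by (rule H1_trace_closed[OF 1(1) 2(1) 3(1) H1_trace_C1_fun[OF C] 1(2) 2(2) 3(2)])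
      (use bound lim s in auto)
qed

lemma continuous_annulus_integrable:
  fixes F :: "complex \<Rightarrow> 'b::euclidean_space"
  assumes "continuous_on (annulus a b) F"
  shows "integrable lebesgue (\<lambda>z. indicator (annulus a b) z *\<^sub>R F z)"
proof -
  have "integrable lborel (\<lambda>z. indicator (annulus a b) z *\<^sub>R F z)"
    by (rule borel_integrable_compact[OF compact_annulus assms])
  then show ?thesis
    by (subst integrable_completion) (auto simp: borel_measurable_integrable)
qed

text \<open>The integrand jumps at radius \<rho>, but each one-sided expression extends continuously
  to the closed annulus on its side. The circles of radius \<rho> and 1 are null sets, so values
  there do not matter.\<close>

lemma integral_disk_split:
  fixes F F1 F2 :: "complex \<Rightarrow> 'b::euclidean_space"
  assumes F: "F \<in> borel_measurable disk_measure"
    and "0 \<le> a" "a \<le> \<rho>" "\<rho> \<le> b" "b \<le> 1"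
    and F1: "continuous_on (annulus a \<rho>) F1" "\<And>z. a \<le> cmod z \<Longrightarrow> cmod z < \<rho> \<Longrightarrow> F z = F1 z"
    and F2: "continuous_on (annulus \<rho> b) F2" "\<And>z. \<rho> < cmod z \<Longrightarrow> cmod z \<le> b \<Longrightarrow> F z = F2 z"
  shows "(LINT z|disk_measure. indicator (annulus a b) z *\<^sub>R F z) =
    (LINT z|lebesgue_on (annulus a \<rho>). F1 z) + (LINT z|lebesgue_on (annulus \<rho> b). F2 z)"
proof -
  let ?I1 = "\<lambda>z. indicator (annulus a \<rho>) z *\<^sub>R F1 z" and ?I2 = "\<lambda>z. indicator (annulus \<rho> b) z *\<^sub>R F2 z"
  have m: "(\<lambda>z. indicator Omega z *\<^sub>R F z) \<in> borel_measurable lebesgue"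
    using F by (subst (asm) borel_measurable_restrict_space_iff) auto
  have m2: "(\<lambda>z. indicator Omega z *\<^sub>R (indicator (annulus a b) z *\<^sub>R F z)) \<in> borel_measurable lebesgue"
  proof -
    have "(\<lambda>z. indicator (annulus a b) z *\<^sub>R (indicator Omega z *\<^sub>R F z)) \<in> borel_measurable lebesgue"
      by (rule borel_measurable_scaleR[OF borel_measurable_indicator m]) simp
    then show ?thesis by (simp add: mult.commute)
  qed
  note int = continuous_annulus_integrable[OF F1(1)] continuous_annulus_integrable[OF F2(1)]
  have "sphere (0::complex) \<rho> \<union> sphere 0 1 \<in> null_sets lebesgue"
    using negligible_sphere[of "0::complex" \<rho>] negligible_sphere[of "0::complex" 1] by (intro null_sets.Un) (simp_all add: negligible_iff_null_sets)
  then have ae: "AE z in lebesgue. indicator Omega z *\<^sub>R (indicator (annulus a b) z *\<^sub>R F z) = ?I1 z + ?I2 z"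
  proof (rule AE_I', intro subsetI)
    fix z assume z: "z \<in> {z \<in> space lebesgue. indicator Omega z *\<^sub>R (indicator (annulus a b) z *\<^sub>R F z) \<noteq> ?I1 z + ?I2 z}"
    show "z \<in> sphere 0 \<rho> \<union> sphere 0 1"
    proof (rule ccontr)
      assume "z \<notin> sphere 0 \<rho> \<union> sphere 0 1"
      then consider "cmod z < \<rho>" | "\<rho> < cmod z" "cmod z < 1" | "cmod z > 1" by fastforce
      then show False
      proof cases
        case 1
        then show ?thesis using z assms(2-5) F1(2)[of z] by (simp add: indicator_def annulus_def split: if_splits)
      next
        case 2
        then show ?thesis using z assms(2-5) F2(2)[of z] by (simp add: indicator_def annulus_def split: if_splits)
      next
        case 3
        then show ?thesis using z assms(2-5) by (simp add: indicator_def annulus_def split: if_splits)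
      qed
    qed
  qed
  have "(LINT z|disk_measure. indicator (annulus a b) z *\<^sub>R F z) = (LINT z|lebesgue. indicator Omega z *\<^sub>R (indicator (annulus a b) z *\<^sub>R F z))"
    by (simp add: integral_restrict_space)
  also have "\<dots> = (LINT z|lebesgue. ?I1 z + ?I2 z)"
    by (rule integral_cong_AE[OF m2 _ ae]) (use int in auto)
  also have "\<dots> = (LINT z|lebesgue. ?I1 z) + (LINT z|lebesgue. ?I2 z)"
    by (rule Bochner_Integration.integral_add[OF int])
  finally show ?thesis by (simp add: integral_restrict_space)
qed

text \<open>The gradient of a harmonic function is \<open>cnj f\<close> with f holomorphic. By the
  Cauchy-Riemann equations \<open>cnj f\<close> is divergence free, so the divergence of
  \<open>\<phi> z *\<^sub>R cnj (f z)\<close> is \<open>cnj (f z) \<bullet> \<psi> z\<close>; its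
  normal component on a circle is \<phi> times the real part of f * cis t.\<close>

lemma Green_annulus:
  assumes ab: "0 \<le> a" "a \<le> b" and C: "C1_fun \<phi> \<psi>"
    and f: "\<And>z. z \<in> annulus a b \<Longrightarrow> (f has_field_derivative f' z) (at z)"
    and cf': "continuous_on (annulus a b) f'"
  shows "(LINT z|lebesgue_on (annulus a b). cnj (f z) \<bullet> \<psi> z) =
    integral {0..2*pi} (\<lambda>t. b * (\<phi> (of_real b * cis t) * Re (f (of_real b * cis t) * cis t))) -
    integral {0..2*pi} (\<lambda>t. a * (\<phi> (of_real a * cis t) * Re (f (of_real a * cis t) * cis t)))"
proof -
  let ?X = "\<lambda>z. \<phi> z *\<^sub>R cnj (f z)"
  let ?X' = "\<lambda>z h. \<phi> z *\<^sub>R cnj (f' z * h) + (h \<bullet> \<psi> z) *\<^sub>R cnj (f z)"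
  have cf: "continuous_on (annulus a b) f"
    by (rule continuous_at_imp_continuous_on) (use f DERIV_isCont in blast)
  note ct = C1_fun_continuous[OF C]
  have X: "(?X has_derivative ?X' z) (at z)" if "z \<in> annulus a b" for z
  proof -
    have "(f has_derivative (\<lambda>h. f' z * h)) (at z)"
      using f[OF that] by (simp add: has_field_derivative_def)
    from bounded_linear.has_derivative[OF bounded_linear_cnj this]
    have "((\<lambda>z. cnj (f z)) has_derivative (\<lambda>h. cnj (f' z * h))) (at z)" .
    from has_derivative_scaleR[OF C1_fun_has_derivative[OF C] this] show ?thesis .
  qed
  have d: "Re (?X' z 1) + Im (?X' z \<i>) = cnj (f z) \<bullet> \<psi> z" for z
    by (simp add: inner_complex_def algebra_simps)
  have e: "?X z \<bullet> cis t = \<phi> z * Re (f z * cis t)" for z t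
    by (simp add: inner_complex_def algebra_simps)
  have "continuous_on (annulus a b) (\<lambda>z. ?X' z 1)" "continuous_on (annulus a b) (\<lambda>z. ?X' z \<i>)"
    by (intro continuous_intros cf cf' ct)+
  from divergence_annulus[OF ab X this] show ?thesis
    unfolding d e .
qed

text \<open>
  The transmission solution for the disk of radius \<open>\<rho>\<close> with boundary values \<open>Re (c z\<^sup>n)\<close> is
  \<open>Re (q z\<^sup>n) + \<mu> Re (q \<tau>(z)\<^sup>n)\<close>, where \<open>\<tau>\<close> is the identity inside and the reflection
  \<open>z \<mapsto> \<rho>\<^sup>2 z / |z|\<^sup>2\<close> outside that disk, so \<open>\<tau>(z) = z / max 1 (|z|\<^sup>2 / \<rho>\<^sup>2)\<close>. Traces are defined by
  continuously differentiable functions, so the maximum is replaced by a smooth one.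
\<close>

definition reg_max :: "nat \<Rightarrow> real \<Rightarrow> real" where
  "reg_max k x = (1 + x + sqrt ((x - 1)\<^sup>2 + (1 / Suc k)\<^sup>2)) / 2"

definition reg_max_deriv :: "nat \<Rightarrow> real \<Rightarrow> real" where
  "reg_max_deriv k x = (1 + (x - 1) / sqrt ((x - 1)\<^sup>2 + (1 / Suc k)\<^sup>2)) / 2"

lemma reg_max_radicand_pos: "0 < (x - 1)\<^sup>2 + (1 / real (Suc k))\<^sup>2"
  by (intro add_nonneg_pos zero_le_power2 zero_less_power) (simp only: divide_pos_pos of_nat_0_less_iff zero_less_Suc zero_less_one)

lemma abs_less_reg_max_root: "\<bar>x - 1\<bar> < sqrt ((x - 1)\<^sup>2 + (1 / real (Suc k))\<^sup>2)"
proof (rule real_less_rsqrt)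
  have "0 < (1 / real (Suc k))\<^sup>2" by (rule zero_less_power) (simp only: divide_pos_pos of_nat_0_less_iff zero_less_Suc zero_less_one)
  then show "\<bar>x - 1\<bar>\<^sup>2 < (x - 1)\<^sup>2 + (1 / real (Suc k))\<^sup>2" unfolding power2_abs by linarith
qed

lemma reg_max_ge_1: "1 \<le> reg_max k x"
proof -
  define s where "s = sqrt ((x - 1)\<^sup>2 + (1 / real (Suc k))\<^sup>2)"
  have "\<bar>x - 1\<bar> < s" unfolding s_def by (rule abs_less_reg_max_root)
  then have "1 - x < s" by linarith
  then show ?thesis unfolding reg_max_def s_def[symmetric] by simp
qed

lemma DERIV_reg_max: "(reg_max k has_real_derivative reg_max_deriv k x) (at x)"
proof -
  define c where "c = (1 / real (Suc k))\<^sup>2"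
  have pos: "0 < (x - 1)\<^sup>2 + c" unfolding c_def by (rule reg_max_radicand_pos)
  have "((\<lambda>x. (x - 1)\<^sup>2 + c) has_real_derivative 2 * (x - 1)) (at x)"
    by (rule DERIV_cong[OF DERIV_add[OF DERIV_power[OF DERIV_diff[OF DERIV_ident DERIV_const]] DERIV_const]]) simp
  from DERIV_chain2[OF DERIV_real_sqrt[OF pos] this]
  have s: "((\<lambda>x. sqrt ((x - 1)\<^sup>2 + c)) has_real_derivative inverse (sqrt ((x - 1)\<^sup>2 + c)) / 2 * (2 * (x - 1))) (at x)" .
  have "((\<lambda>x. (1 + x + sqrt ((x - 1)\<^sup>2 + c)) / 2) has_real_derivative
     (1 + inverse (sqrt ((x - 1)\<^sup>2 + c)) / 2 * (2 * (x - 1))) / 2) (at x)"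
    by (rule DERIV_cong[OF DERIV_cdivide[OF DERIV_add[OF DERIV_add[OF DERIV_const DERIV_ident] s]]]) simp
  moreover have "(1 + inverse r / 2 * (2 * (x - 1))) / 2 = (1 + (x - 1) / r) / 2" for r :: real
  proof -
    have "y / 2 * (2 * w) = w * y" for y w :: real by simp
    then show ?thesis by (simp only: divide_inverse[of "x - 1"])
  qed
  ultimately show ?thesis
    unfolding reg_max_def[abs_def] reg_max_deriv_def c_def[symmetric] by (simp only:)
qed

lemma reg_max_deriv_bounds: "0 \<le> reg_max_deriv k x" "reg_max_deriv k x \<le> 1"
proof -
  define s where "s = sqrt ((x - 1)\<^sup>2 + (1 / real (Suc k))\<^sup>2)"
  have "\<bar>x - 1\<bar> < s" unfolding s_def by (rule abs_less_reg_max_root)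
  then have "0 < s" "x - 1 \<le> 1 * s" "- 1 * s \<le> x - 1" by linarith+
  then have "(x - 1) / s \<le> 1" "- 1 \<le> (x - 1) / s"
    by (simp_all only: pos_divide_le_eq pos_le_divide_eq)
  then show "0 \<le> reg_max_deriv k x" "reg_max_deriv k x \<le> 1"
    unfolding reg_max_deriv_def s_def[symmetric] by simp_all
qed

lemma reg_max_root_tendsto: "(\<lambda>k. sqrt ((x - 1)\<^sup>2 + (1 / real (Suc k))\<^sup>2)) \<longlonglongrightarrow> \<bar>x - 1\<bar>"
proof -
  have "(\<lambda>k. 1 / real (Suc k)) \<longlonglongrightarrow> 0"
    using LIMSEQ_inverse_real_of_nat by (simp add: inverse_eq_divide)
  then have "(\<lambda>k. sqrt ((x - 1)\<^sup>2 + (1 / real (Suc k))\<^sup>2)) \<longlonglongrightarrow> sqrt ((x - 1)\<^sup>2 + 0\<^sup>2)"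
    by (intro tendsto_intros)
  then show ?thesis by simp
qed

lemma reg_max_tendsto: "(\<lambda>k. reg_max k x) \<longlonglongrightarrow> max 1 x"
proof -
  have "(\<lambda>k. reg_max k x) \<longlonglongrightarrow> (1 + x + \<bar>x - 1\<bar>) / 2"
    unfolding reg_max_def by (intro tendsto_divide tendsto_add tendsto_const reg_max_root_tendsto) simp
  moreover have "(1 + x + \<bar>x - 1\<bar>) / 2 = max 1 x" by (cases "x \<le> 1") (simp_all add: max_def abs_if)
  ultimately show ?thesis by simp
qed

text \<open>At x = 1 every regularised derivative equals 1/2, which is the value that
  \<open>sgn 0 = 0\<close> produces in the limit.\<close>

lemma reg_max_deriv_tendsto: "(\<lambda>k. reg_max_deriv k x) \<longlonglongrightarrow> (1 + sgn (x - 1)) / 2"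
proof (cases "x = 1")
  case True
  then show ?thesis by (simp add: reg_max_deriv_def)
next
  case False
  have "(\<lambda>k. reg_max_deriv k x) \<longlonglongrightarrow> (1 + (x - 1) / \<bar>x - 1\<bar>) / 2"
    unfolding reg_max_deriv_def
    by (intro tendsto_divide tendsto_add tendsto_const reg_max_root_tendsto) (use False in simp_all)
  moreover have "(x - 1) / \<bar>x - 1\<bar> = sgn (x - 1)" by (rule sym, rule real_sgn_eq)
  ultimately show ?thesis by simp
qed

text \<open>The reflected term Re (q \<tau>(z)^n) is Re (q z^n) times the n-th power of the
  reciprocal maximum, evaluated at |z|^2 / \<rho>^2. Only this radial factor needs
  smoothing.\<close>

definition reg_profile :: "nat \<Rightarrow> nat \<Rightarrow> real \<Rightarrow> real" where
  "reg_profile k n x = inverse (reg_max k x) ^ n"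

definition reg_profile_deriv :: "nat \<Rightarrow> nat \<Rightarrow> real \<Rightarrow> real" where
  "reg_profile_deriv k n x = - real n * inverse (reg_max k x) ^ (n + 1) * reg_max_deriv k x"

definition profile :: "nat \<Rightarrow> real \<Rightarrow> real" where
  "profile n x = inverse (max 1 x) ^ n"

text \<open>At the kink \<open>x = 1\<close> this is the limit of the regularised derivatives, half of the right derivative.\<close>

definition profile_deriv :: "nat \<Rightarrow> real \<Rightarrow> real" where
  "profile_deriv n x = - real n * inverse (max 1 x) ^ (n + 1) * ((1 + sgn (x - 1)) / 2)"

lemma DERIV_reg_profile: "(reg_profile k n has_real_derivative reg_profile_deriv k n x) (at x)"
proof -
  have nz: "reg_max k x \<noteq> 0" using reg_max_ge_1[of k x] by simp
  have "((\<lambda>x. inverse (reg_max k x) ^ n) has_real_derivative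
      real n * inverse (reg_max k x) ^ (n - 1) * (- (inverse (reg_max k x) * reg_max_deriv k x * inverse (reg_max k x)))) (at x)"
    by (rule DERIV_cong[OF DERIV_power[OF DERIV_inverse'[OF DERIV_reg_max nz]]]) (simp add: mult_ac)
  moreover have "real n * inverse (reg_max k x) ^ (n - 1) * (- (inverse (reg_max k x) * reg_max_deriv k x * inverse (reg_max k x)))
      = reg_profile_deriv k n x"
    by (cases n) (simp_all add: reg_profile_deriv_def algebra_simps)
  ultimately show ?thesis by (simp add: reg_profile_def[abs_def])
qed

lemma reg_profile_bounds: "0 \<le> reg_profile k n x" "reg_profile k n x \<le> 1" "\<bar>reg_profile_deriv k n x\<bar> \<le> n"
proof -
  have i: "0 \<le> inverse (reg_max k x)" "inverse (reg_max k x) \<le> 1"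
    using reg_max_ge_1[of k x] by (auto simp: inverse_le_1_iff)
  then show "0 \<le> reg_profile k n x" "reg_profile k n x \<le> 1"
    unfolding reg_profile_def by (auto intro: power_le_one)
  have "\<bar>reg_profile_deriv k n x\<bar> = real n * (inverse (reg_max k x) ^ (n + 1) * reg_max_deriv k x)"
    using i(1) reg_max_deriv_bounds(1)[of k x] by (simp add: reg_profile_deriv_def abs_mult power_abs)
  also have "\<dots> \<le> real n * (1 * 1)"
    using i reg_max_deriv_bounds[of k x] by (intro mult_left_mono mult_mono power_le_one) auto
  finally show "\<bar>reg_profile_deriv k n x\<bar> \<le> n" by simp
qed

lemma reg_profile_tendsto: "(\<lambda>k. reg_profile k n x) \<longlonglongrightarrow> profile n x"
  unfolding reg_profile_def profile_def by (intro tendsto_intros reg_max_tendsto) auto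

lemma reg_profile_deriv_tendsto: "(\<lambda>k. reg_profile_deriv k n x) \<longlonglongrightarrow> profile_deriv n x"
  unfolding reg_profile_deriv_def profile_deriv_def
  by (intro tendsto_mult tendsto_const tendsto_power tendsto_inverse reg_max_tendsto reg_max_deriv_tendsto) auto

lemma reg_profile_continuous: "continuous_on S (reg_profile k n)" "continuous_on S (reg_profile_deriv k n)"
proof -
  have m: "continuous_on UNIV (reg_max k)"
    unfolding reg_max_def by (intro continuous_intros) auto
  have d: "continuous_on UNIV (reg_max_deriv k)"
    unfolding reg_max_deriv_def
  proof (intro continuous_intros ballI)
    show "sqrt ((x - 1)\<^sup>2 + (1 / real (Suc k))\<^sup>2) \<noteq> 0" for x
      using reg_max_radicand_pos[of x k] by simp
  qed simp
  have nz: "\<forall>x\<in>UNIV. reg_max k x \<noteq> 0"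
  proof
    show "reg_max k x \<noteq> 0" for x using reg_max_ge_1[of k x] by simp
  qed
  have "continuous_on UNIV (reg_profile k n)"
    unfolding reg_profile_def by (intro continuous_intros m nz)
  then show "continuous_on S (reg_profile k n)" by (rule continuous_on_subset) simp
  have "continuous_on UNIV (reg_profile_deriv k n)"
    unfolding reg_profile_deriv_def by (intro continuous_intros m d nz)
  then show "continuous_on S (reg_profile_deriv k n)" by (rule continuous_on_subset) simp
qed

section \<open>Single modes and their gradients\<close>

lemma GDERIV_Re_monomial: "GDERIV (\<lambda>z. Re (q * z ^ n)) z :> cnj (of_nat n * q * z ^ (n - 1))"
proof -
  have "((\<lambda>z. q * z ^ n) has_field_derivative of_nat n * q * z ^ (n - 1)) (at z)"
    by (auto intro!: derivative_eq_intros)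
  then have "((\<lambda>z. q * z ^ n) has_derivative (\<lambda>h. of_nat n * q * z ^ (n - 1) * h)) (at z)"
    by (simp add: has_field_derivative_def)
  from bounded_linear.has_derivative[OF bounded_linear_Re this]
  have "((\<lambda>z. Re (q * z ^ n)) has_derivative (\<lambda>h. Re (of_nat n * q * z ^ (n - 1) * h))) (at z)" .
  moreover have "Re (w * h) = h \<bullet> cnj w" for w h by (simp add: inner_complex_def algebra_simps)
  ultimately show ?thesis unfolding gderiv_def by (simp only:)
qed

lemma GDERIV_norm_square: "GDERIV (\<lambda>z::complex. (cmod z)\<^sup>2 / \<rho>\<^sup>2) z :> (2 / \<rho>\<^sup>2) *\<^sub>R z"
proof -
  have "((\<lambda>z::complex. (z \<bullet> z) / \<rho>\<^sup>2) has_derivative (\<lambda>h. (z \<bullet> h + h \<bullet> z) / \<rho>\<^sup>2)) (at z)"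
    by (rule bounded_linear.has_derivative[OF bounded_linear_divide has_derivative_inner[OF has_derivative_ident has_derivative_ident]])
  moreover have "(\<lambda>h. (z \<bullet> h + h \<bullet> z) / \<rho>\<^sup>2) = (\<lambda>h. h \<bullet> ((2 / \<rho>\<^sup>2) *\<^sub>R z))"
    by (simp add: fun_eq_iff inner_commute)
  ultimately show ?thesis by (simp add: gderiv_def dot_square_norm)
qed

definition mode_fun :: "real \<Rightarrow> real \<Rightarrow> nat \<Rightarrow> complex \<Rightarrow> complex \<Rightarrow> real" where
  "mode_fun \<rho> \<mu> n q z = Re (q * z ^ n) * (1 + \<mu> * profile n ((cmod z)\<^sup>2 / \<rho>\<^sup>2))"

text \<open>The product rule for \<open>mode_fun\<close>, written with \<open>profile_deriv\<close>
  so that it is the limit of the smoothed gradients at every point, including the interface.\<close>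

definition mode_grad :: "real \<Rightarrow> real \<Rightarrow> nat \<Rightarrow> complex \<Rightarrow> complex \<Rightarrow> complex" where
  "mode_grad \<rho> \<mu> n q z = Re (q * z ^ n) *\<^sub>R (\<mu> *\<^sub>R profile_deriv n ((cmod z)\<^sup>2 / \<rho>\<^sup>2) *\<^sub>R (2 / \<rho>\<^sup>2) *\<^sub>R z) +
     (1 + \<mu> * profile n ((cmod z)\<^sup>2 / \<rho>\<^sup>2)) *\<^sub>R cnj (of_nat n * q * z ^ (n - 1))"

lemma norm_monomial_le: "cmod z \<le> 1 \<Longrightarrow> cmod (q * z ^ n) \<le> cmod q"
  by (simp add: norm_mult norm_power mult_left_le power_le_one)

lemma H1_trace_mode:
  assumes "0 < \<rho>"
  shows "H1_trace (mode_fun \<rho> \<mu> n q) (mode_grad \<rho> \<mu> n q) (mode_fun \<rho> \<mu> n q)"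
proof (rule H1_trace_pointwise_limit)
  let ?x = "\<lambda>z. (cmod z)\<^sup>2 / \<rho>\<^sup>2"
  let ?\<phi> = "\<lambda>k z. Re (q * z ^ n) * (1 + \<mu> * reg_profile k n (?x z))"
  let ?\<psi> = "\<lambda>k z. Re (q * z ^ n) *\<^sub>R (\<mu> *\<^sub>R reg_profile_deriv k n (?x z) *\<^sub>R (2 / \<rho>\<^sup>2) *\<^sub>R z) +
     (1 + \<mu> * reg_profile k n (?x z)) *\<^sub>R cnj (of_nat n * q * z ^ (n - 1))"
  \<comment> \<open>The first two summands bound the smoothed gradients, the third the smoothed
    functions; the sum is one constant for both, independent of k. It uses |z| <= 1 and the bound n
    on the derivative of the profile.\<close>
  define B where "B = cmod q * (\<bar>\<mu>\<bar> * (real n * (2 / \<rho>\<^sup>2))) + (1 + \<bar>\<mu>\<bar>) * (real n * cmod q) + cmod q * (1 + \<bar>\<mu>\<bar>)"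
  show "C1_fun (?\<phi> k) (?\<psi> k)" for k
    unfolding C1_fun_def
  proof (intro conjI allI)
    show "GDERIV (?\<phi> k) z :> ?\<psi> k z" for z
    proof (rule GDERIV_mult[OF GDERIV_Re_monomial, THEN GDERIV_subst])
      have "GDERIV (\<lambda>z. reg_profile k n (?x z)) z :> reg_profile_deriv k n (?x z) *\<^sub>R (2 / \<rho>\<^sup>2) *\<^sub>R z"
        by (rule GDERIV_DERIV_compose[OF GDERIV_norm_square DERIV_reg_profile])
      from GDERIV_add[OF GDERIV_const[of 1] GDERIV_mult[OF GDERIV_const[of \<mu>] this]]
      show "GDERIV (\<lambda>z. 1 + \<mu> * reg_profile k n (?x z)) z :> \<mu> *\<^sub>R reg_profile_deriv k n (?x z) *\<^sub>R (2 / \<rho>\<^sup>2) *\<^sub>R z"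
        by simp
    qed simp
    show "continuous_on UNIV (?\<psi> k)"
      by (intro continuous_intros continuous_on_compose2[OF reg_profile_continuous(1)[of UNIV]]
          continuous_on_compose2[OF reg_profile_continuous(2)[of UNIV]]) (use assms in auto)
  qed
  have one: "\<bar>1 + \<mu> * reg_profile k n x\<bar> \<le> 1 + \<bar>\<mu>\<bar>" for k x
  proof -
    have "\<bar>\<mu> * reg_profile k n x\<bar> \<le> \<bar>\<mu>\<bar> * 1"
      unfolding abs_mult using reg_profile_bounds(1,2)[of k n x] by (intro mult_left_mono) auto
    then show ?thesis by linarith
  qed
  have re: "\<bar>Re (q * z ^ n)\<bar> \<le> cmod q" if "cmod z \<le> 1" for z
    using abs_Re_le_cmod[of "q * z ^ n"] norm_monomial_le[OF that] by (rule order_trans)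
  have B0: "0 \<le> cmod q * (\<bar>\<mu>\<bar> * (real n * (2 / \<rho>\<^sup>2)))" "0 \<le> (1 + \<bar>\<mu>\<bar>) * (real n * cmod q)" "0 \<le> cmod q * (1 + \<bar>\<mu>\<bar>)"
    by auto
  show "\<bar>?\<phi> k z\<bar> \<le> B" if z: "cmod z \<le> 1" for k z
  proof -
    have "\<bar>?\<phi> k z\<bar> \<le> cmod q * (1 + \<bar>\<mu>\<bar>)"
      unfolding abs_mult by (intro mult_mono re z one) auto
    then show ?thesis using B0 unfolding B_def by linarith
  qed
  show "norm (?\<psi> k z) \<le> B" if z: "cmod z \<le> 1" for k z
  proof -
    have "norm (?\<psi> k z) \<le> cmod q * (\<bar>\<mu>\<bar> * (real n * (2 / \<rho>\<^sup>2))) + (1 + \<bar>\<mu>\<bar>) * (real n * cmod q)"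
    proof (rule norm_triangle_mono)
      have "norm (Re (q * z ^ n) *\<^sub>R (\<mu> *\<^sub>R reg_profile_deriv k n (?x z) *\<^sub>R (2 / \<rho>\<^sup>2) *\<^sub>R z)) =
          \<bar>Re (q * z ^ n)\<bar> * (\<bar>\<mu>\<bar> * (\<bar>reg_profile_deriv k n (?x z)\<bar> * (2 / \<rho>\<^sup>2 * cmod z)))"
      proof -
        have "\<bar>2 / \<rho>\<^sup>2\<bar> = 2 / \<rho>\<^sup>2" by simp
        then show ?thesis by (simp only: norm_scaleR)
      qed
      also have "\<dots> \<le> cmod q * (\<bar>\<mu>\<bar> * (real n * (2 / \<rho>\<^sup>2 * 1)))"
        by (intro mult_mono re z reg_profile_bounds order_refl mult_nonneg_nonneg) auto
      finally show "norm (Re (q * z ^ n) *\<^sub>R (\<mu> *\<^sub>R reg_profile_deriv k n (?x z) *\<^sub>R (2 / \<rho>\<^sup>2) *\<^sub>R z)) \<le> cmod q * (\<bar>\<mu>\<bar> * (real n * (2 / \<rho>\<^sup>2)))"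
        by (simp only: mult_1_right)
      have "norm ((1 + \<mu> * reg_profile k n (?x z)) *\<^sub>R cnj (of_nat n * q * z ^ (n - 1))) =
          \<bar>1 + \<mu> * reg_profile k n (?x z)\<bar> * (real n * cmod (q * z ^ (n - 1)))"
        by (simp only: norm_scaleR complex_mod_cnj norm_mult norm_of_nat mult.assoc)
      also have "\<dots> \<le> (1 + \<bar>\<mu>\<bar>) * (real n * cmod q)"
        by (intro mult_mono one norm_monomial_le z order_refl) auto
      finally show "norm ((1 + \<mu> * reg_profile k n (?x z)) *\<^sub>R cnj (of_nat n * q * z ^ (n - 1))) \<le> (1 + \<bar>\<mu>\<bar>) * (real n * cmod q)" .
    qed
    then show ?thesis using B0 unfolding B_def by linarith
  qed
  show "(\<lambda>k. ?\<phi> k z) \<longlonglongrightarrow> mode_fun \<rho> \<mu> n q z" for z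
    unfolding mode_fun_def by (intro tendsto_intros reg_profile_tendsto)
  show "(\<lambda>k. ?\<psi> k z) \<longlonglongrightarrow> mode_grad \<rho> \<mu> n q z" for z
    unfolding mode_grad_def by (intro tendsto_intros reg_profile_tendsto reg_profile_deriv_tendsto)
qed

text \<open>The gradient of a mode is the conjugate of a holomorphic function on either side of the interface.\<close>

definition mode_in :: "real \<Rightarrow> nat \<Rightarrow> complex \<Rightarrow> complex \<Rightarrow> complex" where
  "mode_in \<mu> n q z = of_real (1 + \<mu>) * (of_nat n * q * z ^ (n - 1))"

definition mode_out :: "real \<Rightarrow> real \<Rightarrow> nat \<Rightarrow> complex \<Rightarrow> complex \<Rightarrow> complex" where
  "mode_out \<rho> \<mu> n q z = of_nat n * q * z ^ (n - 1) - of_real (\<mu> * \<rho> ^ (2 * n)) * (of_nat n * cnj q * inverse z ^ (n + 1))"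

lemma mode_grad_inside:
  assumes "0 < \<rho>" "cmod z < \<rho>"
  shows "mode_grad \<rho> \<mu> n q z = cnj (mode_in \<mu> n q z)"
proof -
  have "(cmod z)\<^sup>2 < \<rho>\<^sup>2" using assms by (intro power_strict_mono) auto
  then have x: "(cmod z)\<^sup>2 / \<rho>\<^sup>2 < 1" using assms by simp
  then have "profile n ((cmod z)\<^sup>2 / \<rho>\<^sup>2) = 1" by (simp add: profile_def max_def)
  moreover have "profile_deriv n ((cmod z)\<^sup>2 / \<rho>\<^sup>2) = 0"
  proof -
    have "sgn ((cmod z)\<^sup>2 / \<rho>\<^sup>2 - 1) = - 1" by (rule sgn_neg) (use x in linarith)
    then show ?thesis by (simp only: profile_deriv_def) simp
  qed
  ultimately show ?thesis
    unfolding mode_grad_def mode_in_def by (simp only:) (simp add: scaleR_conv_of_real)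
qed

text \<open>Outside, the reflected term is Re (cnj q \<rho>^(2n) z^(-n)), whose complex derivative
  gives the second term of \<open>mode_out\<close>. In the computation twice the real part is split
  into a number and its conjugate, and the part of the radial derivative containing
  \<open>cnj q\<close> cancels against the profile.\<close>

lemma mode_grad_outside:
  assumes "0 < \<rho>" "\<rho> < cmod z"
  shows "mode_grad \<rho> \<mu> n q z = cnj (mode_out \<rho> \<mu> n q z)"
proof (cases n)
  case 0
  then show ?thesis by (simp add: mode_grad_def mode_out_def profile_deriv_def)
next
  case (Suc m)
  have z: "z \<noteq> 0" "cnj z \<noteq> 0" using assms by auto
  have "\<rho>\<^sup>2 < (cmod z)\<^sup>2" using assms by (intro power_strict_mono) auto
  then have x: "1 < (cmod z)\<^sup>2 / \<rho>\<^sup>2" using assms by simp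
  define s where "s = inverse ((cmod z)\<^sup>2 / \<rho>\<^sup>2) ^ n"
  have nz: "complex_of_real ((cmod z)\<^sup>2) = z * cnj z" by (rule complex_norm_square)
  have p: "profile n ((cmod z)\<^sup>2 / \<rho>\<^sup>2) = s" using x by (simp add: profile_def s_def max_def)
  have pd: "profile_deriv n ((cmod z)\<^sup>2 / \<rho>\<^sup>2) * (2 / \<rho>\<^sup>2) = - 2 * real n * s / (cmod z)\<^sup>2"
    using x assms z by (simp add: profile_deriv_def s_def max_def field_simps)
  have s: "complex_of_real s * (z * cnj z) ^ n = of_real (\<rho> ^ (2 * n))"
  proof -
    have "s * ((cmod z)\<^sup>2) ^ n = (\<rho>\<^sup>2) ^ n"
    proof -
      have "inverse ((cmod z)\<^sup>2 / \<rho>\<^sup>2) * (cmod z)\<^sup>2 = \<rho>\<^sup>2" using z by simp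
      then show ?thesis by (simp only: s_def power_mult_distrib[symmetric])
    qed
    then have "complex_of_real (s * ((cmod z)\<^sup>2) ^ n) = complex_of_real (\<rho> ^ (2 * n))" by (simp add: power_mult)
    then show ?thesis by (simp only: of_real_mult of_real_power nz[symmetric])
  qed
  have "mode_grad \<rho> \<mu> n q z = of_real (Re (q * z ^ n)) * (of_real \<mu> * (of_real (profile_deriv n ((cmod z)\<^sup>2 / \<rho>\<^sup>2) * (2 / \<rho>\<^sup>2)) * z)) +
      (1 + of_real \<mu> * of_real s) * cnj (of_nat n * q * z ^ (n - 1))"
    unfolding mode_grad_def p by (simp add: scaleR_conv_of_real)
  also have "\<dots> = - (of_real (2 * Re (q * z ^ n))) * (of_real \<mu> * (of_nat n * of_real s / of_real ((cmod z)\<^sup>2) * z)) +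
      (1 + of_real \<mu> * of_real s) * cnj (of_nat n * q * z ^ (n - 1))"
  proof -
    have "of_real R * (of_real \<mu> * (of_real (- 2 * real n * s / N) * z)) = - (of_real (2 * R)) * (of_real \<mu> * (of_nat n * of_real s / of_real N * z))" for R N :: real
      by (cases "N = 0") (simp_all add: field_simps)
    then show ?thesis unfolding pd by (simp only:)
  qed
  also have "complex_of_real (2 * Re (q * z ^ n)) = q * z ^ n + cnj q * cnj z ^ n"
    using complex_add_cnj[of "q * z ^ n"] by simp
  also have "- (q * z ^ n + cnj q * cnj z ^ n) * (of_real \<mu> * (of_nat n * of_real s / of_real ((cmod z)\<^sup>2) * z)) +
      (1 + of_real \<mu> * of_real s) * cnj (of_nat n * q * z ^ (n - 1))
      = of_nat n * cnj q * cnj z ^ m - of_real \<mu> * of_nat n * (of_real s * q * z ^ n / cnj z)"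
    unfolding nz using z by (simp add: Suc field_simps)
  also have "of_real s * q * z ^ n / cnj z = of_real (\<rho> ^ (2 * n)) * q * inverse (cnj z) ^ (n + 1)"
    unfolding s[symmetric] using z by (simp add: power_mult_distrib field_simps)
  finally show ?thesis by (simp add: mode_out_def Suc mult_ac)
qed

lemma mode_fun_circle:
  assumes "0 < \<rho>" "\<rho> < 1"
  shows "mode_fun \<rho> \<mu> n q (cis t) = (1 + \<mu> * \<rho> ^ (2 * n)) * Re (q * cis t ^ n)"
proof -
  have "1 < 1 / \<rho>\<^sup>2" using assms by (simp add: power_less_one_iff abs_square_less_1)
  then have "inverse (max 1 (1 / \<rho>\<^sup>2)) ^ n = \<rho> ^ (2 * n)" by (simp add: max_def power_mult)
  then show ?thesis
    by (simp only: mode_fun_def profile_def norm_cis power_one mult.commute)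
qed

text \<open>Relation of the normal derivatives on the interface. For one number w the inner
  expression is (1 + \<mu>) w and the outer one w - \<mu> cnj w, with real parts (1 + \<mu>) Re w
  and (1 - \<mu>) Re w; the statement is the cross-multiplied form.\<close>

lemma mode_in_out_circle:
  assumes "0 < \<rho>" 
  shows "Re (mode_out \<rho> \<mu> n q (of_real \<rho> * cis t) * cis t) * (1 + \<mu>) = Re (mode_in \<mu> n q (of_real \<rho> * cis t) * cis t) * (1 - \<mu>)"
proof (cases n)
  case 0
  then show ?thesis by (simp add: mode_in_def mode_out_def)
next
  case (Suc m)
  let ?w = "of_real (real n * \<rho> ^ m) * (q * cis t ^ n)"
  have 1: "mode_in \<mu> n q (of_real \<rho> * cis t) * cis t = of_real (1 + \<mu>) * ?w"
    by (simp add: mode_in_def Suc power_mult_distrib algebra_simps)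
  have inv: "inverse (of_real \<rho> * cis t) = of_real (inverse \<rho>) * cnj (cis t)" by (simp add: cis_cnj)
  have cc: "cnj (cis t) * cis t = 1" using cis_mult[of "- t" t] by (simp add: cis_cnj)
  have "inverse (of_real \<rho> * cis t) ^ (n + 1) * cis t = of_real (inverse \<rho> ^ (n + 1)) * (cnj (cis t) ^ n * (cnj (cis t) * cis t))"
    unfolding inv by (simp only: power_mult_distrib of_real_power of_real_mult power_add power_one_right mult_ac)
  then have i: "inverse (of_real \<rho> * cis t) ^ (n + 1) * cis t = of_real (inverse \<rho> ^ (n + 1)) * cnj (cis t) ^ n"
    unfolding cc by simp
  have rr: "\<rho> ^ (2 * n) * inverse \<rho> ^ (n + 1) = \<rho> ^ m"
  proof -
    have "\<rho> ^ (2 * n) = \<rho> ^ m * \<rho> ^ (n + 1)" by (simp add: Suc power_add[symmetric] mult_2)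
    moreover have "\<rho> ^ (n + 1) * inverse \<rho> ^ (n + 1) = 1"
      using assms by (simp only: power_mult_distrib[symmetric]) simp
    ultimately show ?thesis by (simp only: mult.assoc mult_1_right)
  qed
  have "mode_out \<rho> \<mu> n q (of_real \<rho> * cis t) * cis t = ?w - of_real \<mu> * (of_real (real n) * cnj q * (of_real (\<rho> ^ (2 * n)) * (inverse (of_real \<rho> * cis t) ^ (n + 1) * cis t)))"
    by (simp add: mode_out_def Suc power_mult_distrib algebra_simps)
  also have "\<dots> = ?w - of_real \<mu> * (of_real (real n) * cnj q * (of_real (\<rho> ^ (2 * n) * inverse \<rho> ^ (n + 1)) * cnj (cis t) ^ n))"
    unfolding i by simp
  also have "\<dots> = ?w - of_real \<mu> * cnj ?w"
    unfolding rr by simp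
  finally have 2: "mode_out \<rho> \<mu> n q (of_real \<rho> * cis t) * cis t = ?w - of_real \<mu> * cnj ?w" .
  have re: "Re (of_real (1 + \<mu>) * x) = (1 + \<mu>) * Re x" "Re (x - of_real \<mu> * cnj x) = (1 - \<mu>) * Re x" for x
    by (simp_all add: algebra_simps)
  show ?thesis unfolding 1 2 re by (simp only: mult.assoc mult.commute mult.left_commute)
qed

lemma bounded_coefficient_conductivity:
  assumes "0 < \<sigma>1" "0 < \<sigma>2" "D \<in> sets lebesgue"
  shows "bounded_coefficient (conductivity \<sigma>1 \<sigma>2 D) (min \<sigma>1 \<sigma>2) (max \<sigma>1 \<sigma>2)"
proof
  have "(indicator D :: complex \<Rightarrow> real) \<in> borel_measurable lebesgue" using assms(3) by simp
  then have [measurable]: "(indicator D :: complex \<Rightarrow> real) \<in> borel_measurable disk_measure"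
    by (rule measurable_restrict_space1)
  show "conductivity \<sigma>1 \<sigma>2 D \<in> borel_measurable disk_measure"
    unfolding conductivity_def[abs_def] by measurable
  show "min \<sigma>1 \<sigma>2 \<le> conductivity \<sigma>1 \<sigma>2 D z" "conductivity \<sigma>1 \<sigma>2 D z \<le> max \<sigma>1 \<sigma>2" for z
    by (cases "z \<in> D"; simp add: conductivity_def)+
qed (use assms in simp)

section \<open>The weak equation for modes\<close>

lemma DERIV_mode_in:
  "(mode_in \<mu> n q has_field_derivative of_real (1 + \<mu>) * (of_nat n * q * (of_nat (n - 1) * z ^ (n - 1 - 1)))) (at z)"
  unfolding mode_in_def[abs_def] by (auto intro!: derivative_eq_intros)

lemma DERIV_mode_out:
  assumes "z \<noteq> 0"
  shows "(mode_out \<rho> \<mu> n q has_field_derivative of_nat n * q * (of_nat (n - 1) * z ^ (n - 1 - 1)) -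
     of_real (\<mu> * \<rho> ^ (2 * n)) * (of_nat n * cnj q * (of_nat (n + 1) * inverse z ^ n * (- (inverse z * inverse z))))) (at z)"
proof -
  have i: "(inverse has_field_derivative - (inverse z * inverse z)) (at z)"
    using DERIV_inverse[OF assms] by (simp add: power2_eq_square power_Suc)
  have "((\<lambda>z. inverse z ^ (n + 1)) has_field_derivative of_nat (n + 1) * inverse z ^ n * (- (inverse z * inverse z))) (at z)"
    by (rule DERIV_cong[OF DERIV_power[OF i, of "n + 1"]]) (simp add: mult_ac)
  from DERIV_cmult[OF DERIV_cmult[OF this, of "of_nat n * cnj q"], of "of_real (\<mu> * \<rho> ^ (2 * n))"]
  have 2: "((\<lambda>z. of_real (\<mu> * \<rho> ^ (2 * n)) * (of_nat n * cnj q * inverse z ^ (n + 1))) has_field_derivative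
      of_real (\<mu> * \<rho> ^ (2 * n)) * (of_nat n * cnj q * (of_nat (n + 1) * inverse z ^ n * (- (inverse z * inverse z))))) (at z)" .
  have 1: "((\<lambda>z. of_nat n * q * z ^ (n - 1)) has_field_derivative of_nat n * q * (of_nat (n - 1) * z ^ (n - 1 - 1))) (at z)"
    by (auto intro!: derivative_eq_intros)
  show ?thesis unfolding mode_out_def[abs_def] by (rule DERIV_diff[OF 1 2])
qed

lemma mode_in_continuous: "continuous_on S (mode_in \<mu> n q)"
  unfolding mode_in_def[abs_def] by (intro continuous_intros)

lemma mode_out_continuous: "0 \<notin> S \<Longrightarrow> continuous_on S (mode_out \<rho> \<mu> n q)"
  unfolding mode_out_def[abs_def] by (intro continuous_intros) auto

lemma annulus_nonzero: "0 < a \<Longrightarrow> 0 \<notin> annulus a b"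
  by (simp add: annulus_def)

text \<open>Green's formula on both sides of the interface. This \<mu> makes 1 + \<mu> and 1 - \<mu>
  proportional to \<sigma>1 and \<sigma>2, so the two fluxes weighted with the conductivities agree
  and the interface terms cancel; only the flux through the unit circle remains.\<close>

lemma energy_mode_C1_fun:
  assumes "0 < \<rho>" "\<rho> < 1" "0 < \<sigma>1" "0 < \<sigma>2" and \<mu>: "\<mu> = (\<sigma>1 - \<sigma>2) / (\<sigma>1 + \<sigma>2)" and C: "C1_fun \<phi> \<psi>"
  shows "energy (conductivity \<sigma>1 \<sigma>2 (ball 0 \<rho>)) (mode_grad \<rho> \<mu> n q) \<psi> =
    \<sigma>1 * integral {0..2*pi} (\<lambda>t. \<phi> (cis t) * Re (mode_out \<rho> \<mu> n q (cis t) * cis t))"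
proof -
  let ?\<gamma> = "conductivity \<sigma>1 \<sigma>2 (ball 0 \<rho>)"
  let ?in = "mode_in \<mu> n q" and ?out = "mode_out \<rho> \<mu> n q"
  interpret bounded_coefficient ?\<gamma> "min \<sigma>1 \<sigma>2" "max \<sigma>1 \<sigma>2"
    by (rule bounded_coefficient_conductivity) (use assms in auto)
  note sG = H1_trace_square_integrable(2)[OF H1_trace_mode[OF \<open>0 < \<rho>\<close>, of \<mu> n q]]
  note ct = C1_fun_continuous[OF C]
  have meas: "(\<lambda>z. ?\<gamma> z * (mode_grad \<rho> \<mu> n q z \<bullet> \<psi> z)) \<in> borel_measurable disk_measure"
    using energy_integrable[OF sG C1_fun_square_integrable(2)[OF C]] by (rule borel_measurable_integrable)
  have cF1: "continuous_on (annulus 0 \<rho>) (\<lambda>z. \<sigma>2 * (cnj (?in z) \<bullet> \<psi> z))"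
    by (intro continuous_intros mode_in_continuous ct)
  have cF2: "continuous_on (annulus \<rho> 1) (\<lambda>z. \<sigma>1 * (cnj (?out z) \<bullet> \<psi> z))"
    by (intro continuous_intros mode_out_continuous annulus_nonzero ct \<open>0 < \<rho>\<close>)
  have "energy ?\<gamma> (mode_grad \<rho> \<mu> n q) \<psi> = (LINT z|disk_measure. indicator (annulus 0 1) z *\<^sub>R (?\<gamma> z * (mode_grad \<rho> \<mu> n q z \<bullet> \<psi> z)))"
    unfolding energy_def by (rule Bochner_Integration.integral_cong) (auto simp: annulus_def)
  also have "\<dots> = (LINT z|lebesgue_on (annulus 0 \<rho>). \<sigma>2 * (cnj (?in z) \<bullet> \<psi> z)) + (LINT z|lebesgue_on (annulus \<rho> 1). \<sigma>1 * (cnj (?out z) \<bullet> \<psi> z))"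
  proof (rule integral_disk_split[OF meas _ _ _ _ cF1 _ cF2])
    show "?\<gamma> z * (mode_grad \<rho> \<mu> n q z \<bullet> \<psi> z) = \<sigma>2 * (cnj (?in z) \<bullet> \<psi> z)" if "cmod z < \<rho>" for z
      using mode_grad_inside[OF \<open>0 < \<rho>\<close> that] that by (simp add: conductivity_def)
    show "?\<gamma> z * (mode_grad \<rho> \<mu> n q z \<bullet> \<psi> z) = \<sigma>1 * (cnj (?out z) \<bullet> \<psi> z)" if "\<rho> < cmod z" for z
      using mode_grad_outside[OF \<open>0 < \<rho>\<close> that] that by (simp add: conductivity_def)
  qed (use assms in auto)
  also have "(LINT z|lebesgue_on (annulus 0 \<rho>). \<sigma>2 * (cnj (?in z) \<bullet> \<psi> z)) =
      \<sigma>2 * integral {0..2*pi} (\<lambda>t. \<rho> * (\<phi> (of_real \<rho> * cis t) * Re (?in (of_real \<rho> * cis t) * cis t)))"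
  proof -
    have "(LINT z|lebesgue_on (annulus 0 \<rho>). cnj (?in z) \<bullet> \<psi> z) =
      integral {0..2*pi} (\<lambda>t. \<rho> * (\<phi> (of_real \<rho> * cis t) * Re (?in (of_real \<rho> * cis t) * cis t))) -
      integral {0..2*pi} (\<lambda>t. 0 * (\<phi> (of_real 0 * cis t) * Re (?in (of_real 0 * cis t) * cis t)))"
      by (rule Green_annulus[OF _ _ C DERIV_mode_in]) (use assms in \<open>auto intro!: continuous_intros\<close>)
    then show ?thesis by simp
  qed
  also have "(LINT z|lebesgue_on (annulus \<rho> 1). \<sigma>1 * (cnj (?out z) \<bullet> \<psi> z)) =
      \<sigma>1 * (integral {0..2*pi} (\<lambda>t. \<phi> (cis t) * Re (?out (cis t) * cis t)) -
        integral {0..2*pi} (\<lambda>t. \<rho> * (\<phi> (of_real \<rho> * cis t) * Re (?out (of_real \<rho> * cis t) * cis t))))"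
  proof -
    have "(LINT z|lebesgue_on (annulus \<rho> 1). cnj (?out z) \<bullet> \<psi> z) =
      integral {0..2*pi} (\<lambda>t. 1 * (\<phi> (of_real 1 * cis t) * Re (?out (of_real 1 * cis t) * cis t))) -
      integral {0..2*pi} (\<lambda>t. \<rho> * (\<phi> (of_real \<rho> * cis t) * Re (?out (of_real \<rho> * cis t) * cis t)))"
    proof (rule Green_annulus[OF _ _ C DERIV_mode_out])
      have nz: "\<forall>z\<in>annulus \<rho> 1. z \<noteq> 0" using annulus_nonzero[OF \<open>0 < \<rho>\<close>, of 1] by auto
      show "continuous_on (annulus \<rho> 1) (\<lambda>z. of_nat n * q * (of_nat (n - 1) * z ^ (n - 1 - 1)) -
         of_real (\<mu> * \<rho> ^ (2 * n)) * (of_nat n * cnj q * (of_nat (n + 1) * inverse z ^ n * (- (inverse z * inverse z)))))"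
        by (intro continuous_intros nz)
      show "z \<noteq> 0" if "z \<in> annulus \<rho> 1" for z using that nz by blast
    qed (use assms in auto)
    then show ?thesis by simp
  qed
  also have "integral {0..2*pi} (\<lambda>t. \<rho> * (\<phi> (of_real \<rho> * cis t) * Re (?in (of_real \<rho> * cis t) * cis t))) =
      \<sigma>1 / \<sigma>2 * integral {0..2*pi} (\<lambda>t. \<rho> * (\<phi> (of_real \<rho> * cis t) * Re (?out (of_real \<rho> * cis t) * cis t)))"
  proof -
    have "Re (?in (of_real \<rho> * cis t) * cis t) = \<sigma>1 / \<sigma>2 * Re (?out (of_real \<rho> * cis t) * cis t)" for t
    proof -
      have s: "1 + \<mu> = 2 * \<sigma>1 / (\<sigma>1 + \<sigma>2)" "1 - \<mu> = 2 * \<sigma>2 / (\<sigma>1 + \<sigma>2)"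
        using assms by (simp_all add: \<mu> field_simps)
      define x y where "x = Re (?out (of_real \<rho> * cis t) * cis t)" and "y = Re (?in (of_real \<rho> * cis t) * cis t)"
      have "x * (2 * \<sigma>1 / (\<sigma>1 + \<sigma>2)) = y * (2 * \<sigma>2 / (\<sigma>1 + \<sigma>2))"
        unfolding x_def y_def using mode_in_out_circle[OF \<open>0 < \<rho>\<close>, of \<mu> n q t] unfolding s .
      then have "x * \<sigma>1 = y * \<sigma>2" using assms by (simp add: field_simps)
      then have "y = \<sigma>1 / \<sigma>2 * x" using assms by (simp add: field_simps)
      then show ?thesis by (simp only: x_def y_def)
    qed
    then have "(\<lambda>t. \<rho> * (\<phi> (of_real \<rho> * cis t) * Re (?in (of_real \<rho> * cis t) * cis t))) =
       (\<lambda>t. \<sigma>1 / \<sigma>2 * (\<rho> * (\<phi> (of_real \<rho> * cis t) * Re (?out (of_real \<rho> * cis t) * cis t))))"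
      by (simp only: mult.left_commute)
    then show ?thesis by (simp only: integral_mult_right)
  qed
  finally show ?thesis using assms by (simp add: right_diff_distrib)
qed

text \<open>A function of zero trace is approximated by C^1 functions that are merely small on the
  circle. Their boundary flux is small with them, so the energy is at most \<open>M * e\<close> for
  every positive e.\<close>

lemma mode_dirichlet_solution:
  assumes "0 < \<rho>" "\<rho> < 1" "0 < \<sigma>1" "0 < \<sigma>2" and \<mu>: "\<mu> = (\<sigma>1 - \<sigma>2) / (\<sigma>1 + \<sigma>2)"
  shows "dirichlet_solution (conductivity \<sigma>1 \<sigma>2 (ball 0 \<rho>)) (mode_fun \<rho> \<mu> n q) (mode_fun \<rho> \<mu> n q) (mode_grad \<rho> \<mu> n q)"
  unfolding dirichlet_solution_def
proof (intro conjI allI impI)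
  show H: "H1_trace (mode_fun \<rho> \<mu> n q) (mode_grad \<rho> \<mu> n q) (mode_fun \<rho> \<mu> n q)"
    by (rule H1_trace_mode) fact
  let ?\<gamma> = "conductivity \<sigma>1 \<sigma>2 (ball 0 \<rho>)" and ?G = "mode_grad \<rho> \<mu> n q"
  fix v F assume v: "H1_trace v F (\<lambda>z. 0)"
  interpret bounded_coefficient ?\<gamma> "min \<sigma>1 \<sigma>2" "max \<sigma>1 \<sigma>2"
    by (rule bounded_coefficient_conductivity) (use assms in auto)
  define \<beta> where "\<beta> t = Re (mode_out \<rho> \<mu> n q (cis t) * cis t)" for t
  have c\<beta>: "continuous_on {0..2*pi} \<beta>"
  proof -
    have "continuous_on {0..2*pi} (\<lambda>t. mode_out \<rho> \<mu> n q (cis t))"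
      by (rule continuous_on_compose2[OF mode_out_continuous[of "- {0}"]]) (auto intro: continuous_intros)
    then show ?thesis unfolding \<beta>_def by (intro continuous_intros)
  qed
  note sG = H1_trace_square_integrable(2)[OF H] and sF = H1_trace_square_integrable(2)[OF v]
  note s\<beta> = continuous_square_integrable_circle[OF c\<beta>]
  define M where "M = \<sigma>1 * l2norm circle_measure \<beta> + max \<sigma>1 \<sigma>2 * l2norm disk_measure ?G"
  have M0: "0 \<le> M" using assms unfolding M_def by (intro add_nonneg_nonneg mult_nonneg_nonneg) auto
  have le: "\<bar>energy ?\<gamma> ?G F\<bar> \<le> M * e" if e: "e > 0" for e
  proof -
    obtain \<phi> \<psi> where C: "C1_fun \<phi> \<psi>" and 1: "l2norm disk_measure (\<lambda>z. \<psi> z - F z) < e" "l2norm circle_measure (\<lambda>t. \<phi> (cis t) - 0) < e"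
      using C1_fun_close[OF v e] by metis
    note sC = C1_fun_square_integrable[OF C]
    have "energy ?\<gamma> ?G \<psi> = \<sigma>1 * (LINT t|circle_measure. \<phi> (cis t) * \<beta> t)"
    proof -
      have "continuous_on {0..2*pi} (\<lambda>t. \<phi> (cis t) * \<beta> t)"
        by (intro continuous_intros c\<beta> cis_continuous_circle C1_fun_continuous[OF C])
      from integral_circle_eq[OF this] show ?thesis
        using energy_mode_C1_fun[OF assms C, of n q] unfolding \<beta>_def by (simp only:)
    qed
    also have "\<bar>\<dots>\<bar> \<le> \<sigma>1 * (l2norm circle_measure (\<lambda>t. \<phi> (cis t)) * l2norm circle_measure \<beta>)"
      unfolding abs_mult using abs_integral_inner_le[OF sC(3) s\<beta>] assms by (auto intro!: mult_mono)
    also have "\<dots> \<le> \<sigma>1 * (e * l2norm circle_measure \<beta>)"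
      using 1(2) assms by (intro mult_left_mono mult_right_mono) auto
    finally have a: "\<bar>energy ?\<gamma> ?G \<psi>\<bar> \<le> \<sigma>1 * l2norm circle_measure \<beta> * e" by (simp add: mult_ac)
    have "\<bar>energy ?\<gamma> ?G (\<lambda>z. \<psi> z - F z)\<bar> \<le> max \<sigma>1 \<sigma>2 * l2norm disk_measure ?G * l2norm disk_measure (\<lambda>z. \<psi> z - F z)"
      by (rule abs_energy_le[OF sG square_integrable_diff[OF sC(2) sF]])
    also have "\<dots> \<le> max \<sigma>1 \<sigma>2 * l2norm disk_measure ?G * e"
      using 1(1) K_pos by (intro mult_left_mono) auto
    finally have b: "\<bar>energy ?\<gamma> ?G \<psi> - energy ?\<gamma> ?G F\<bar> \<le> max \<sigma>1 \<sigma>2 * l2norm disk_measure ?G * e"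
      unfolding energy_diff_right[OF sG sC(2) sF] .
    show ?thesis using a b unfolding M_def distrib_right by linarith
  qed
  show "energy ?\<gamma> ?G F = 0"
  proof (rule ccontr)
    assume nz: "energy ?\<gamma> ?G F \<noteq> 0"
    define x where "x = \<bar>energy ?\<gamma> ?G F\<bar>"
    have x: "x > 0" using nz by (simp add: x_def)
    \<comment> \<open>This e is proportional to x with a factor that keeps M e below x, whether or
      not M is zero.\<close>
    have "x \<le> M * (x / (2 * (M + 1)))" unfolding x_def by (rule le) (use nz M0 in auto)
    also have "\<dots> = x * (M / (2 * (M + 1)))" by simp
    also have "\<dots> < x * 1"
      using M0 by (intro mult_strict_left_mono x) (simp add: pos_divide_less_eq)
    finally show False by simp
  qed
qed

text \<open>Boundary data enter only through the points \<open>cis t\<close>, so a sum of modes and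
  a harmonic polynomial that agree on the circle can be exchanged as data.\<close>

lemma H1_trace_cong_circle:
  assumes "\<And>t. g (cis t) = g' (cis t)"
  shows "H1_trace u G g \<longleftrightarrow> H1_trace u G g'"
  unfolding H1_trace_iff C1_close_def by (simp only: assms)

lemma (in bounded_coefficient) dirichlet_solution_sum:
  assumes "finite I" "\<And>i. i \<in> I \<Longrightarrow> dirichlet_solution \<gamma> (f i) (u i) (G i)"
  shows "dirichlet_solution \<gamma> (\<lambda>z. \<Sum>i\<in>I. f i z) (\<lambda>z. \<Sum>i\<in>I. u i z) (\<lambda>z. \<Sum>i\<in>I. G i z)"
  unfolding dirichlet_solution_def
proof (intro conjI allI impI)
  show "H1_trace (\<lambda>z. \<Sum>i\<in>I. u i z) (\<lambda>z. \<Sum>i\<in>I. G i z) (\<lambda>z. \<Sum>i\<in>I. f i z)"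
    by (rule H1_trace_sum) (use assms in \<open>simp add: dirichlet_solution_def\<close>)
  fix v H assume v: "H1_trace v H (\<lambda>z. 0)"
  note sH = H1_trace_square_integrable(2)[OF v]
  from assms show "energy \<gamma> (\<lambda>z. \<Sum>i\<in>I. G i z) H = 0"
  proof (induction I rule: finite_induct)
    case empty
    then show ?case by (simp add: energy_def)
  next
    case (insert i I)
    have sq: "square_integrable disk_measure (G j)" if "j \<in> insert i I" for j
      by (rule dirichlet_solution_square_integrable[OF insert.prems[OF that]])
    have "energy \<gamma> (\<lambda>z. G i z + (\<Sum>i\<in>I. G i z)) H = energy \<gamma> (G i) H + energy \<gamma> (\<lambda>z. \<Sum>i\<in>I. G i z) H"
      by (intro energy_add_left sq sH square_integrable_sum) auto
    moreover have "energy \<gamma> (G i) H = 0"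
      using insert.prems[of i] v by (simp add: dirichlet_solution_def)
    moreover have "energy \<gamma> (\<lambda>z. \<Sum>i\<in>I. G i z) H = 0"
      by (rule insert.IH) (use insert.prems in simp)
    ultimately show ?case using insert.hyps by simp
  qed
qed

section \<open>Finite sums of modes and their energy on annuli\<close>

definition modes_grad :: "real \<Rightarrow> real \<Rightarrow> (nat \<Rightarrow> complex) \<Rightarrow> nat \<Rightarrow> complex \<Rightarrow> complex" where
  "modes_grad \<rho> \<mu> q N z = (\<Sum>n\<le>N. mode_grad \<rho> \<mu> n (q n) z)"

text \<open>On the unit circle the mode of degree n with amplitude q equals 1 + \<mu> \<rho>^(2n)
  times Re (q z^n). Dividing the coefficients by this factor produces the prescribed data.\<close>

lemma harmonic_poly_dirichlet_solution:
  assumes "0 < \<rho>" "\<rho> < 1" "0 < \<sigma>1" "0 < \<sigma>2" and \<mu>: "\<mu> = (\<sigma>1 - \<sigma>2) / (\<sigma>1 + \<sigma>2)"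
    and q: "\<And>n. q n = c n / of_real (1 + \<mu> * \<rho> ^ (2 * n))" and nz: "\<And>n. 1 + \<mu> * \<rho> ^ (2 * n) \<noteq> 0"
  obtains u where "dirichlet_solution (conductivity \<sigma>1 \<sigma>2 (ball 0 \<rho>)) (harmonic_poly c N) u (modes_grad \<rho> \<mu> q N)"
proof
  interpret bounded_coefficient "conductivity \<sigma>1 \<sigma>2 (ball 0 \<rho>)" "min \<sigma>1 \<sigma>2" "max \<sigma>1 \<sigma>2"
    by (rule bounded_coefficient_conductivity) (use assms in auto)
  let ?u = "\<lambda>z. \<Sum>n\<le>N. mode_fun \<rho> \<mu> n (q n) z"
  have s: "dirichlet_solution (conductivity \<sigma>1 \<sigma>2 (ball 0 \<rho>)) ?u ?u (modes_grad \<rho> \<mu> q N)"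
    unfolding modes_grad_def[abs_def] by (rule dirichlet_solution_sum) (auto intro!: mode_dirichlet_solution assms(1-5))
  have "mode_fun \<rho> \<mu> n (q n) (cis t) = Re (c n * cis t ^ n)" for n t
  proof -
    have "mode_fun \<rho> \<mu> n (q n) (cis t) = Re (of_real (1 + \<mu> * \<rho> ^ (2 * n)) * (q n * cis t ^ n))"
    proof -
      have "x * Re w = Re (of_real x * w)" for x w by simp
      then show ?thesis unfolding mode_fun_circle[OF assms(1,2)] .
    qed
    also have "of_real (1 + \<mu> * \<rho> ^ (2 * n)) * (q n * cis t ^ n) = c n * cis t ^ n"
    proof -
      have "x * (d / x * w) = d * w" if "x \<noteq> 0" for x d w :: complex using that by simp
      moreover have "complex_of_real (1 + \<mu> * \<rho> ^ (2 * n)) \<noteq> 0"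
        unfolding of_real_eq_0_iff by (rule nz)
      ultimately show ?thesis unfolding q by (simp only: not_False_eq_True)
    qed
    finally show ?thesis .
  qed
  then have "?u (cis t) = harmonic_poly c N (cis t)" for t
    by (simp only: harmonic_poly_def)
  from H1_trace_cong_circle[of ?u "harmonic_poly c N", OF this] s
  show "dirichlet_solution (conductivity \<sigma>1 \<sigma>2 (ball 0 \<rho>)) (harmonic_poly c N) ?u (modes_grad \<rho> \<mu> q N)"
    unfolding dirichlet_solution_def by simp
qed

text \<open>Parseval with the frequencies n - 1; the factor 8 pi is 2 pi times the bound 4 for (1 +
  \<mu>)^2.\<close>

lemma mode_in_circle_integral:
  assumes r: "0 < r" and \<mu>: "\<bar>\<mu>\<bar> \<le> 1"
  shows "(LINT t|circle_measure. (cmod (\<Sum>n\<le>N. mode_in \<mu> n (q n) (of_real r * cis t)))\<^sup>2) \<le>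
    8 * pi * (\<Sum>n\<le>N. (real n * cmod (q n) * r ^ (n - 1))\<^sup>2)"
proof -
  \<comment> \<open>At n = 0 the exponent \<open>n - 1\<close> is truncated while the frequency is
    -1; the coefficient is zero there, so the mismatch is harmless.\<close>
  define a where "a n = of_real (1 + \<mu>) * (of_nat n * q n * of_real (r ^ (n - 1)))" for n
  have "mode_in \<mu> n (q n) (of_real r * cis t) = a n * cis (of_int (int n - 1) * t)" for n t
  proof (cases n)
    case (Suc m)
    then show ?thesis by (simp add: mode_in_def a_def power_mult_distrib Complex.DeMoivre)
  qed (simp add: mode_in_def a_def)
  then have "(LINT t|circle_measure. (cmod (\<Sum>n\<le>N. mode_in \<mu> n (q n) (of_real r * cis t)))\<^sup>2) = 2 * pi * (\<Sum>n\<le>N. (cmod (a n))\<^sup>2)"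
    by (simp only:) (rule Parseval_finite; simp add: inj_on_def)
  also have "\<dots> \<le> 2 * pi * (\<Sum>n\<le>N. 4 * (real n * cmod (q n) * r ^ (n - 1))\<^sup>2)"
  proof (intro mult_left_mono sum_mono)
    fix n
    have "(1 + \<mu>)\<^sup>2 \<le> 2\<^sup>2" using \<mu> by (intro power_mono) auto
    then have "(1 + \<mu>)\<^sup>2 * (real n * cmod (q n) * r ^ (n - 1))\<^sup>2 \<le> 4 * (real n * cmod (q n) * r ^ (n - 1))\<^sup>2"
      by (intro mult_right_mono) auto
    moreover have "cmod (a n) = \<bar>1 + \<mu>\<bar> * (real n * cmod (q n) * r ^ (n - 1))"
      unfolding a_def using r by (simp only: norm_mult norm_of_real norm_of_nat power_abs)
    ultimately show "(cmod (a n))\<^sup>2 \<le> 4 * (real n * cmod (q n) * r ^ (n - 1))\<^sup>2"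
      by (simp only: power_mult_distrib power2_abs)
  qed simp
  also have "\<dots> = 8 * pi * (\<Sum>n\<le>N. (real n * cmod (q n) * r ^ (n - 1))\<^sup>2)"
    by (simp add: sum_distrib_left[symmetric])
  finally show ?thesis .
qed

text \<open>Direct and reflected parts are separated by |w - w'|^2 <= 2 |w|^2 + 2 |w'|^2, and
  Parseval is applied to each. As \<rho> is at most r, the reflected amplitude satisfies \<rho>^(2n)
  r^(-n-1) <= r^(n-1). The total constant is again 8 pi, so one density serves on both sides of the
  interface.\<close>

lemma mode_out_circle_integral:
  assumes \<rho>: "0 < \<rho>" "\<rho> \<le> r" and \<mu>: "\<bar>\<mu>\<bar> \<le> 1"
  shows "(LINT t|circle_measure. (cmod (\<Sum>n\<le>N. mode_out \<rho> \<mu> n (q n) (of_real r * cis t)))\<^sup>2) \<le>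
    8 * pi * (\<Sum>n\<le>N. (real n * cmod (q n) * r ^ (n - 1))\<^sup>2)"
proof -
  define x where "x n = real n * cmod (q n) * r ^ (n - 1)" for n
  define a where "a n = of_nat n * q n * of_real (r ^ (n - 1))" for n
  define b where "b n = of_real (\<mu> * \<rho> ^ (2 * n)) * (of_nat n * cnj (q n) * of_real (inverse r ^ (n + 1)))" for n
  let ?A = "\<lambda>t. \<Sum>n\<le>N. a n * cis (of_int (int n - 1) * t)" and ?B = "\<lambda>t. \<Sum>n\<le>N. b n * cis (of_int (- int n - 1) * t)"
  have r: "0 < r" using \<rho> by simp
  have "mode_out \<rho> \<mu> n (q n) (of_real r * cis t) = a n * cis (of_int (int n - 1) * t) - b n * cis (of_int (- int n - 1) * t)" for n t
  proof (cases n)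
    case (Suc m)
    have inv: "inverse (of_real r * cis t) ^ (n + 1) = of_real (inverse r ^ (n + 1)) * cis (of_int (- int n - 1) * t)"
    proof -
      have "inverse (of_real r * cis t) = of_real (inverse r) * cis (- t)" by simp
      then have "inverse (of_real r * cis t) ^ (n + 1) = of_real (inverse r) ^ (n + 1) * cis (real (n + 1) * (- t))"
        by (simp only: power_mult_distrib Complex.DeMoivre)
      moreover have "real (n + 1) * (- t) = of_int (- int n - 1) * t" by (simp add: algebra_simps)
      ultimately show ?thesis by (simp only: of_real_power)
    qed
    have pw: "(of_real r * cis t) ^ (n - 1) = of_real (r ^ (n - 1)) * cis (of_int (int n - 1) * t)"
      by (simp add: Suc power_mult_distrib Complex.DeMoivre)
    show ?thesis unfolding mode_out_def a_def b_def inv pw by (simp only: mult.assoc)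
  qed (simp add: mode_out_def a_def b_def)
  then have eq: "(\<Sum>n\<le>N. mode_out \<rho> \<mu> n (q n) (of_real r * cis t)) = ?A t - ?B t" for t
    by (simp only: sum_subtractf)
  have int: "integrable circle_measure (\<lambda>t. (cmod (\<Sum>n\<le>N. c n * cis (of_int (k n) * t)))\<^sup>2)" for c k
    by (intro continuous_imp_integrable_real continuous_intros)
  have int2: "integrable circle_measure (\<lambda>t. (cmod (?A t - ?B t))\<^sup>2)"
    by (intro continuous_imp_integrable_real continuous_intros)
  have "(LINT t|circle_measure. (cmod (?A t - ?B t))\<^sup>2) \<le> (LINT t|circle_measure. 2 * (cmod (?A t))\<^sup>2 + 2 * (cmod (?B t))\<^sup>2)"
  proof (rule integral_mono[OF int2])
    show "integrable circle_measure (\<lambda>t. 2 * (cmod (?A t))\<^sup>2 + 2 * (cmod (?B t))\<^sup>2)"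
      by (intro Bochner_Integration.integrable_add integrable_mult_right int)
    fix t
    have "(cmod (w - w'))\<^sup>2 \<le> 2 * (cmod w)\<^sup>2 + 2 * (cmod w')\<^sup>2" for w w'
    proof -
      have "(cmod (w - w'))\<^sup>2 \<le> (cmod w + cmod w')\<^sup>2" by (intro power_mono norm_triangle_ineq4) simp
      also have "\<dots> \<le> 2 * (cmod w)\<^sup>2 + 2 * (cmod w')\<^sup>2"
        using sum_squares_bound[of "cmod w" "cmod w'"] by (simp add: power2_sum)
      finally show ?thesis .
    qed
    then show "(cmod (?A t - ?B t))\<^sup>2 \<le> 2 * (cmod (?A t))\<^sup>2 + 2 * (cmod (?B t))\<^sup>2" .
  qed
  also have "\<dots> = 2 * (LINT t|circle_measure. (cmod (?A t))\<^sup>2) + 2 * (LINT t|circle_measure. (cmod (?B t))\<^sup>2)"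
    by (subst Bochner_Integration.integral_add[OF integrable_mult_right[OF int] integrable_mult_right[OF int]])
      (simp only: integral_mult_right_zero)
  also have "(LINT t|circle_measure. (cmod (?A t))\<^sup>2) = 2 * pi * (\<Sum>n\<le>N. (cmod (a n))\<^sup>2)"
    by (rule Parseval_finite) (simp_all add: inj_on_def)
  also have "(LINT t|circle_measure. (cmod (?B t))\<^sup>2) = 2 * pi * (\<Sum>n\<le>N. (cmod (b n))\<^sup>2)"
    by (rule Parseval_finite) (simp_all add: inj_on_def)
  also have "2 * (2 * pi * (\<Sum>n\<le>N. (cmod (a n))\<^sup>2)) + 2 * (2 * pi * (\<Sum>n\<le>N. (cmod (b n))\<^sup>2))
     \<le> 2 * (2 * pi * (\<Sum>n\<le>N. (x n)\<^sup>2)) + 2 * (2 * pi * (\<Sum>n\<le>N. (x n)\<^sup>2))"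
  proof (intro add_mono mult_left_mono sum_mono)
    fix n
    have "cmod (a n) = x n"
      unfolding a_def x_def using r by (simp only: norm_mult norm_of_real norm_of_nat power_abs)
    then show "(cmod (a n))\<^sup>2 \<le> (x n)\<^sup>2" by simp
    have "cmod (b n) \<le> x n"
    proof (cases n)
      case (Suc m)
      have "\<rho> ^ (2 * n) * inverse r ^ (n + 1) \<le> r ^ (2 * n) * inverse r ^ (n + 1)"
        using \<rho> r by (intro mult_right_mono power_mono) auto
      also have "\<dots> = r ^ m"
      proof -
        have "r ^ (2 * n) = r ^ m * r ^ (n + 1)" by (simp add: Suc power_add[symmetric] mult_2)
        moreover have "r ^ (n + 1) * inverse r ^ (n + 1) = 1"
          using r by (simp only: power_mult_distrib[symmetric]) simp
        ultimately show ?thesis by (simp only: mult.assoc mult_1_right)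
      qed
      finally have p: "\<rho> ^ (2 * n) * inverse r ^ (n + 1) \<le> r ^ (n - 1)" by (simp add: Suc)
      have "cmod (b n) = \<bar>\<mu>\<bar> * (real n * cmod (q n) * (\<rho> ^ (2 * n) * inverse r ^ (n + 1)))"
        unfolding b_def using \<rho> r by (simp only: norm_mult norm_of_real norm_of_nat complex_mod_cnj abs_mult power_abs[symmetric] abs_inverse) (simp add: mult_ac)
      also have "\<dots> \<le> 1 * (real n * cmod (q n) * r ^ (n - 1))"
        using \<mu> p \<rho> r by (intro mult_mono mult_left_mono) auto
      finally show ?thesis by (simp add: x_def)
    qed (simp add: b_def x_def)
    then show "(cmod (b n))\<^sup>2 \<le> (x n)\<^sup>2" by (intro power_mono) auto
  qed auto
  finally show ?thesis unfolding eq x_def by simp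
qed

text \<open>\<open>mode_mass q N r\<close> bounds the Dirichlet energy on the disk of radius \<open>r\<close>, and \<open>mode_density q N\<close> is its derivative.\<close>

definition mode_density :: "(nat \<Rightarrow> complex) \<Rightarrow> nat \<Rightarrow> real \<Rightarrow> real" where
  "mode_density q N r = 8 * pi * (\<Sum>n\<le>N. (real n * cmod (q n))\<^sup>2 * r ^ (2 * n - 1))"

definition mode_mass :: "(nat \<Rightarrow> complex) \<Rightarrow> nat \<Rightarrow> real \<Rightarrow> real" where
  "mode_mass q N r = 4 * pi * (\<Sum>n\<le>N. real n * (cmod (q n))\<^sup>2 * r ^ (2 * n))"

lemma mode_density_has_integral:
  assumes "a \<le> b"
  shows "(mode_density q N has_integral mode_mass q N b - mode_mass q N a) {a..b}"
proof (rule fundamental_theorem_of_calculus[OF assms])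
  fix r
  have "((\<lambda>r. real n * (cmod (q n))\<^sup>2 * r ^ (2 * n)) has_real_derivative 2 * ((real n * cmod (q n))\<^sup>2 * r ^ (2 * n - 1))) (at r within {a..b})" for n
    by (auto intro!: derivative_eq_intros simp: power2_eq_square)
  then have "((\<lambda>r. \<Sum>n\<le>N. real n * (cmod (q n))\<^sup>2 * r ^ (2 * n)) has_real_derivative (\<Sum>n\<le>N. 2 * ((real n * cmod (q n))\<^sup>2 * r ^ (2 * n - 1)))) (at r within {a..b})"
    by (intro DERIV_sum)
  from DERIV_cmult[OF this, of "4 * pi"]
  have "(mode_mass q N has_real_derivative 4 * pi * (\<Sum>n\<le>N. 2 * ((real n * cmod (q n))\<^sup>2 * r ^ (2 * n - 1)))) (at r within {a..b})"
    unfolding mode_mass_def[abs_def] .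
  moreover have "4 * pi * (\<Sum>n\<le>N. 2 * ((real n * cmod (q n))\<^sup>2 * r ^ (2 * n - 1))) = mode_density q N r"
    unfolding mode_density_def sum_distrib_left[symmetric] by simp
  ultimately show "(mode_mass q N has_vector_derivative mode_density q N r) (at r within {a..b})"
    by (simp add: has_real_derivative_iff_has_vector_derivative)
qed

text \<open>The Jacobian r turns r^(2(n-1)) into r^(2n-1), the power in \<open>mode_density\<close>.
  At r = 0, where no bound on the circle is supplied, the Jacobian makes the integrand zero.\<close>

lemma integral_annulus_square_le:
  assumes ab: "0 \<le> a" "a \<le> b" and F: "continuous_on (annulus a b) F"
    and bound: "\<And>r. a \<le> r \<Longrightarrow> r \<le> b \<Longrightarrow> 0 < r \<Longrightarrow>
      (LINT t|circle_measure. (cmod (F (of_real r * cis t)))\<^sup>2) \<le> 8 * pi * (\<Sum>n\<le>N. (real n * cmod (q n) * r ^ (n - 1))\<^sup>2)"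
  shows "(LINT z|lebesgue_on (annulus a b). (cmod (F z))\<^sup>2) \<le> mode_mass q N b - mode_mass q N a"
proof -
  let ?f = "\<lambda>r t. r *\<^sub>R (cmod (F (of_real r * cis t)))\<^sup>2"
  have c2: "continuous_on (annulus a b) (\<lambda>z. (cmod (F z))\<^sup>2)" by (intro continuous_intros F)
  have "continuous_on (cbox (a,0) (b,2*pi)) (\<lambda>x. fst x *\<^sub>R (cmod (F (of_real (fst x) * cis (snd x))))\<^sup>2)"
    by (intro continuous_intros continuous_on_polar_comp ab F)
  then have cont: "continuous_on (cbox (a,0) (b,2*pi)) (\<lambda>(r,t). ?f r t)" by (simp add: case_prod_unfold)
  have "(LINT z|lebesgue_on (annulus a b). (cmod (F z))\<^sup>2) = integral {a..b} (\<lambda>r. integral {0..2*pi} (?f r))"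
    by (rule integral_annulus[OF ab c2])
  also have "\<dots> \<le> integral {a..b} (mode_density q N)"
  proof (rule integral_le)
    have "(\<lambda>r. integral (cbox 0 (2*pi)) (?f r)) integrable_on cbox a b"
      by (rule integrable_continuous, rule integral_continuous_on_param) (use cont in \<open>simp add: cbox_Pair_eq\<close>)
    then show "(\<lambda>r. integral {0..2*pi} (?f r)) integrable_on {a..b}" by simp
    show "mode_density q N integrable_on {a..b}"
      using mode_density_has_integral[OF ab(2)] by blast
    fix r assume r: "r \<in> {a..b}"
    show "integral {0..2*pi} (?f r) \<le> mode_density q N r"
    proof (cases "r = 0")
      case True
      then show ?thesis by (simp add: mode_density_def sum_nonneg)
    next
      case False
      then have r0: "0 < r" using r ab by simp
      have "continuous_on {0..2*pi} (\<lambda>t. (cmod (F (of_real r * cis t)))\<^sup>2)"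
        by (intro continuous_intros continuous_on_compose2[OF F]) (use polar_mem_annulus[OF ab(1) r] in auto)
      from integral_circle_eq[OF this]
      have "integral {0..2*pi} (?f r) = r * (LINT t|circle_measure. (cmod (F (of_real r * cis t)))\<^sup>2)"
        by simp
      also have "\<dots> \<le> r * (8 * pi * (\<Sum>n\<le>N. (real n * cmod (q n) * r ^ (n - 1))\<^sup>2))"
        using r r0 by (intro mult_left_mono bound) auto
      also have "\<dots> = 8 * pi * (\<Sum>n\<le>N. r * (real n * cmod (q n) * r ^ (n - 1))\<^sup>2)"
        by (simp only: sum_distrib_left mult.left_commute)
      also have "(\<Sum>n\<le>N. r * (real n * cmod (q n) * r ^ (n - 1))\<^sup>2) = (\<Sum>n\<le>N. (real n * cmod (q n))\<^sup>2 * r ^ (2 * n - 1))"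
      proof (intro sum.cong refl)
        show "r * (real n * cmod (q n) * r ^ (n - 1))\<^sup>2 = (real n * cmod (q n))\<^sup>2 * r ^ (2 * n - 1)" for n
        proof (cases n)
          case (Suc m)
          have "r * (real n * cmod (q n) * r ^ (n - 1))\<^sup>2 = (real n * cmod (q n))\<^sup>2 * (r * (r ^ (n - 1))\<^sup>2)"
            by (simp only: power_mult_distrib mult.left_commute)
          moreover have "r * (r ^ (n - 1))\<^sup>2 = r ^ (2 * n - 1)"
            by (simp add: Suc power_mult[symmetric] mult.commute)
          ultimately show ?thesis by (simp only:)
        qed simp
      qed
      finally show ?thesis by (simp only: mode_density_def)
    qed
  qed
  also have "\<dots> = mode_mass q N b - mode_mass q N a"
    by (rule integral_unique[OF mode_density_has_integral[OF ab(2)]])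
  finally show ?thesis .
qed

text \<open>Inner and outer estimates are increments of the same function \<open>mode_mass\<close>,
  so they telescope at the interface radius.\<close>

lemma modes_grad_annulus_bound:
  assumes \<rho>: "0 < \<rho>" and ab: "0 \<le> a" "a \<le> \<rho>" "\<rho> \<le> b" "b \<le> 1" and \<mu>: "\<bar>\<mu>\<bar> \<le> 1"
  shows "(l2norm disk_measure (\<lambda>z. indicator (annulus a b) z *\<^sub>R modes_grad \<rho> \<mu> q N z))\<^sup>2 \<le> mode_mass q N b - mode_mass q N a"
proof -
  let ?G = "modes_grad \<rho> \<mu> q N" and ?in = "\<lambda>z. \<Sum>n\<le>N. mode_in \<mu> n (q n) z" and ?out = "\<lambda>z. \<Sum>n\<le>N. mode_out \<rho> \<mu> n (q n) z"
  have sG: "square_integrable disk_measure ?G"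
    unfolding modes_grad_def[abs_def]
    by (rule square_integrable_sum) (rule H1_trace_square_integrable(2)[OF H1_trace_mode[OF \<rho>]])
  then have m: "(\<lambda>z. (cmod (?G z))\<^sup>2) \<in> borel_measurable disk_measure"
    by (auto simp: square_integrable_def)
  have cin: "continuous_on (annulus a \<rho>) ?in" by (intro continuous_on_sum mode_in_continuous)
  have cout: "continuous_on (annulus \<rho> b) ?out"
    by (intro continuous_on_sum mode_out_continuous annulus_nonzero \<rho>)
  have "(l2norm disk_measure (\<lambda>z. indicator (annulus a b) z *\<^sub>R ?G z))\<^sup>2 = (LINT z|disk_measure. indicator (annulus a b) z *\<^sub>R (cmod (?G z))\<^sup>2)"
    unfolding l2norm_power2 by (rule Bochner_Integration.integral_cong) (auto simp: indicator_def)
  also have "\<dots> = (LINT z|lebesgue_on (annulus a \<rho>). (cmod (?in z))\<^sup>2) + (LINT z|lebesgue_on (annulus \<rho> b). (cmod (?out z))\<^sup>2)"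
  proof (rule integral_disk_split[OF m ab])
    show "continuous_on (annulus a \<rho>) (\<lambda>z. (cmod (?in z))\<^sup>2)" "continuous_on (annulus \<rho> b) (\<lambda>z. (cmod (?out z))\<^sup>2)"
      by (intro continuous_intros cin cout)+
    show "(cmod (?G z))\<^sup>2 = (cmod (?in z))\<^sup>2" if "cmod z < \<rho>" for z
      unfolding modes_grad_def mode_grad_inside[OF \<rho> that] cnj_sum[symmetric] complex_mod_cnj ..
    show "(cmod (?G z))\<^sup>2 = (cmod (?out z))\<^sup>2" if "\<rho> < cmod z" for z
      unfolding modes_grad_def mode_grad_outside[OF \<rho> that] cnj_sum[symmetric] complex_mod_cnj ..
  qed
  also have "\<dots> \<le> (mode_mass q N \<rho> - mode_mass q N a) + (mode_mass q N b - mode_mass q N \<rho>)"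
    by (intro add_mono integral_annulus_square_le cin cout mode_in_circle_integral mode_out_circle_integral \<rho> ab \<mu>)
      (use ab \<rho> in auto)
  finally show ?thesis by simp
qed

text \<open>The crude bound k (b - a) would cost half a derivative of the data. The cofactor of b -
  a is estimated by the geometric series of b instead, which is uniform in the exponent as long as b
  < 1.\<close>

lemma power_diff_le:
  fixes a b :: real
  assumes "0 \<le> a" "a \<le> b" "b < 1"
  shows "b ^ k - a ^ k \<le> (b - a) / (1 - b)"
proof -
  have "b ^ k - a ^ k = (b - a) * (\<Sum>i<k. a ^ (k - Suc i) * b ^ i)"
    by (rule power_diff_sumr2)
  also have "\<dots> \<le> (b - a) * (\<Sum>i<k. 1 * b ^ i)"
    using assms by (intro mult_left_mono sum_mono mult_right_mono power_le_one) auto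
  also have "\<dots> \<le> (b - a) * (1 / (1 - b))"
  proof (intro mult_left_mono)
    have "(\<Sum>i<k. b ^ i) \<le> (\<Sum>i. b ^ i)"
      using assms by (intro sum_le_suminf summable_geometric) auto
    then show "(\<Sum>i<k. 1 * b ^ i) \<le> 1 / (1 - b)" using assms by (simp add: suminf_geometric)
  qed (use assms in simp)
  finally show ?thesis by simp
qed

lemma mode_mass_diff_le:
  assumes "0 \<le> a" "a \<le> b" "b < 1"
  shows "mode_mass q N b - mode_mass q N a \<le> (b - a) / (1 - b) * mode_mass q N 1"
proof -
  have "mode_mass q N b - mode_mass q N a = 4 * pi * (\<Sum>n\<le>N. real n * (cmod (q n))\<^sup>2 * (b ^ (2 * n) - a ^ (2 * n)))"
    by (simp add: mode_mass_def right_diff_distrib sum_subtractf)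
  also have "\<dots> \<le> 4 * pi * (\<Sum>n\<le>N. real n * (cmod (q n))\<^sup>2 * ((b - a) / (1 - b)))"
    by (intro mult_left_mono sum_mono power_diff_le assms) auto
  also have "\<dots> = (b - a) / (1 - b) * mode_mass q N 1"
    unfolding mode_mass_def sum_distrib_right[symmetric] by simp
  finally show ?thesis .
qed

lemma mode_mass_nonneg: "0 \<le> r \<Longrightarrow> 0 \<le> mode_mass q N r"
  unfolding mode_mass_def by (intro mult_nonneg_nonneg sum_nonneg) auto

section \<open>Geometry of perturbed disks\<close>

text \<open>The suprema in \<open>C2_circle_norm\<close> run over the whole line; they say something
  about individual values only once the sets are known to be bounded, which periodicity
  provides.\<close>

lemma periodic_continuous_bounded:
  fixes f :: "real \<Rightarrow> real"
  assumes cont: "continuous_on UNIV f" and per: "\<And>s. f (s + p) = f s" and p: "p > 0"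
  shows "bdd_above (range (\<lambda>s. \<bar>f s\<bar>))"
proof -
  have per_nat: "f (s + real n * p) = f s" for s n
  proof (induction n)
    case (Suc n)
    have "f (s + real (Suc n) * p) = f ((s + real n * p) + p)" by (simp add: algebra_simps)
    then show ?case by (simp only: per Suc.IH)
  qed simp
  have "compact (f ` {0..p})"
    by (intro compact_continuous_image continuous_on_subset[OF cont]) auto
  then obtain B where B: "\<And>s. s \<in> {0..p} \<Longrightarrow> \<bar>f s\<bar> \<le> B"
    by (metis bounded_iff compact_imp_bounded imageI real_norm_def)
  have "\<bar>f s\<bar> \<le> B" for s
  proof -
    define k where "k = \<lfloor>s / p\<rfloor>"
    define s' where "s' = s - of_int k * p"
    have "of_int k \<le> s / p" "s / p < of_int k + 1" unfolding k_def by linarith+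
    then have "s' \<in> {0..p}" using p by (simp add: s'_def field_simps)
    moreover have "f s = f s'"
    proof (cases "k \<ge> 0")
      case True
      then have "s = s' + real (nat k) * p" by (simp add: s'_def)
      then show ?thesis using per_nat[of s' "nat k"] by simp
    next
      case False
      then have "s' = s + real (nat (- k)) * p" by (simp add: s'_def)
      then show ?thesis using per_nat[of s "nat (- k)"] by simp
    qed
    ultimately show ?thesis using B by simp
  qed
  then show ?thesis by (intro bdd_aboveI[of _ B]) auto
qed

text \<open>The shift identifies the numbers that are derivatives at s + p with those that are
  derivatives at s, so \<open>deriv\<close> selects the same one at both points.\<close>

lemma deriv_periodic:
  fixes f :: "real \<Rightarrow> real"
  assumes "\<And>s. f (s + p) = f s"
  shows "deriv f (s + p) = deriv f s"
proof -
  have eq: "(\<lambda>s. f (s + p)) = f" by (rule ext) (rule assms)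
  have "(f has_field_derivative D) (at (s + p)) \<longleftrightarrow> (f has_field_derivative D) (at s)" for D
    using DERIV_shift[of f D s p] unfolding eq .
  then show ?thesis unfolding deriv_def by (simp only:)
qed

text \<open>The suprema of the two derivatives are nonnegative, so the first supremum alone is below
  1. Its boundedness makes it an upper bound for the values of \<open>\<delta>\<close>.\<close>

lemma C2_circle_norm_bound:
  assumes C2: "C2_fun (arc_lift 0 \<rho> \<delta>)" and small: "C2_circle_norm 0 \<rho> \<delta> < 1" and \<rho>: "\<rho> > 0" and x: "cmod x = \<rho>"
  shows "\<bar>\<delta> x\<bar> < 1"
proof -
  let ?h = "arc_lift 0 \<rho> \<delta>" and ?p = "2 * pi * \<rho>"
  have per: "?h (s + ?p) = ?h s" for s
  proof -
    have "(s + ?p) / \<rho> = s / \<rho> + 2 * pi" using \<rho> by (simp add: field_simps)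
    then have "cis ((s + ?p) / \<rho>) = cis (s / \<rho>)" by (simp add: cis.ctr)
    then show ?thesis by (simp add: arc_lift_def)
  qed
  note per1 = deriv_periodic[where f = ?h and p = ?p, OF per]
  note per2 = deriv_periodic[where f = "deriv ?h" and p = ?p, OF per1]
  have c: "continuous_on UNIV ?h" "continuous_on UNIV (deriv ?h)" "continuous_on UNIV (deriv (deriv ?h))"
    using C2 by (auto simp: C2_fun_def intro: differentiable_imp_continuous_on)
  have p: "?p > 0" using \<rho> by simp
  note b = periodic_continuous_bounded[where p = ?p, OF c(1) per p] periodic_continuous_bounded[where p = ?p, OF c(2) per1 p] periodic_continuous_bounded[where p = ?p, OF c(3) per2 p]
  have nn: "0 \<le> (SUP s. \<bar>f s\<bar>)" if "bdd_above (range (\<lambda>s. \<bar>f s\<bar>))" for f :: "real \<Rightarrow> real"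
    using cSUP_upper[OF UNIV_I that, of 0] by linarith
  have "x = of_real \<rho> * cis (Arg x)" using rcis_cmod_Arg[of x] unfolding rcis_def x by (rule sym)
  then have "\<bar>\<delta> x\<bar> = \<bar>?h (\<rho> * Arg x)\<bar>" using \<rho> by (simp add: arc_lift_def)
  also have "\<dots> \<le> (SUP s. \<bar>?h s\<bar>)" by (rule cSUP_upper[OF UNIV_I b(1)])
  also have "\<dots> < 1" using small nn[OF b(2)] nn[OF b(3)] unfolding C2_circle_norm_def by linarith
  finally show ?thesis .
qed

text \<open>The perturbation condition places the frontier inside the annulus. It remains to exclude
  that D lies on the wrong side of its frontier: D is bounded by the unit disk, so rays leave it,
  and each ray from 0 meets the frontier at most once.\<close>

lemma eps_perturbation_annulus:
  assumes eps: "0 \<le> \<epsilon>" "\<epsilon> < \<rho>" and D: "eps_perturbation \<epsilon> 0 \<rho> D" and sub: "D \<subseteq> Omega"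
  shows "z \<in> D \<Longrightarrow> cmod z \<le> \<rho> + \<epsilon>" "cmod z < \<rho> - \<epsilon> \<Longrightarrow> z \<in> D"
proof -
  have \<rho>: "\<rho> > 0" using eps by simp
  have C2D: "C2_domain D" and ex: "\<exists>\<delta>. C2_fun (arc_lift 0 \<rho> \<delta>) \<and> C2_circle_norm 0 \<rho> \<delta> < 1 \<and>
        frontier D = (\<lambda>x. x + (\<epsilon> * \<delta> x) *\<^sub>R ((x - 0) /\<^sub>R \<rho>)) ` sphere 0 \<rho>"
    using D unfolding eps_perturbation_def by simp_all
  obtain \<delta> where C2: "C2_fun (arc_lift 0 \<rho> \<delta>)" "C2_circle_norm 0 \<rho> \<delta> < 1"
    and fr: "frontier D = (\<lambda>x. x + (\<epsilon> * \<delta> x) *\<^sub>R ((x - 0) /\<^sub>R \<rho>)) ` sphere 0 \<rho>"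
    using ex by (elim exE conjE)
  have "open D" and ne: "D \<noteq> {}" using C2D by (simp_all add: C2_domain_def)
  have frontier_point: "\<exists>x. cmod x = \<rho> \<and> y = (1 + \<epsilon> * \<delta> x / \<rho>) *\<^sub>R x \<and> x = (\<rho> / cmod y) *\<^sub>R y \<and> \<rho> - \<epsilon> \<le> cmod y \<and> cmod y \<le> \<rho> + \<epsilon>"
    if y: "y \<in> frontier D" for y
  proof -
    obtain x where x: "cmod x = \<rho>" "y = x + (\<epsilon> * \<delta> x) *\<^sub>R (x /\<^sub>R \<rho>)"
      using y unfolding fr by auto
    define t where "t = 1 + \<epsilon> * \<delta> x / \<rho>"
    have yt: "y = t *\<^sub>R x" unfolding x(2) t_def by (simp add: scaleR_add_left divide_inverse)
    have "\<bar>\<epsilon> * \<delta> x\<bar> \<le> \<epsilon> * 1"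
      unfolding abs_mult using C2_circle_norm_bound[OF C2 \<rho> x(1)] eps by (intro mult_mono) auto
    then have e: "- \<epsilon> \<le> \<epsilon> * \<delta> x" "\<epsilon> * \<delta> x \<le> \<epsilon>" by linarith+
    have tr: "t * \<rho> = \<rho> + \<epsilon> * \<delta> x" using \<rho> by (simp add: t_def field_simps)
    with e eps have "t * \<rho> > 0" by linarith
    then have t: "t > 0" using \<rho> by (simp add: zero_less_mult_iff)
    then have cy: "cmod y = t * \<rho>" by (simp add: yt x(1))
    have "x = (\<rho> / cmod y) *\<^sub>R y" unfolding cy unfolding yt using t \<rho> by simp
    moreover have "\<rho> - \<epsilon> \<le> cmod y" "cmod y \<le> \<rho> + \<epsilon>" using cy tr e by linarith+
    ultimately show ?thesis using x(1) yt unfolding t_def by (intro exI[of _ x] conjI)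
  qed
  have frontier_norm: "\<rho> - \<epsilon> \<le> cmod y" "cmod y \<le> \<rho> + \<epsilon>" if "y \<in> frontier D" for y
    using frontier_point[OF that] by auto
  \<comment> \<open>Since \<epsilon> < \<rho>, a frontier point is a positive multiple of its
    parameter \<open>x\<close>, which is thus its radial projection. Points on one ray share the
    projection, and the parametrisation returns the same point.\<close>
  have frontier_unique: "y = y'" if y: "y \<in> frontier D" "y' \<in> frontier D" and s: "y' = s *\<^sub>R y" "s > 0" for y y' s
  proof -
    have "(\<rho> / cmod y') *\<^sub>R y' = (\<rho> / cmod y) *\<^sub>R y" using s by simp
    moreover obtain x where x: "y = (1 + \<epsilon> * \<delta> x / \<rho>) *\<^sub>R x" "x = (\<rho> / cmod y) *\<^sub>R y"
      using frontier_point[OF y(1)] by (elim exE conjE)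
    moreover obtain x' where x': "y' = (1 + \<epsilon> * \<delta> x' / \<rho>) *\<^sub>R x'" "x' = (\<rho> / cmod y') *\<^sub>R y'"
      using frontier_point[OF y(2)] by (elim exE conjE)
    ultimately have "x = x'" by (metis (no_types))
    show ?thesis unfolding x(1) x'(1) \<open>x = x'\<close> ..
  qed
  have ray: "\<exists>s\<ge>1. s *\<^sub>R w \<in> frontier D" if w: "w \<in> D" "w \<noteq> 0" for w
  proof -
    let ?R = "(\<lambda>s. s *\<^sub>R w) ` {1..}"
    have "connected ?R" by (intro connected_continuous_image continuous_intros) (simp add: is_interval_connected)
    moreover have "w \<in> ?R" by (auto intro!: image_eqI[of _ _ 1])
    moreover have "?R - D \<noteq> {}"
    proof -
      \<comment> \<open>This multiple of \<open>w\<close> has norm \<open>cmod w + 1\<close> and so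
        lies outside the unit disk.\<close>
      let ?s = "1 + 1 / cmod w"
      have "cmod (?s *\<^sub>R w) = cmod w + 1" using w by (simp add: abs_of_nonneg field_simps)
      then have "?s *\<^sub>R w \<notin> D" using sub by force
      moreover have "?s *\<^sub>R w \<in> ?R" by (rule imageI) simp
      ultimately show ?thesis by blast
    qed
    ultimately have "?R \<inter> frontier D \<noteq> {}" using w connected_Int_frontier[of ?R D] by blast
    then show ?thesis by auto
  qed
  show "cmod z \<le> \<rho> + \<epsilon>" if z: "z \<in> D"
  proof (rule ccontr)
    assume n: "\<not> cmod z \<le> \<rho> + \<epsilon>"
    then have "z \<noteq> 0" using eps by auto
    then obtain s where s: "s \<ge> 1" "s *\<^sub>R z \<in> frontier D" using ray[OF z] by blast
    have "1 * cmod z \<le> s * cmod z" using s by (intro mult_right_mono) auto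
    then show False using frontier_norm(2)[OF s(2)] s(1) n by simp
  qed
  \<comment> \<open>If 0 were outside D, the ray through a point w of D would cross the frontier
    both at some t <= 1 and at some s >= 1. Uniqueness forces t = s = 1, so that w is a frontier
    point of the open set D.\<close>
  have zero: "0 \<in> D"
  proof (rule ccontr)
    assume n: "0 \<notin> D"
    obtain w where w: "w \<in> D" using ne by blast
    with n have "w \<noteq> 0" by auto
    then obtain s where s: "s \<ge> 1" "s *\<^sub>R w \<in> frontier D" using ray[OF w] by blast
    have "closed_segment 0 w \<inter> frontier D \<noteq> {}"
    proof (rule connected_Int_frontier)
      show "closed_segment 0 w \<inter> D \<noteq> {}" using w by auto
      show "closed_segment 0 w - D \<noteq> {}" using n by auto
    qed simp
    then obtain t where t: "0 \<le> t" "t \<le> 1" "t *\<^sub>R w \<in> frontier D" by (auto simp: in_segment)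
    have "t \<noteq> 0" using frontier_norm(1)[OF t(3)] eps by auto
    then have "s *\<^sub>R w = (s / t) *\<^sub>R (t *\<^sub>R w)" "s / t > 0" using t s by auto
    from frontier_unique[OF t(3) s(2) this] have "t = s" using \<open>w \<noteq> 0\<close> by simp
    then have "w \<in> frontier D" using s t by simp
    then show False using w \<open>open D\<close> by (simp add: frontier_def interior_open)
  qed
  show "z \<in> D" if z: "cmod z < \<rho> - \<epsilon>"
  proof (rule ccontr)
    assume n: "z \<notin> D"
    \<comment> \<open>The ball is connected and meets D at 0; if it also left D it would contain a
      frontier point, of norm less than \<rho> - \<epsilon>.\<close>
    have "ball 0 (\<rho> - \<epsilon>) \<inter> frontier D \<noteq> {}"
    proof (rule connected_Int_frontier)
      have "0 \<in> ball 0 (\<rho> - \<epsilon>)" using eps by simp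
      with zero show "ball 0 (\<rho> - \<epsilon>) \<inter> D \<noteq> {}" by blast
      show "ball 0 (\<rho> - \<epsilon>) - D \<noteq> {}" using z n by auto
    qed simp
    then obtain y where "cmod y < \<rho> - \<epsilon>" "y \<in> frontier D" by auto
    then show False using frontier_norm(1)[of y] by simp
  qed
qed

text \<open>A real point r of the disk is compared with the boundary point 1, at distance 1 - r;
  then r tends to \<rho>.\<close>

lemma ball_subset_Omega0:
  assumes "ball 0 \<rho> \<subseteq> Omega0 \<delta>0" "0 < \<rho>"
  shows "\<rho> \<le> 1 - \<delta>0"
proof (rule dense_le_bounded[of 0])
  fix r assume r: "0 < r" "r < \<rho>"
  then have "complex_of_real r \<in> Omega0 \<delta>0" using assms(1) by auto
  then have "cmod (of_real r) < 1" and d: "\<delta>0 \<le> infdist (complex_of_real r) (frontier Omega)"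
    by (simp_all add: Omega0_def)
  have "infdist (complex_of_real r) (frontier Omega) \<le> dist (complex_of_real r) 1"
    by (rule infdist_le) simp
  also have "dist (complex_of_real r) 1 = 1 - r"
  proof -
    have "dist (complex_of_real r) 1 = cmod (of_real (r - 1))" by (simp add: dist_norm)
    also have "\<dots> = 1 - r" using \<open>cmod (of_real r) < 1\<close> by (simp only: norm_of_real)
    finally show ?thesis .
  qed
  finally show "r \<le> 1 - \<delta>0" using d by simp
qed fact

section \<open>Gradient of the disk solution on thin annuli\<close>

text \<open>For a fixed test function the energy is continuous in the gradient, so the weak equation
  passes to the limit.\<close>

lemma (in bounded_coefficient) dirichlet_solution_limit:
  assumes s: "\<And>N. dirichlet_solution \<gamma> (f N) (u N) (G N)"
    and v: "H1_trace v F g" and lim: "(\<lambda>N. l2norm disk_measure (\<lambda>z. G N z - F z)) \<longlonglongrightarrow> 0"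
  shows "dirichlet_solution \<gamma> g v F"
  unfolding dirichlet_solution_def
proof (intro conjI allI impI v)
  fix w H assume w: "H1_trace w H (\<lambda>z. 0)"
  note sH = H1_trace_square_integrable(2)[OF w] and sF = H1_trace_square_integrable(2)[OF v]
    and sG = dirichlet_solution_square_integrable[OF s]
  have e0: "energy \<gamma> (G N) H = 0" for N using s[of N] w by (simp add: dirichlet_solution_def)
  have "\<bar>energy \<gamma> F H\<bar> \<le> K * l2norm disk_measure (\<lambda>z. G N z - F z) * l2norm disk_measure H" for N
    using abs_energy_le[OF square_integrable_diff[OF sG[of N] sF] sH] energy_diff_left[OF sG[of N] sF sH] e0[of N] by simp
  moreover have "(\<lambda>N. K * l2norm disk_measure (\<lambda>z. G N z - F z) * l2norm disk_measure H) \<longlonglongrightarrow> K * 0 * l2norm disk_measure H"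
    by (rule tendsto_mult[OF tendsto_mult[OF tendsto_const lim] tendsto_const])
  ultimately have "\<bar>energy \<gamma> F H\<bar> \<le> K * 0 * l2norm disk_measure H"
    by (intro LIMSEQ_le_const[of _ "K * 0 * l2norm disk_measure H"]) auto
  then show "energy \<gamma> F H = 0" by simp
qed

text \<open>The weight n is at most the square root of 1 + n^2, and the factor 4 comes from the
  doubled coefficients. The nonnegative frequencies form a finite part of the two-sided sum.\<close>

lemma sobolev_half_partial_sum:
  assumes g: "g \<in> sobolev (1/2)"
  shows "(\<Sum>n\<le>N. real n * (cmod (fourier_poly_coeff g n))\<^sup>2) \<le> 4 * (sobolev_norm (1/2) g)\<^sup>2"
proof -
  let ?a = "\<lambda>n::int. (1 + (of_int n)\<^sup>2) powr (1/2) * (cmod (fourier_coeff g n))\<^sup>2"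
  have sum: "?a summable_on UNIV" using g by (simp add: sobolev_def)
  have nn: "0 \<le> ?a n" for n by simp
  have "real n * (cmod (fourier_poly_coeff g n))\<^sup>2 \<le> 4 * ?a (int n)" for n
  proof (cases "n = 0")
    case False
    have "real n = sqrt ((real n)\<^sup>2)" by simp
    also have "\<dots> \<le> sqrt (1 + (real n)\<^sup>2)" by (rule real_sqrt_le_mono) simp
    also have "\<dots> = (1 + (of_int (int n))\<^sup>2) powr (1/2)" by (simp add: powr_half_sqrt)
    finally have "real n * (4 * (cmod (fourier_coeff g (int n)))\<^sup>2) \<le> (1 + (of_int (int n))\<^sup>2) powr (1/2) * (4 * (cmod (fourier_coeff g (int n)))\<^sup>2)"
      by (rule mult_right_mono) simp
    moreover have "(cmod (fourier_poly_coeff g n))\<^sup>2 = 4 * (cmod (fourier_coeff g (int n)))\<^sup>2"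
      using False by (simp add: fourier_poly_coeff_def norm_mult power_mult_distrib)
    ultimately show ?thesis by (simp only: mult.left_commute)
  qed simp
  then have "(\<Sum>n\<le>N. real n * (cmod (fourier_poly_coeff g n))\<^sup>2) \<le> (\<Sum>n\<le>N. 4 * ?a (int n))"
    by (intro sum_mono)
  also have "\<dots> = 4 * (\<Sum>n\<in>int ` {..N}. ?a n)"
    by (subst sum.reindex) (simp_all add: sum_distrib_left)
  also have "\<dots> \<le> 4 * infsum ?a UNIV"
    by (intro mult_left_mono finite_sum_le_infsum[OF sum]) (use nn in auto)
  also have "infsum ?a UNIV = (sobolev_norm (1/2) g)\<^sup>2"
    unfolding sobolev_norm_def by (simp add: infsum_nonneg)
  finally show ?thesis .
qed

text \<open>The truncated Fourier series of the data are solved exactly. Their gradients are Cauchy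
  because the tails have small energy, and the limit inherits both the weak equation and the bounds
  on annuli. The given extension ensures that the truncations converge to the data on the
  circle.\<close>

lemma disk_solution_gradient_bound:
  assumes \<rho>: "0 < \<rho>" "\<rho> < 1" and \<sigma>: "0 < \<sigma>1" "0 < \<sigma>2" and \<mu>: "\<mu> = (\<sigma>1 - \<sigma>2) / (\<sigma>1 + \<sigma>2)"
    and g: "g \<in> sobolev (1/2)" and tr: "H1_trace v0 H0 g"
  obtains v H where "dirichlet_solution (conductivity \<sigma>1 \<sigma>2 (ball 0 \<rho>)) g v H"
    and "l2norm disk_measure H \<le> sqrt (16 * pi / (1 - \<bar>\<mu>\<bar>)\<^sup>2) * sobolev_norm (1/2) g"
    and "\<And>a b. 0 \<le> a \<Longrightarrow> a \<le> \<rho> \<Longrightarrow> \<rho> \<le> b \<Longrightarrow> b < 1 \<Longrightarrow>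
      l2norm disk_measure (\<lambda>z. indicator (annulus a b) z *\<^sub>R H z)
        \<le> sqrt ((b - a) / (1 - b) * (16 * pi / (1 - \<bar>\<mu>\<bar>)\<^sup>2)) * sobolev_norm (1/2) g"
proof -
  let ?\<gamma> = "conductivity \<sigma>1 \<sigma>2 (ball 0 \<rho>)"
  interpret bounded_coefficient ?\<gamma> "min \<sigma>1 \<sigma>2" "max \<sigma>1 \<sigma>2"
    by (rule bounded_coefficient_conductivity) (use \<sigma> in auto)
  define S where "S = sobolev_norm (1/2) g"
  \<comment> \<open>The origin of the constant: 4 pi from \<open>mode_mass\<close>, 4 from the
    doubled Fourier coefficients, and the lower bound 1 - |\<mu>| for the divisors 1 + \<mu>
    \<rho>^(2n), squared.\<close>
  define M0 where "M0 = 16 * pi / (1 - \<bar>\<mu>\<bar>)\<^sup>2"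
  have \<mu>1: "\<bar>\<mu>\<bar> < 1" using \<sigma> by (auto simp: \<mu> abs_less_iff field_simps)
  have M0: "0 \<le> M0" by (simp add: M0_def)
  have S0: "0 \<le> S" unfolding S_def sobolev_norm_def by (intro real_sqrt_ge_zero infsum_nonneg) simp
  have den: "1 - \<bar>\<mu>\<bar> \<le> 1 + \<mu> * \<rho> ^ (2 * n)" for n
  proof -
    have "\<bar>\<mu> * \<rho> ^ (2 * n)\<bar> \<le> \<bar>\<mu>\<bar> * 1"
      unfolding abs_mult using \<rho> by (intro mult_left_mono) (auto simp: power_abs[symmetric] intro: power_le_one)
    then show ?thesis by linarith
  qed
  define c where "c = fourier_poly_coeff g"
  define q where "q n = c n / of_real (1 + \<mu> * \<rho> ^ (2 * n))" for n
  have q_le: "(cmod (q n))\<^sup>2 \<le> (cmod (c n))\<^sup>2 / (1 - \<bar>\<mu>\<bar>)\<^sup>2" for n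
  proof -
    have "cmod (q n) = cmod (c n) / \<bar>1 + \<mu> * \<rho> ^ (2 * n)\<bar>" unfolding q_def by (simp only: norm_divide norm_of_real)
    also have "\<dots> \<le> cmod (c n) / (1 - \<bar>\<mu>\<bar>)"
      using den[of n] \<mu>1 by (intro divide_left_mono mult_pos_pos) auto
    finally have "(cmod (q n))\<^sup>2 \<le> (cmod (c n) / (1 - \<bar>\<mu>\<bar>))\<^sup>2" by (intro power_mono) auto
    then show ?thesis by (simp only: power_divide)
  qed
  have sum_bound: "(\<Sum>n\<le>N. real n * (cmod (q n))\<^sup>2) \<le> 4 * S\<^sup>2 / (1 - \<bar>\<mu>\<bar>)\<^sup>2" for N
  proof -
    have "(\<Sum>n\<le>N. real n * (cmod (q n))\<^sup>2) \<le> (\<Sum>n\<le>N. real n * ((cmod (c n))\<^sup>2 / (1 - \<bar>\<mu>\<bar>)\<^sup>2))"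
      by (intro sum_mono mult_left_mono q_le) auto
    also have "\<dots> = (\<Sum>n\<le>N. real n * (cmod (c n))\<^sup>2) / (1 - \<bar>\<mu>\<bar>)\<^sup>2" by (simp add: sum_divide_distrib)
    also have "\<dots> \<le> 4 * S\<^sup>2 / (1 - \<bar>\<mu>\<bar>)\<^sup>2"
      unfolding S_def c_def by (intro divide_right_mono sobolev_half_partial_sum g) simp
    finally show ?thesis .
  qed
  have mass: "mode_mass q N 1 \<le> M0 * S\<^sup>2" for N
  proof -
    have "mode_mass q N 1 = 4 * pi * (\<Sum>n\<le>N. real n * (cmod (q n))\<^sup>2)" by (simp add: mode_mass_def)
    also have "\<dots> \<le> 4 * pi * (4 * S\<^sup>2 / (1 - \<bar>\<mu>\<bar>)\<^sup>2)" by (intro mult_left_mono sum_bound) simp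
    finally show ?thesis by (simp add: M0_def)
  qed
  have "\<exists>u. dirichlet_solution ?\<gamma> (harmonic_poly c N) u (modes_grad \<rho> \<mu> q N)" for N
  proof -
    have nz: "1 + \<mu> * \<rho> ^ (2 * n) \<noteq> 0" for n using den[of n] \<mu>1 by linarith
    obtain u where "dirichlet_solution ?\<gamma> (harmonic_poly c N) u (modes_grad \<rho> \<mu> q N)"
      by (rule harmonic_poly_dirichlet_solution[where N = N, OF \<rho> \<sigma> \<mu> q_def nz])
    then show ?thesis by (rule exI[of _ u])
  qed
  then obtain u where u: "\<And>N. dirichlet_solution ?\<gamma> (harmonic_poly c N) (u N) (modes_grad \<rho> \<mu> q N)" by metis
  have sG: "square_integrable disk_measure (modes_grad \<rho> \<mu> q N)" for N
    by (rule dirichlet_solution_square_integrable[OF u])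
  \<comment> \<open>The open disk lies in this annulus, so total norms are covered by the estimate
    on annuli with outer radius 1.\<close>
  have full: "l2norm disk_measure F = l2norm disk_measure (\<lambda>z. indicator (annulus 0 1) z *\<^sub>R F z)" for F :: "complex \<Rightarrow> complex"
    by (rule l2norm_cong) (simp add: annulus_def)
  have norm_le: "l2norm disk_measure (modes_grad \<rho> \<mu> q' N) \<le> sqrt (mode_mass q' N 1)" for q' N
  proof (rule real_le_rsqrt)
    have "(l2norm disk_measure (modes_grad \<rho> \<mu> q' N))\<^sup>2 \<le> mode_mass q' N 1 - mode_mass q' N 0"
      unfolding full[of "modes_grad \<rho> \<mu> q' N"] by (rule modes_grad_annulus_bound) (use \<rho> \<mu>1 in auto)
    then show "(l2norm disk_measure (modes_grad \<rho> \<mu> q' N))\<^sup>2 \<le> mode_mass q' N 1"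
      using mode_mass_nonneg[of 0 q' N] by simp
  qed
  define P where "P N = (\<Sum>n\<le>N. real n * (cmod (q n))\<^sup>2)" for N
  have diff: "l2norm disk_measure (\<lambda>z. modes_grad \<rho> \<mu> q N z - modes_grad \<rho> \<mu> q M z) \<le> sqrt (4 * pi * (P N - P M))" if "M \<le> N" for M N
  proof -
    \<comment> \<open>The difference of two partial sums is itself a sum of modes, with the low
      coefficients set to zero, so the energy estimate applies to it directly.\<close>
    define q' where "q' n = (if n \<le> M then 0 else q n)" for n
    have z: "mode_grad \<rho> \<mu> n 0 z = 0" for n z by (simp add: mode_grad_def)
    have "modes_grad \<rho> \<mu> q N z - modes_grad \<rho> \<mu> q M z = modes_grad \<rho> \<mu> q' N z" for z
    proof -
      have s: "{..N} = {..M} \<union> {M<..N}" "{..M} \<inter> {M<..N} = {}" using that by auto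
      have "modes_grad \<rho> \<mu> q N z = modes_grad \<rho> \<mu> q M z + (\<Sum>n\<in>{M<..N}. mode_grad \<rho> \<mu> n (q n) z)"
        unfolding modes_grad_def s(1) by (rule sum.union_disjoint) (use s(2) in auto)
      moreover have "modes_grad \<rho> \<mu> q' N z = (\<Sum>n\<in>{M<..N}. mode_grad \<rho> \<mu> n (q n) z)"
        unfolding modes_grad_def by (rule sum.mono_neutral_cong_right) (auto simp: q'_def z)
      ultimately show ?thesis by simp
    qed
    moreover have "mode_mass q' N 1 = 4 * pi * (P N - P M)"
    proof -
      have s: "{..N} = {..M} \<union> {M<..N}" "{..M} \<inter> {M<..N} = {}" using that by auto
      have "P N = P M + (\<Sum>n\<in>{M<..N}. real n * (cmod (q n))\<^sup>2)"
        unfolding P_def s(1) by (rule sum.union_disjoint) (use s(2) in auto)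
      moreover have "(\<Sum>n\<le>N. real n * (cmod (q' n))\<^sup>2) = (\<Sum>n\<in>{M<..N}. real n * (cmod (q n))\<^sup>2)"
        by (rule sum.mono_neutral_cong_right) (auto simp: q'_def)
      ultimately show ?thesis by (simp add: mode_mass_def)
    qed
    ultimately show ?thesis using norm_le[of q' N] by (simp only:)
  qed
  \<comment> \<open>Monotone and bounded by the Sobolev norm, \<open>P\<close> is Cauchy; by
    \<open>diff\<close> so are the gradients.\<close>
  have incP: "incseq P" unfolding P_def by (intro incseq_SucI) simp
  have "Bseq P"
    using sum_bound by (intro BseqI'[of _ "4 * S\<^sup>2 / (1 - \<bar>\<mu>\<bar>)\<^sup>2"]) (simp add: P_def abs_of_nonneg sum_nonneg)
  then have "Cauchy P" using incP by (intro convergent_Cauchy Bseq_mono_convergent) (auto simp: incseq_def)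
  have Cauchy: "\<exists>N. \<forall>j\<ge>N. \<forall>k\<ge>N. l2norm disk_measure (\<lambda>z. modes_grad \<rho> \<mu> q k z - modes_grad \<rho> \<mu> q j z) < e" if e: "e > 0" for e
  proof -
    have "0 < e\<^sup>2 / (4 * pi)" using e by simp
    then obtain N where N: "\<And>j k. j \<ge> N \<Longrightarrow> k \<ge> N \<Longrightarrow> \<bar>P j - P k\<bar> < e\<^sup>2 / (4 * pi)"
      using CauchyD[OF \<open>Cauchy P\<close>] unfolding real_norm_def by metis
    have le: "l2norm disk_measure (\<lambda>z. modes_grad \<rho> \<mu> q k z - modes_grad \<rho> \<mu> q j z) < e" if "j \<ge> N" "k \<ge> N" "j \<le> k" for j k
    proof -
      have "P k - P j < e\<^sup>2 / (4 * pi)" using N[OF that(2,1)] by linarith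
      then have "4 * pi * (P k - P j) < e\<^sup>2" by (simp add: pos_less_divide_eq mult.commute)
      then have "sqrt (4 * pi * (P k - P j)) < sqrt (e\<^sup>2)" by (rule real_sqrt_less_mono)
      also have "sqrt (e\<^sup>2) = e" using e by simp
      finally show ?thesis using diff[OF that(3)] by linarith
    qed
    have "l2norm disk_measure (\<lambda>z. modes_grad \<rho> \<mu> q k z - modes_grad \<rho> \<mu> q j z) < e" if "j \<ge> N" "k \<ge> N" for j k
    proof (cases "j \<le> k")
      case False
      have "l2norm disk_measure (\<lambda>z. modes_grad \<rho> \<mu> q k z - modes_grad \<rho> \<mu> q j z) = l2norm disk_measure (\<lambda>z. modes_grad \<rho> \<mu> q j z - modes_grad \<rho> \<mu> q k z)"
        by (rule l2norm_minus_commute)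
      also have "\<dots> < e" by (rule le) (use that False in auto)
      finally show ?thesis .
    qed (use le that in auto)
    then show ?thesis by (intro exI[of _ N] allI impI)
  qed
  note sg = H1_trace_square_integrable(3)[OF tr]
  have limc: "(\<lambda>N. l2norm circle_measure (\<lambda>t. harmonic_poly c N (cis t) - g (cis t))) \<longlonglongrightarrow> 0"
    unfolding c_def
  proof (rule fourier_series_l2_convergence[OF sg])
    fix e :: real assume "e > 0"
    \<comment> \<open>Continuous approximants of \<open>g\<close> come with its extension: the C^1
      functions of the trace, restricted to the circle.\<close>
    then obtain \<phi> \<psi> where C: "C1_fun \<phi> \<psi>" and l: "l2norm circle_measure (\<lambda>t. \<phi> (cis t) - g (cis t)) < e"
      by (rule C1_fun_close[OF tr])
    show "\<exists>f. continuous_on (sphere 0 1) f \<and> l2norm circle_measure (\<lambda>t. f (cis t) - g (cis t)) < e"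
      by (intro exI[of _ \<phi>] conjI l C1_fun_continuous(1)[OF C])
  qed
  have H: "H1_trace (u N) (modes_grad \<rho> \<mu> q N) (harmonic_poly c N)" for N
    using u[of N] by (simp add: dirichlet_solution_def)
  obtain v F where v: "H1_trace v F g" and F: "(\<lambda>N. l2norm disk_measure (\<lambda>z. modes_grad \<rho> \<mu> q N z - F z)) \<longlonglongrightarrow> 0"
    by (rule H1_trace_complete[OF H sg limc Cauchy])
  note sF = H1_trace_square_integrable(2)[OF v]
  \<comment> \<open>Cutting off to \<open>A\<close> does not increase the distance to the limit, so
    a bound common to all truncations survives.\<close>
  have bound: "l2norm disk_measure (\<lambda>z. indicator A z *\<^sub>R F z) \<le> B"
    if A: "A \<in> sets lebesgue" and le: "\<And>N. l2norm disk_measure (\<lambda>z. indicator A z *\<^sub>R modes_grad \<rho> \<mu> q N z) \<le> B" for A B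
  proof -
    have "l2norm disk_measure (\<lambda>z. indicator A z *\<^sub>R F z) \<le> B + l2norm disk_measure (\<lambda>z. modes_grad \<rho> \<mu> q N z - F z)" for N
    proof -
      have "l2norm disk_measure (\<lambda>z. indicator A z *\<^sub>R F z) \<le> l2norm disk_measure (\<lambda>z. indicator A z *\<^sub>R modes_grad \<rho> \<mu> q N z)
        + l2norm disk_measure (\<lambda>z. indicator A z *\<^sub>R F z - indicator A z *\<^sub>R modes_grad \<rho> \<mu> q N z)"
        by (intro l2norm_le_add_diff square_integrable_indicator sF sG A)
      also have "(\<lambda>z. indicator A z *\<^sub>R F z - indicator A z *\<^sub>R modes_grad \<rho> \<mu> q N z) = (\<lambda>z. indicator A z *\<^sub>R (F z - modes_grad \<rho> \<mu> q N z))"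
        by (simp only: scaleR_diff_right)
      also have "l2norm disk_measure (\<lambda>z. indicator A z *\<^sub>R (F z - modes_grad \<rho> \<mu> q N z)) \<le> l2norm disk_measure (\<lambda>z. F z - modes_grad \<rho> \<mu> q N z)"
        by (intro square_integrable_indicator(2) square_integrable_diff sF sG A)
      also have "\<dots> = l2norm disk_measure (\<lambda>z. modes_grad \<rho> \<mu> q N z - F z)" by (rule l2norm_minus_commute)
      finally show ?thesis using le[of N] by linarith
    qed
    moreover have "(\<lambda>N. B + l2norm disk_measure (\<lambda>z. modes_grad \<rho> \<mu> q N z - F z)) \<longlonglongrightarrow> B + 0"
      by (rule tendsto_add[OF tendsto_const F])
    ultimately have "l2norm disk_measure (\<lambda>z. indicator A z *\<^sub>R F z) \<le> B + 0"
      by (intro LIMSEQ_le_const[of _ "B + 0"]) auto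
    then show ?thesis by simp
  qed
  have sqS: "sqrt (x * S\<^sup>2) = sqrt x * S" for x using S0 by (simp add: real_sqrt_mult)
  show thesis
  proof (rule that)
    show "dirichlet_solution ?\<gamma> g v F" by (rule dirichlet_solution_limit[OF u v F])
    have "l2norm disk_measure (\<lambda>z. indicator (annulus 0 1) z *\<^sub>R F z) \<le> sqrt M0 * S"
    proof (rule bound)
      fix N
      have "l2norm disk_measure (modes_grad \<rho> \<mu> q N) \<le> sqrt (mode_mass q N 1)" by (rule norm_le)
      also have "\<dots> \<le> sqrt (M0 * S\<^sup>2)" by (intro real_sqrt_le_mono mass)
      finally show "l2norm disk_measure (\<lambda>z. indicator (annulus 0 1) z *\<^sub>R modes_grad \<rho> \<mu> q N z) \<le> sqrt M0 * S"
        unfolding full[symmetric] sqS .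
    qed simp
    then show "l2norm disk_measure F \<le> sqrt (16 * pi / (1 - \<bar>\<mu>\<bar>)\<^sup>2) * sobolev_norm (1/2) g"
      unfolding full[symmetric] M0_def S_def .
    fix a b assume ab: "0 \<le> a" "a \<le> \<rho>" "\<rho> \<le> b" "b < 1"
    have "l2norm disk_measure (\<lambda>z. indicator (annulus a b) z *\<^sub>R F z) \<le> sqrt ((b - a) / (1 - b) * M0) * S"
    proof (rule bound)
      fix N
      have "(l2norm disk_measure (\<lambda>z. indicator (annulus a b) z *\<^sub>R modes_grad \<rho> \<mu> q N z))\<^sup>2 \<le> mode_mass q N b - mode_mass q N a"
        by (rule modes_grad_annulus_bound) (use ab \<rho> \<mu>1 in auto)
      also have "\<dots> \<le> (b - a) / (1 - b) * mode_mass q N 1"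
        by (rule mode_mass_diff_le) (use ab in auto)
      also have "\<dots> \<le> (b - a) / (1 - b) * (M0 * S\<^sup>2)"
        using ab by (intro mult_left_mono mass) auto
      finally have "l2norm disk_measure (\<lambda>z. indicator (annulus a b) z *\<^sub>R modes_grad \<rho> \<mu> q N z) \<le> sqrt ((b - a) / (1 - b) * (M0 * S\<^sup>2))"
        by (rule real_le_rsqrt)
      then show "l2norm disk_measure (\<lambda>z. indicator (annulus a b) z *\<^sub>R modes_grad \<rho> \<mu> q N z) \<le> sqrt ((b - a) / (1 - b) * M0) * S"
        unfolding mult.assoc[symmetric] sqS .
    qed simp
    then show "l2norm disk_measure (\<lambda>z. indicator (annulus a b) z *\<^sub>R F z)
        \<le> sqrt ((b - a) / (1 - b) * (16 * pi / (1 - \<bar>\<mu>\<bar>)\<^sup>2)) * sobolev_norm (1/2) g"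
      unfolding M0_def S_def .
  qed
qed

section \<open>The estimate for thin annuli and its assembly\<close>

lemma sobolev_mono:
  assumes f: "f \<in> sobolev s'" and "s \<le> s'"
  shows "f \<in> sobolev s" "sobolev_norm s f \<le> sobolev_norm s' f"
proof -
  let ?a = "\<lambda>s (n::int). (1 + (of_int n)\<^sup>2) powr s * (cmod (fourier_coeff f n))\<^sup>2"
  have le: "?a s n \<le> ?a s' n" for n
    using \<open>s \<le> s'\<close> by (intro mult_right_mono powr_mono) auto
  have sum': "?a s' summable_on UNIV" using f by (simp add: sobolev_def)
  have sum: "?a s summable_on UNIV"
    by (rule summable_on_comparison_test[OF sum' le]) simp
  show "f \<in> sobolev s" using f sum by (simp add: sobolev_def)
  show "sobolev_norm s f \<le> sobolev_norm s' f"
    unfolding sobolev_norm_def by (intro real_sqrt_le_mono infsum_mono sum sum' le)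
qed

lemma sobolev_norm_nonneg: "0 \<le> sobolev_norm s f"
  unfolding sobolev_norm_def by (intro real_sqrt_ge_zero infsum_nonneg) simp

text \<open>For \<epsilon> <= \<delta>0 / 2 the annulus stays at distance at least \<delta>0 / 2
  from the unit circle, and the ratio of width to distance is at most 4 \<epsilon> / \<delta>0. For
  larger \<epsilon> it may reach the circle, but then 4 \<epsilon> / \<delta>0 exceeds 1 and the
  bound on the whole disk is enough.\<close>

lemma thin_annulus_gradient_bound:
  assumes \<delta>0: "0 < \<delta>0" "\<rho> \<le> 1 - \<delta>0" and eps: "0 \<le> \<epsilon>" "\<epsilon> < \<rho>"
    and \<sigma>: "0 < \<sigma>1" "0 < \<sigma>2" and \<mu>: "\<mu> = (\<sigma>1 - \<sigma>2) / (\<sigma>1 + \<sigma>2)"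
    and g: "g \<in> sobolev (1/2)" and tr: "H1_trace v0 H0 g"
  obtains v H where "dirichlet_solution (conductivity \<sigma>1 \<sigma>2 (ball 0 \<rho>)) g v H"
    and "l2norm disk_measure (\<lambda>z. indicator (annulus (\<rho> - \<epsilon>) (\<rho> + \<epsilon>)) z *\<^sub>R H z)
      \<le> sqrt (4 * \<epsilon> / \<delta>0 * (16 * pi / (1 - \<bar>\<mu>\<bar>)\<^sup>2)) * sobolev_norm (1/2) g"
proof -
  let ?M = "16 * pi / (1 - \<bar>\<mu>\<bar>)\<^sup>2" and ?S = "sobolev_norm (1/2) g"
  have M: "0 \<le> ?M" by simp
  have \<rho>: "0 < \<rho>" "\<rho> < 1" using \<delta>0 eps by linarith+
  obtain v H where sol: "dirichlet_solution (conductivity \<sigma>1 \<sigma>2 (ball 0 \<rho>)) g v H"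
    and full: "l2norm disk_measure H \<le> sqrt ?M * ?S"
    and ann: "\<And>a b. 0 \<le> a \<Longrightarrow> a \<le> \<rho> \<Longrightarrow> \<rho> \<le> b \<Longrightarrow> b < 1 \<Longrightarrow>
      l2norm disk_measure (\<lambda>z. indicator (annulus a b) z *\<^sub>R H z) \<le> sqrt ((b - a) / (1 - b) * ?M) * ?S"
    by (rule disk_solution_gradient_bound[OF \<rho> \<sigma> \<mu> g tr]) (rule that)
  have sH: "square_integrable disk_measure H"
  proof -
    have "H1_trace v H g" using sol by (simp add: dirichlet_solution_def)
    then show ?thesis by (rule H1_trace_square_integrable(2))
  qed
  have "l2norm disk_measure (\<lambda>z. indicator (annulus (\<rho> - \<epsilon>) (\<rho> + \<epsilon>)) z *\<^sub>R H z) \<le> sqrt (4 * \<epsilon> / \<delta>0 * ?M) * ?S"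
  proof (cases "\<epsilon> \<le> \<delta>0 / 2")
    case True
    have "l2norm disk_measure (\<lambda>z. indicator (annulus (\<rho> - \<epsilon>) (\<rho> + \<epsilon>)) z *\<^sub>R H z) \<le>
        sqrt ((\<rho> + \<epsilon> - (\<rho> - \<epsilon>)) / (1 - (\<rho> + \<epsilon>)) * ?M) * ?S"
      by (rule ann) (use True eps \<delta>0 in linarith)+
    also have "\<dots> \<le> sqrt (4 * \<epsilon> / \<delta>0 * ?M) * ?S"
    proof (intro mult_right_mono real_sqrt_le_mono sobolev_norm_nonneg M)
      have "(\<rho> + \<epsilon> - (\<rho> - \<epsilon>)) / (1 - (\<rho> + \<epsilon>)) \<le> (2 * \<epsilon>) / (\<delta>0 / 2)"
        by (rule frac_le) (use True eps \<delta>0 in linarith)+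
      then show "(\<rho> + \<epsilon> - (\<rho> - \<epsilon>)) / (1 - (\<rho> + \<epsilon>)) \<le> 4 * \<epsilon> / \<delta>0" by simp
    qed
    finally show ?thesis .
  next
    case False
    have "l2norm disk_measure (\<lambda>z. indicator (annulus (\<rho> - \<epsilon>) (\<rho> + \<epsilon>)) z *\<^sub>R H z) \<le> l2norm disk_measure H"
      by (rule square_integrable_indicator(2)[OF sH annulus_lebesgue])
    also note full
    also have "sqrt ?M * ?S \<le> sqrt (4 * \<epsilon> / \<delta>0 * ?M) * ?S"
    proof (intro mult_right_mono real_sqrt_le_mono sobolev_norm_nonneg)
      have "1 \<le> 4 * \<epsilon> / \<delta>0" using False \<delta>0 by (simp add: pos_le_divide_eq)
      then have "1 * ?M \<le> 4 * \<epsilon> / \<delta>0 * ?M" by (rule mult_right_mono) (rule M)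
      then show "?M \<le> 4 * \<epsilon> / \<delta>0 * ?M" by simp
    qed
    finally show ?thesis .
  qed
  with sol show thesis by (rule that)
qed

theorem theorem3p4:
  fixes \<sigma>1 \<sigma>2 \<delta>0 \<rho>0 \<alpha> :: real
  assumes "\<sigma>1 > 0" and "\<sigma>2 > 0" and "\<delta>0 > 0" and "\<rho>0 > 0" and "0 < \<alpha>" and "\<alpha> < 1"
  shows "\<exists>C>0. \<forall>\<epsilon> \<rho> D f.
    perturbation_class \<delta>0 \<rho>0 \<epsilon> 0 \<rho> D \<and> closure D \<subseteq> Omega \<and> f \<in> sobolev (1 + \<alpha>) \<longrightarrow>
      dual_sobolev_norm (1/2) (\<lambda>g. DN_map \<sigma>1 \<sigma>2 D f g - DN_map \<sigma>1 \<sigma>2 (ball 0 \<rho>) f g)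
        \<le> ennreal (C * \<epsilon> powr \<alpha> * sobolev_norm (1 + \<alpha>) f)"
proof -
  define \<mu> where "\<mu> = (\<sigma>1 - \<sigma>2) / (\<sigma>1 + \<sigma>2)"
  define d where "d = \<bar>\<sigma>2 - \<sigma>1\<bar>"
  define m where "m = min \<sigma>1 \<sigma>2"
  \<comment> \<open>\<open>w * \<epsilon>\<close> is the number under the square root in the
    estimate on the annulus, for \<open>f\<close> and for \<open>g\<close> alike.\<close>
  define w where "w = 4 / \<delta>0 * (16 * pi / (1 - \<bar>\<mu>\<bar>)\<^sup>2)"
  \<comment> \<open>Depends on \<sigma>1, \<sigma>2 and \<delta>0 only. It is zero when the
    conductivities are equal, hence \<open>C0 + 1\<close> as the positive constant.\<close>
  define C0 where "C0 = d * (1 + d / m) * w"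
  have d0: "0 \<le> d" and m0: "0 < m" using assms by (auto simp: d_def m_def)
  have w0: "0 \<le> w" using assms by (simp add: w_def)
  have C0: "0 \<le> C0" unfolding C0_def using d0 m0 w0 by (intro mult_nonneg_nonneg add_nonneg_nonneg divide_nonneg_pos) auto
  have main: "\<bar>DN_map \<sigma>1 \<sigma>2 D f g - DN_map \<sigma>1 \<sigma>2 (ball 0 \<rho>) f g\<bar> \<le> (C0 + 1) * \<epsilon> powr \<alpha> * sobolev_norm (1 + \<alpha>) f"
    if pc: "perturbation_class \<delta>0 \<rho>0 \<epsilon> 0 \<rho> D" and cl: "closure D \<subseteq> Omega" and f: "f \<in> sobolev (1 + \<alpha>)"
      and g: "g \<in> sobolev (1/2)" "sobolev_norm (1/2) g \<le> 1" for \<epsilon> \<rho> D f g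
  proof -
    have eps: "0 \<le> \<epsilon>" "\<epsilon> < \<rho>0" "\<rho>0 < \<rho>" and sub: "ball 0 \<rho> \<subseteq> Omega0 \<delta>0" and ep: "eps_perturbation \<epsilon> 0 \<rho> D"
      using pc by (simp_all add: perturbation_class_def)
    have er: "\<epsilon> < \<rho>" and \<rho>: "0 < \<rho>" using eps assms by linarith+
    have \<rho>1: "\<rho> \<le> 1 - \<delta>0" by (rule ball_subset_Omega0[OF sub \<rho>])
    have e1: "\<epsilon> < 1" using er \<rho>1 assms by linarith
    have f2: "f \<in> sobolev (1/2)" and fn: "sobolev_norm (1/2) f \<le> sobolev_norm (1 + \<alpha>) f"
      using sobolev_mono[OF f, of "1/2"] assms by auto
    have rhs: "0 \<le> (C0 + 1) * \<epsilon> powr \<alpha> * sobolev_norm (1 + \<alpha>) f"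
      using C0 by (intro mult_nonneg_nonneg sobolev_norm_nonneg) auto
    show ?thesis
    proof (cases "(\<nexists>u G. H1_trace u G f) \<or> (\<nexists>v H. H1_trace v H g)")
      case True
      show ?thesis using rhs unfolding DN_map_undefined[OF True, of \<sigma>1 \<sigma>2 D "ball 0 \<rho>"] by simp
    next
      case False
      then obtain u0 G0 v0 H0 where tr: "H1_trace u0 G0 f" "H1_trace v0 H0 g" by auto
      have dm: "\<delta>0 > 0" "\<sigma>1 > 0" "\<sigma>2 > 0" by fact+
      obtain u G where u: "dirichlet_solution (conductivity \<sigma>1 \<sigma>2 (ball 0 \<rho>)) f u G"
        and uG: "l2norm disk_measure (\<lambda>z. indicator (annulus (\<rho> - \<epsilon>) (\<rho> + \<epsilon>)) z *\<^sub>R G z) \<le> sqrt (4 * \<epsilon> / \<delta>0 * (16 * pi / (1 - \<bar>\<mu>\<bar>)\<^sup>2)) * sobolev_norm (1/2) f"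
        by (rule thin_annulus_gradient_bound[OF dm(1) \<rho>1 eps(1) er dm(2,3) \<mu>_def f2 tr(1)])
      obtain v H where v: "dirichlet_solution (conductivity \<sigma>1 \<sigma>2 (ball 0 \<rho>)) g v H"
        and vH: "l2norm disk_measure (\<lambda>z. indicator (annulus (\<rho> - \<epsilon>) (\<rho> + \<epsilon>)) z *\<^sub>R H z) \<le> sqrt (4 * \<epsilon> / \<delta>0 * (16 * pi / (1 - \<bar>\<mu>\<bar>)\<^sup>2)) * sobolev_norm (1/2) g"
        by (rule thin_annulus_gradient_bound[OF dm(1) \<rho>1 eps(1) er dm(2,3) \<mu>_def g(1) tr(2)])
      have we: "4 * \<epsilon> / \<delta>0 * (16 * pi / (1 - \<bar>\<mu>\<bar>)\<^sup>2) = w * \<epsilon>" by (simp add: w_def)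
      have "open D" using ep by (simp add: eps_perturbation_def C2_domain_def)
      then have Dl: "D \<in> sets lebesgue" by (simp add: sets_completionI_sets)
      have "D \<subseteq> Omega" using cl closure_subset by blast
      note ann = eps_perturbation_annulus[OF eps(1) er ep this]
      \<comment> \<open>Off the annulus a point lies in both D and the disk or in neither; on it the
        coefficients differ by at most \<open>d\<close>.\<close>
      have diff: "\<bar>conductivity \<sigma>1 \<sigma>2 D z - conductivity \<sigma>1 \<sigma>2 (ball 0 \<rho>) z\<bar> \<le> d * indicator (annulus (\<rho> - \<epsilon>) (\<rho> + \<epsilon>)) z" for z
      proof -
        consider "z \<in> D" "z \<in> ball 0 \<rho>" | "z \<notin> D" "z \<notin> ball 0 \<rho>" | "z \<in> D" "z \<notin> ball 0 \<rho>" | "z \<notin> D" "z \<in> ball 0 \<rho>" by blast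
        then show ?thesis
        proof cases
          case 3
          then have "z \<in> annulus (\<rho> - \<epsilon>) (\<rho> + \<epsilon>)" using ann(1)[of z] eps by (simp add: annulus_def)
          with 3 show ?thesis by (simp add: conductivity_def d_def)
        next
          case 4
          then have "z \<in> annulus (\<rho> - \<epsilon>) (\<rho> + \<epsilon>)" using ann(2)[of z] eps by (force simp: annulus_def)
          with 4 show ?thesis by (simp add: conductivity_def d_def)
        qed (use d0 in \<open>auto simp: conductivity_def\<close>)
      qed
      have "\<bar>DN_map \<sigma>1 \<sigma>2 D f g - DN_map \<sigma>1 \<sigma>2 (ball 0 \<rho>) f g\<bar> \<le>
        d * (1 + d / m) * l2norm disk_measure (\<lambda>z. indicator (annulus (\<rho> - \<epsilon>) (\<rho> + \<epsilon>)) z *\<^sub>R G z)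
          * l2norm disk_measure (\<lambda>z. indicator (annulus (\<rho> - \<epsilon>) (\<rho> + \<epsilon>)) z *\<^sub>R H z)"
        unfolding m_def
        by (rule DN_map_perturbation[OF bounded_coefficient_conductivity bounded_coefficient_conductivity annulus_lebesgue diff d0 u v])
          (use dm Dl in auto)
      \<comment> \<open>Each of the two data contributes one factor
        \<open>sqrt (w * \<epsilon>)\<close>, and the product is the full first power of
        \<epsilon>.\<close>
      also have "\<dots> \<le> d * (1 + d / m) * (sqrt (w * \<epsilon>) * sobolev_norm (1/2) f) * (sqrt (w * \<epsilon>) * 1)"
      proof (intro mult_mono order_refl)
        show "l2norm disk_measure (\<lambda>z. indicator (annulus (\<rho> - \<epsilon>) (\<rho> + \<epsilon>)) z *\<^sub>R G z) \<le> sqrt (w * \<epsilon>) * sobolev_norm (1/2) f"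
          using uG unfolding we .
        have "sqrt (w * \<epsilon>) * sobolev_norm (1/2) g \<le> sqrt (w * \<epsilon>) * 1"
          using g(2) w0 eps by (intro mult_left_mono) auto
        then show "l2norm disk_measure (\<lambda>z. indicator (annulus (\<rho> - \<epsilon>) (\<rho> + \<epsilon>)) z *\<^sub>R H z) \<le> sqrt (w * \<epsilon>) * 1"
          using vH unfolding we by linarith
      qed (use d0 m0 w0 eps sobolev_norm_nonneg[of "1/2" f] in \<open>auto intro!: mult_nonneg_nonneg add_nonneg_nonneg\<close>)
      also have "\<dots> = d * (1 + d / m) * (sqrt (w * \<epsilon>) * sqrt (w * \<epsilon>)) * sobolev_norm (1/2) f" by simp
      also have "sqrt (w * \<epsilon>) * sqrt (w * \<epsilon>) = w * \<epsilon>" using w0 eps by simp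
      also have "d * (1 + d / m) * (w * \<epsilon>) * sobolev_norm (1/2) f = C0 * \<epsilon> * sobolev_norm (1/2) f" by (simp add: C0_def)
      also have "\<dots> \<le> (C0 + 1) * \<epsilon> powr \<alpha> * sobolev_norm (1 + \<alpha>) f"
      proof (intro mult_mono fn)
        \<comment> \<open>Since \<epsilon> < \<rho> <= 1 - \<delta>0, the base is below 1 and
          lowering the exponent from 1 to \<alpha> increases the power. For \<epsilon> = 0 both
          sides are zero.\<close>
        show "\<epsilon> \<le> \<epsilon> powr \<alpha>"
        proof (cases "\<epsilon> = 0")
          case False
          then have "\<epsilon> = \<epsilon> powr 1" using eps by simp
          also have "\<dots> \<le> \<epsilon> powr \<alpha>" using e1 eps assms by (intro powr_mono') auto
          finally show ?thesis .
        qed simp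
      qed (use C0 eps sobolev_norm_nonneg in auto)
      finally show ?thesis .
    qed
  qed
  show ?thesis
  proof (intro exI[of _ "C0 + 1"] conjI allI impI)
    show "0 < C0 + 1" using C0 by simp
    fix \<epsilon> \<rho> D f
    assume a: "perturbation_class \<delta>0 \<rho>0 \<epsilon> 0 \<rho> D \<and> closure D \<subseteq> Omega \<and> f \<in> sobolev (1 + \<alpha>)"
    show "dual_sobolev_norm (1/2) (\<lambda>g. DN_map \<sigma>1 \<sigma>2 D f g - DN_map \<sigma>1 \<sigma>2 (ball 0 \<rho>) f g)
        \<le> ennreal ((C0 + 1) * \<epsilon> powr \<alpha> * sobolev_norm (1 + \<alpha>) f)"
      unfolding dual_sobolev_norm_def by (intro SUP_least ennreal_leI) (use main a in auto)
  qed
qed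

end
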